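(* Let $\alpha\in(0,2)$ and $\theta\in\tilde{\mathcal E}$. The free boundary $b=(b_t)_{t\in[0,T]}$ associated with $\theta$ is a continuous and non-increasing solution to the integral equation $$\mathbb E\Big[\int_0^{T}e^{-\rho s}\big(X^{b_0}_s-\alpha(2-\alpha)\theta_{s}-\rho K\big)\mathbf 1_{\{X^{b_0}_s\le b_{s}\}}\,ds\Big]=0.$$ Moreover, $b=(b_t)_{t\in[0,T]}$ is the unique solution of this equation in the class of continuous non-increasing functions such that $b_t\ge\alpha(2-\alpha)\theta_t+\rho K$ for any $t\in[0,T]$.
   Context: $T>0$, $\sigma>0$, $\rho>0$, $K>0$ are constants and $x\in\mathbb R$ is the fixed initial state; $(\Omega,\mathcal F,\mathbb F,\mathbb P)$ is a complete filtered probability space satisfying the usual conditions with a one-dimensional $\mathbb F$-Brownian motion $W$. For $y\in\mathbb R$, $X^y_s=y+\sigma W_s$; in particular $X^{b_0}_s=b_0+\sigma W_s$. $\Theta$ is the set of bounded, non-increasing, càdlàg functions $\theta:[0,T]\to\mathbb R$. For $\theta\in\Theta$ and $(t,y)\in[0,T]\times\mathbb R$ let $\mathcal T_t$ be the set of $\mathbb F$-stopping times with values in $[0,T-t]$ and $$v(t,y)=\inf_{\tau\in\mathcal T_t}\mathbb E\Big[\int_0^\tau e^{-\rho s}\big(X^y_s-\alpha(2-\alpha)\theta_{s+t}\big)ds+Ke^{-\rho\tau}\Big].$$ The free boundary associated with $\theta$ is $b_t=b_t(\theta)=\inf\{y\in\mathbb R:\ v(t,y)\ge K\}$, $t\in[0,T]$,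 with $\inf\emptyset=+\infty$. Put $\xi^*_t(\theta)=\sup_{s\in[0,t]}(x+\sigma W_s-b_s(\theta))^+$. $\delta$ is a sufficiently large positive constant depending on $\sigma,T,x,\alpha,K,\rho$; for $\delta$ sufficiently large one has $\mathbb E[\xi^*_T(\theta)]\le\delta$ both when $\theta\equiv x-\delta$ and when $\theta\equiv x$. Then $\mathcal E=\{\theta\in\Theta:\ x-\delta\le\theta_t\le x,\ t\in[0,T]\}$ and $\tilde{\mathcal E}=\{\theta\in\mathcal E:\ t\mapsto\theta_t\text{ is continuous and }\theta_0=x\}$.
   Formalization: The equation is required from every start (t,b_t), t in [0,T], with X^{b_t}_s, θ_{t+s}, b_{t+s} on [0,T-t]: for t=0 alone uniqueness fails (for θ≡x a constant also solves it). b_T is the left limit b_{T-}, since v(T,·)=K would give b_T=-∞. *)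

theory Defs
  imports "HOL-Probability.Probability"
begin

(* The time index of the filtration is the type real because the library notions of filtration and
   stopping time are indexed by a type. Only the sigma-algebras F t with t >= 0 carry information:
   all stopping times below are nonnegative, so the events {tau <= t} with t < 0 are empty. *)
locale usual_filtered_space = prob_space M + complete_measure M + filtration "space M" F
  for M :: "'a measure" and F :: "real \<Rightarrow> 'a measure" +
  assumes sets_F_subset: "sets (F t) \<subseteq> sets M"
    and null_sets_F0: "null_sets M \<subseteq> sets (F 0)"
    and right_continuous_F: "0 \<le> t \<Longrightarrow> sets (F t) = (\<Inter>s\<in>{t<..}. sets (F s))"

locale filtered_brownian_motion = usual_filtered_space M F
  for M :: "'a measure" and F :: "real \<Rightarrow> 'a measure" +
  fixes W :: "real \<Rightarrow> 'a \<Rightarrow> real"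
  assumes W_adapted: "0 \<le> t \<Longrightarrow> W t \<in> borel_measurable (F t)"
    and W_0: "AE \<omega> in M. W 0 \<omega> = 0"
    and W_continuous: "AE \<omega> in M. continuous_on {0..} (\<lambda>t. W t \<omega>)"
    and W_increment: "0 \<le> s \<Longrightarrow> s < t \<Longrightarrow>
      distributed M lborel (\<lambda>\<omega>. W t \<omega> - W s \<omega>) (normal_density 0 (sqrt (t - s)))"
    and W_indep: "0 \<le> s \<Longrightarrow> s < t \<Longrightarrow>
      indep_set (sets (F s)) {(\<lambda>\<omega>. W t \<omega> - W s \<omega>) -` B \<inter> space M | B. B \<in> sets borel}"

definition X_proc :: "real \<Rightarrow> (real \<Rightarrow> 'a \<Rightarrow> real) \<Rightarrow> real \<Rightarrow> real \<Rightarrow> 'a \<Rightarrow> real" where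
  "X_proc \<sigma> W y s \<omega> = y + \<sigma> * W s \<omega>"

definition cadlag_on_Icc :: "real \<Rightarrow> (real \<Rightarrow> real) \<Rightarrow> bool" where
  "cadlag_on_Icc T f \<longleftrightarrow>
     (\<forall>t\<in>{0..<T}. (f \<longlongrightarrow> f t) (at_right t)) \<and> (\<forall>t\<in>{0<..T}. \<exists>l. (f \<longlongrightarrow> l) (at_left t))"

(* Functions on [0,T] are functions on the real line whose values outside [0,T] are irrelevant. *)
definition Theta :: "real \<Rightarrow> (real \<Rightarrow> real) set" where
  "Theta T = {\<theta>. bounded (\<theta> ` {0..T}) \<and> antimono_on {0..T} \<theta> \<and> cadlag_on_Icc T \<theta>}"

definition E_set :: "real \<Rightarrow> real \<Rightarrow> real \<Rightarrow> (real \<Rightarrow> real) set" where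
  "E_set T x \<delta> = {\<theta> \<in> Theta T. \<forall>t\<in>{0..T}. x - \<delta> \<le> \<theta> t \<and> \<theta> t \<le> x}"

definition E_tilde :: "real \<Rightarrow> real \<Rightarrow> real \<Rightarrow> (real \<Rightarrow> real) set" where
  "E_tilde T x \<delta> = {\<theta> \<in> E_set T x \<delta>. continuous_on {0..T} \<theta> \<and> \<theta> 0 = x}"

definition stopping_times_upto :: "'a measure \<Rightarrow> (real \<Rightarrow> 'a measure) \<Rightarrow> real \<Rightarrow> ('a \<Rightarrow> real) set" where
  "stopping_times_upto M F u = {\<tau>. stopping_time F \<tau> \<and> (\<forall>\<omega>\<in>space M. \<tau> \<omega> \<in> {0..u})}"

definition value_fun ::
  "'a measure \<Rightarrow> (real \<Rightarrow> 'a measure) \<Rightarrow> (real \<Rightarrow> 'a \<Rightarrow> real) \<Rightarrow>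
   real \<Rightarrow> real \<Rightarrow> real \<Rightarrow> real \<Rightarrow> real \<Rightarrow> (real \<Rightarrow> real) \<Rightarrow> real \<Rightarrow> real \<Rightarrow> real" where
  "value_fun M F W T \<sigma> \<rho> K \<alpha> \<theta> t y =
     (INF \<tau>\<in>stopping_times_upto M F (T - t).
        prob_space.expectation M (\<lambda>\<omega>.
          (LBINT s:{0..\<tau> \<omega>}. exp (- \<rho> * s) * (X_proc \<sigma> W y s \<omega> - \<alpha> * (2 - \<alpha>) * \<theta> (s + t)))
          + K * exp (- \<rho> * \<tau> \<omega>)))"

(* For t < T this is inf {y. v(t,y) >= K} with inf of the empty set equal to infinity. At t = T the
   only admissible stopping time is 0, so v(T,y) = K for every y and the same formula would give
   -infinity; the boundary at the terminal time is therefore the left limit. *)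
definition free_boundary ::
  "'a measure \<Rightarrow> (real \<Rightarrow> 'a measure) \<Rightarrow> (real \<Rightarrow> 'a \<Rightarrow> real) \<Rightarrow>
   real \<Rightarrow> real \<Rightarrow> real \<Rightarrow> real \<Rightarrow> real \<Rightarrow> (real \<Rightarrow> real) \<Rightarrow> real \<Rightarrow> ereal" where
  "free_boundary M F W T \<sigma> \<rho> K \<alpha> \<theta> t =
     (let b = (\<lambda>u. Inf {ereal y | y. value_fun M F W T \<sigma> \<rho> K \<alpha> \<theta> u y \<ge> K})
      in if t < T then b t else Lim (at_left T) b)"

(* Left-hand side of the integral equation for the function b, started at the boundary point b t at
   time t. For t = 0 it is the expectation of the integral over [0,T] involving X started at b 0. *)
definition boundary_lhs ::
  "'a measure \<Rightarrow> (real \<Rightarrow> 'a \<Rightarrow> real) \<Rightarrow>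
   real \<Rightarrow> real \<Rightarrow> real \<Rightarrow> real \<Rightarrow> real \<Rightarrow> (real \<Rightarrow> real) \<Rightarrow> (real \<Rightarrow> real) \<Rightarrow> real \<Rightarrow> real" where
  "boundary_lhs M W T \<sigma> \<rho> K \<alpha> \<theta> b t =
     prob_space.expectation M (\<lambda>\<omega>.
       LBINT s:{0..T - t}. exp (- \<rho> * s)
         * (X_proc \<sigma> W (b t) s \<omega> - \<alpha> * (2 - \<alpha>) * \<theta> (t + s) - \<rho> * K)
         * indicator {..b (t + s)} (X_proc \<sigma> W (b t) s \<omega>))"

lemma boundary_lhs_0:
  "boundary_lhs M W T \<sigma> \<rho> K \<alpha> \<theta> b 0 =
     prob_space.expectation M (\<lambda>\<omega>.
       LBINT s:{0..T}. exp (- \<rho> * s)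
         * (X_proc \<sigma> W (b 0) s \<omega> - \<alpha> * (2 - \<alpha>) * \<theta> s - \<rho> * K)
         * indicator {..b s} (X_proc \<sigma> W (b 0) s \<omega>))"
  by (simp add: boundary_lhs_def)

(* A scalar equation at the single starting time 0 cannot determine a function (for constant theta
   it also has a constant solution), so b solves the equation if it does so from every starting
   point (t, b t). *)
definition solves_boundary_equation ::
  "'a measure \<Rightarrow> (real \<Rightarrow> 'a \<Rightarrow> real) \<Rightarrow>
   real \<Rightarrow> real \<Rightarrow> real \<Rightarrow> real \<Rightarrow> real \<Rightarrow> (real \<Rightarrow> real) \<Rightarrow> (real \<Rightarrow> real) \<Rightarrow> bool" where
  "solves_boundary_equation M W T \<sigma> \<rho> K \<alpha> \<theta> b \<longleftrightarrow>
     (\<forall>t\<in>{0..T}. boundary_lhs M W T \<sigma> \<rho> K \<alpha> \<theta> b t = 0)"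

definition solution_class :: "real \<Rightarrow> real \<Rightarrow> real \<Rightarrow> real \<Rightarrow> (real \<Rightarrow> real) \<Rightarrow> (real \<Rightarrow> real) set" where
  "solution_class T \<rho> K \<alpha> \<theta> =
     {b. continuous_on {0..T} b \<and> antimono_on {0..T} b \<and>
         (\<forall>t\<in>{0..T}. b t \<ge> \<alpha> * (2 - \<alpha>) * \<theta> t + \<rho> * K)}"

end

theory Submission
  imports Defs
begin

text \<open>
  Write \<open>f = \<alpha>(2-\<alpha>)\<theta> + \<rho>K\<close> and \<open>u = K - v\<close>; then \<open>u\<close> is the value of stopping the running gain \<open>f - X\<close>
  with no terminal reward. No stochastic calculus is used. Approximating by Bermudan problems with
  exercise dates on a grid, one telescopes the backward recursion and passes to the limit by dominated
  convergence (a monotone boundary is continuous almost everywhere). This gives the early exercise premium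
  formula \<open>u(t,y) = E \<integral> exp(-\<rho>s) (f(t+s) - X\<^sub>s) 1{X\<^sub>s \<le> b(t+s)} ds\<close>, without smooth fit or local times; evaluated at
  \<open>y = b(t)\<close> it is the integral equation. Continuity of \<open>b\<close> follows from the formula, because stopping is
  strictly better than waiting at points above \<open>f\<close> from which \<open>u\<close> vanishes soon.

  For uniqueness, a second solution \<open>c\<close> defines \<open>w\<close> by the same formula with \<open>c\<close> in place of \<open>b\<close>. Peskir's four
  comparisons (\<open>w = 0\<close> above \<open>c\<close>; \<open>w \<le> u\<close>; \<open>c \<le> b\<close>; \<open>b \<le> c\<close>), which usually rest on the strong Markov property at
  hitting times, are obtained from a weak maximum principle for functions satisfying the semigroup identity.
\<close>

section \<open>The Gaussian semigroup\<close>

text \<open>Randomness enters through the events \<open>{s < \<tau>}\<close> only. After Fubini the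
  gain of a stopping time is a time integral of expectations restricted to such an event, which lies
  in \<open>F s\<close>; so the Markov property at deterministic times, restricted to events of the
  past, is all that the process has to supply. Everything after the Bermudan bounds is about the
  Gaussian semigroup and functions of \<open>(t, y)\<close>.

  The functions \<open>u\<close> and \<open>w\<close> are not known to be differentiable, so no
  generator can be applied to them. Its place is taken by the flow identity over a short time
  \<open>r\<close> (\<open>G_flow\<close>). A source that is strictly negative near the starting
  point contributes at order \<open>r\<close>, whatever happens at a fixed distance contributes at
  order \<open>r\<^sup>2\<close> (\<open>heat_local\<close>), and \<open>r\<close> tending to 0
  gives the contradiction. This one comparison yields the left continuity of \<open>b\<close>, the
  maximum principle and the exclusion of \<open>c > b\<close>. It looks forward in time only, so
  that above a non-increasing boundary monotonicity alone supplies the neighbourhood in which it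
  takes place.\<close>

definition stdN :: "real measure" where
  "stdN = density lborel (\<lambda>x. ennreal (std_normal_density x))"

lemma space_stdN [simp]: "space stdN = UNIV"
  and sets_stdN [simp, measurable_cong]: "sets stdN = sets borel"
  by (simp_all add: stdN_def)

interpretation stdN: prob_space stdN
  unfolding stdN_def by (rule prob_space_normal_density) simp

lemma prob_stdN_UNIV [simp]: "measure stdN UNIV = 1"
  using stdN.prob_space by simp

lemma integrable_stdN_iff:
  "g \<in> borel_measurable borel \<Longrightarrow> integrable stdN g \<longleftrightarrow> integrable lborel (\<lambda>z. std_normal_density z * g z)"
  for g :: "real \<Rightarrow> real"
  unfolding stdN_def by (subst integrable_density) auto

lemma integral_stdN:
  "g \<in> borel_measurable borel \<Longrightarrow> integral\<^sup>L stdN g = (\<integral>z. std_normal_density z * g z \<partial>lborel)"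
  for g :: "real \<Rightarrow> real"
  unfolding stdN_def by (subst integral_density) auto

lemma integrable_stdN_power [simp]: "integrable stdN (\<lambda>z. z ^ k)"
  by (simp add: integrable_stdN_iff integrable_std_normal_moment)

lemma integrable_stdN_id [simp]: "integrable stdN (\<lambda>z. z)"
  using integrable_stdN_power[of 1] by simp

lemma integral_stdN_id [simp]: "(\<integral>z. z \<partial>stdN) = 0"
  using integral_std_normal_moment_odd[of 0] by (simp add: integral_stdN)

lemma integral_stdN_sq [simp]: "(\<integral>z. z\<^sup>2 \<partial>stdN) = 1"
  using integral_std_normal_moment_even[of 1] by (simp add: integral_stdN)

lemma integral_stdN_pow4 [simp]: "(\<integral>z. z ^ 4 \<partial>stdN) = 3"
  using integral_std_normal_moment_even[of 2] by (simp add: integral_stdN fact_numeral)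

lemma integral_stdN_pow6 [simp]: "(\<integral>z. z ^ 6 \<partial>stdN) = 15"
  using integral_std_normal_moment_even[of 3] by (simp add: integral_stdN fact_numeral)

lemma abs_le_square: "\<bar>x\<bar> \<le> (1 + x\<^sup>2) / 2" for x :: real
proof -
  have "0 \<le> (\<bar>x\<bar> - 1)\<^sup>2" by simp
  then show ?thesis by (simp add: power2_eq_square algebra_simps)
qed

lemma integrable_stdN_abs [simp]: "integrable stdN (\<lambda>z. \<bar>z\<bar>)"
  by (rule integrable_abs) simp

lemma integral_stdN_abs: "(\<integral>z. \<bar>z\<bar> \<partial>stdN) \<le> 1"
proof -
  have "(\<integral>z. \<bar>z\<bar> \<partial>stdN) \<le> (\<integral>z. (1 + z\<^sup>2) / 2 \<partial>stdN)"
    using abs_le_square by (intro integral_mono) auto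
  also have "\<dots> = 1"
    by (simp add: stdN.prob_space)
  finally show ?thesis .
qed

lemma AE_stdN_lborel: "(AE z in lborel. Q z) \<Longrightarrow> AE z in stdN. Q z"
  unfolding stdN_def by (subst AE_density) auto

lemma AE_stdN_neq: "AE z in stdN. z \<noteq> a"
  by (rule AE_stdN_lborel) (rule AE_lborel_singleton)

text \<open>The transition operator of \<open>y + \<sigma> W\<close>, written over one fixed
  measure: state and time occur in the integrand only, so limits in both are taken by dominated
  convergence under \<open>stdN\<close>, and \<open>s = 0\<close> gives the identity without a
  degenerate law.\<close>

definition heat :: "real \<Rightarrow> real \<Rightarrow> (real \<Rightarrow> real) \<Rightarrow> real \<Rightarrow> real" where
  "heat \<sigma> s g y = (\<integral>z. g (y + \<sigma> * sqrt s * z) \<partial>stdN)"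

definition qbound :: "real \<Rightarrow> (real \<Rightarrow> real) \<Rightarrow> bool" where
  "qbound C g \<longleftrightarrow> g \<in> borel_measurable borel \<and> (\<forall>x. \<bar>g x\<bar> \<le> C * (1 + x\<^sup>2))"

lemma qboundI: "g \<in> borel_measurable borel \<Longrightarrow> (\<And>x. \<bar>g x\<bar> \<le> C * (1 + x\<^sup>2)) \<Longrightarrow> qbound C g"
  and qbound_measurable [measurable_dest]: "qbound C g \<Longrightarrow> g \<in> borel_measurable borel"
  and qboundD: "qbound C g \<Longrightarrow> \<bar>g x\<bar> \<le> C * (1 + x\<^sup>2)"
  unfolding qbound_def by auto

lemma qbound_nonneg: "qbound C g \<Longrightarrow> 0 \<le> C"
  using qboundD[of C g 0] by simp

lemma qbound_linear:
  assumes "g \<in> borel_measurable borel" "\<And>x. \<bar>g x\<bar> \<le> a + b * \<bar>x\<bar>" "0 \<le> a" "0 \<le> b"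
  shows "qbound (a + b) g"
proof (rule qboundI)
  fix x :: real
  have "b * \<bar>x\<bar> \<le> b * (1 + x\<^sup>2)"
    using assms(4) abs_le_square[of x] by (intro mult_left_mono) (auto simp: add_nonneg_nonneg field_simps)
  then have "a + b * \<bar>x\<bar> \<le> (a + b) * (1 + x\<^sup>2)"
    using assms(3) mult_nonneg_nonneg[OF assms(3) zero_le_power2[of x]] unfolding distrib_left distrib_right by linarith
  with assms(2)[of x] show "\<bar>g x\<bar> \<le> (a + b) * (1 + x\<^sup>2)"
    by linarith
qed (rule assms)

lemma integrable_stdN_shift_sq [simp]: "integrable stdN (\<lambda>z. (y + c * z)\<^sup>2)"
  by (simp add: power2_sum power_mult_distrib)

lemma qbound_integrable [simp, intro]:
  assumes "qbound C g"
  shows "integrable stdN (\<lambda>z. g (y + c * z))"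
proof (rule Bochner_Integration.integrable_bound)
  show "integrable stdN (\<lambda>z. C * (1 + (y + c * z)\<^sup>2))"
    by simp
  show "(\<lambda>z. g (y + c * z)) \<in> borel_measurable stdN"
    using qbound_measurable[OF assms] by measurable
  show "AE z in stdN. norm (g (y + c * z)) \<le> norm (C * (1 + (y + c * z)\<^sup>2))"
  proof (rule AE_I2)
    fix z
    have "0 \<le> C * (1 + (y + c * z)\<^sup>2)"
      using qbound_nonneg[OF assms] by simp
    then show "norm (g (y + c * z)) \<le> norm (C * (1 + (y + c * z)\<^sup>2))"
      using qboundD[OF assms, of "y + c * z"] by simp
  qed
qed

lemma heat_0 [simp]: "heat \<sigma> 0 g y = g y"
  by (simp add: heat_def stdN.prob_space)

lemma heat_const [simp]: "heat \<sigma> s (\<lambda>x. c) y = c"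
  by (simp add: heat_def stdN.prob_space)


lemma heat_affine [simp]: "heat \<sigma> s (\<lambda>x. c - x) y = c - y"
  by (simp add: heat_def)

lemma heat_sq:
  assumes "0 \<le> s"
  shows "heat \<sigma> s (\<lambda>x. (x - a)\<^sup>2) y = (y - a)\<^sup>2 + \<sigma>\<^sup>2 * s"
proof -
  have "heat \<sigma> s (\<lambda>x. (x - a)\<^sup>2) y = (\<integral>z. (y - a)\<^sup>2 + (\<sigma>\<^sup>2 * s) * z\<^sup>2 + (2 * (y - a) * \<sigma> * sqrt s) * z \<partial>stdN)"
    unfolding heat_def
  proof (rule Bochner_Integration.integral_cong[OF refl])
    fix z
    have "(sqrt s)\<^sup>2 = s" using assms by simp
    moreover have "(y + \<sigma> * sqrt s * z - a)\<^sup>2 = (y - a)\<^sup>2 + (\<sigma>\<^sup>2 * (sqrt s)\<^sup>2) * z\<^sup>2 + (2 * (y - a) * \<sigma> * sqrt s) * z"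
      by algebra
    ultimately show "(y + \<sigma> * sqrt s * z - a)\<^sup>2 = (y - a)\<^sup>2 + (\<sigma>\<^sup>2 * s) * z\<^sup>2 + (2 * (y - a) * \<sigma> * sqrt s) * z"
      by simp
  qed
  then show ?thesis by (simp add: stdN.prob_space)
qed

lemma heat_add: "qbound C g \<Longrightarrow> qbound D k \<Longrightarrow> heat \<sigma> s (\<lambda>x. g x + k x) y = heat \<sigma> s g y + heat \<sigma> s k y"
  unfolding heat_def by (rule Bochner_Integration.integral_add) (auto intro: qbound_integrable)

lemma heat_diff: "qbound C g \<Longrightarrow> qbound D k \<Longrightarrow> heat \<sigma> s (\<lambda>x. g x - k x) y = heat \<sigma> s g y - heat \<sigma> s k y"
  unfolding heat_def by (rule Bochner_Integration.integral_diff) (auto intro: qbound_integrable)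

lemma heat_cmult: "heat \<sigma> s (\<lambda>x. c * g x) y = c * heat \<sigma> s g y"
  unfolding heat_def by simp

lemma heat_mono: "qbound C g \<Longrightarrow> qbound D k \<Longrightarrow> (\<And>x. g x \<le> k x) \<Longrightarrow> heat \<sigma> s g y \<le> heat \<sigma> s k y"
  unfolding heat_def by (rule integral_mono) (auto intro: qbound_integrable)

lemma heat_nonneg: "(\<And>x. 0 \<le> g x) \<Longrightarrow> 0 \<le> heat \<sigma> s g y"
  unfolding heat_def by (rule Bochner_Integration.integral_nonneg) auto

lemma qbound_const: "qbound \<bar>c\<bar> (\<lambda>x. c)"
  by (rule qboundI) (auto simp: mult_le_cancel_left1 intro: mult_left_mono[of 1 "1 + _", simplified])

lemma qbound_weaken: "qbound C g \<Longrightarrow> C \<le> D \<Longrightarrow> qbound D g"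
  unfolding qbound_def by (meson add_nonneg_nonneg mult_right_mono order_trans zero_le_one zero_le_power2)

lemma qbound_add: "qbound C g \<Longrightarrow> qbound D k \<Longrightarrow> qbound (C + D) (\<lambda>x. g x + k x)"
  unfolding qbound_def by (auto simp: distrib_right intro: order_trans[OF abs_triangle_ineq add_mono])

lemma qbound_uminus: "qbound C g \<Longrightarrow> qbound C (\<lambda>x. - g x)"
  unfolding qbound_def by auto


lemma qbound_cmult: "qbound C g \<Longrightarrow> qbound (\<bar>c\<bar> * C) (\<lambda>x. c * g x)"
  unfolding qbound_def by (auto simp: abs_mult mult.assoc intro: mult_left_mono)

lemma heat_abs_le:
  assumes g: "qbound C g" and s: "0 \<le> s"
  shows "\<bar>heat \<sigma> s g y\<bar> \<le> C * (1 + y\<^sup>2 + \<sigma>\<^sup>2 * s)"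
proof -
  have q: "qbound C (\<lambda>x. C * (1 + x\<^sup>2))"
    using qbound_nonneg[OF g] by (intro qboundI) auto
  have e: "heat \<sigma> s (\<lambda>x. C * (1 + x\<^sup>2)) y = C * (1 + y\<^sup>2 + \<sigma>\<^sup>2 * s)"
  proof -
    have "heat \<sigma> s (\<lambda>x. 1 + (x - 0)\<^sup>2) y = heat \<sigma> s (\<lambda>x. 1) y + heat \<sigma> s (\<lambda>x. (x - 0)\<^sup>2) y"
      by (rule heat_add[OF qbound_const, of 1]) (auto intro!: qboundI[of _ 1])
    then show ?thesis using heat_sq[OF s, of \<sigma> 0 y] heat_cmult[of \<sigma> s C "\<lambda>x. 1 + x\<^sup>2"] by simp
  qed
  have "\<bar>g x\<bar> \<le> C * (1 + x\<^sup>2)" for x using qboundD[OF g] .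
  then have "heat \<sigma> s g y \<le> C * (1 + y\<^sup>2 + \<sigma>\<^sup>2 * s)" "heat \<sigma> s (\<lambda>x. - 1 * g x) y \<le> C * (1 + y\<^sup>2 + \<sigma>\<^sup>2 * s)"
    unfolding e[symmetric]
    using heat_mono[OF g q] heat_mono[OF qbound_uminus[OF g] q] by (auto simp: abs_le_iff)
  then show ?thesis unfolding heat_cmult by simp
qed

lemma abs_shift_le:
  assumes "0 \<le> \<sigma>" "0 \<le> s"
  shows "\<bar>y + \<sigma> * sqrt s * z\<bar> \<le> \<bar>y\<bar> + \<sigma> * sqrt s * \<bar>z\<bar>"
  using abs_triangle_ineq[of y "\<sigma> * sqrt s * z"] assms by (simp add: abs_mult)

text \<open>The first absolute moment of \<open>stdN\<close> is at most 1, so the mean displacement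
  is at most \<open>\<sigma> * sqrt s\<close>. Unlike the quadratic estimate this keeps linear
  growth linear, which gives the bounds uniform in time.\<close>

lemma heat_abs_le_linear:
  assumes "g \<in> borel_measurable borel" "\<And>x. \<bar>g x\<bar> \<le> a + b * \<bar>x\<bar>" "0 \<le> a" "0 \<le> b" and s: "0 \<le> s" and \<sigma>: "0 \<le> \<sigma>"
  shows "\<bar>heat \<sigma> s g y\<bar> \<le> a + b * (\<bar>y\<bar> + \<sigma> * sqrt s)"
proof -
  have q: "qbound (a + b) g" by (rule qbound_linear[OF assms(1-4)])
  have "\<bar>heat \<sigma> s g y\<bar> \<le> (\<integral>z. \<bar>g (y + \<sigma> * sqrt s * z)\<bar> \<partial>stdN)"
    unfolding heat_def by (rule integral_abs_bound)
  also have "\<dots> \<le> (\<integral>z. (a + b * \<bar>y\<bar>) + (b * \<sigma> * sqrt s) * \<bar>z\<bar> \<partial>stdN)"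
  proof (rule integral_mono)
    fix z
    have "\<bar>g (y + \<sigma> * sqrt s * z)\<bar> \<le> a + b * \<bar>y + \<sigma> * sqrt s * z\<bar>"
      by (rule assms)
    also have "\<bar>y + \<sigma> * sqrt s * z\<bar> \<le> \<bar>y\<bar> + \<sigma> * sqrt s * \<bar>z\<bar>"
      by (rule abs_shift_le[OF \<sigma> s])
    finally have "\<bar>g (y + \<sigma> * sqrt s * z)\<bar> \<le> a + b * (\<bar>y\<bar> + \<sigma> * sqrt s * \<bar>z\<bar>)"
      using \<open>0 \<le> b\<close> by (simp add: mult_left_mono)
    then show "\<bar>g (y + \<sigma> * sqrt s * z)\<bar> \<le> (a + b * \<bar>y\<bar>) + (b * \<sigma> * sqrt s) * \<bar>z\<bar>"
      by (simp add: algebra_simps)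
  qed (use q in \<open>auto intro!: integrable_abs qbound_integrable\<close>)
  also have "\<dots> = (a + b * \<bar>y\<bar>) + (b * \<sigma> * sqrt s) * (\<integral>z. \<bar>z\<bar> \<partial>stdN)"
    by (simp add: stdN.prob_space)
  also have "\<dots> \<le> (a + b * \<bar>y\<bar>) + (b * \<sigma> * sqrt s) * 1"
    using integral_stdN_abs assms by (intro add_left_mono mult_left_mono) auto
  finally show ?thesis by (simp add: algebra_simps)
qed

lemma heat_measurable [measurable]:
  assumes [measurable]: "case_prod g \<in> borel_measurable (M \<Otimes>\<^sub>M borel)" "y \<in> borel_measurable M" "s \<in> borel_measurable M"
  shows "(\<lambda>w. heat \<sigma> (s w) (g w) (y w)) \<in> borel_measurable M"
  unfolding heat_def by measurable

lemma qbound_lipschitz: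
  assumes L: "\<And>x x'. \<bar>g x - g x'\<bar> \<le> L * \<bar>x - x'\<bar>" and "0 \<le> L"
  shows "qbound (\<bar>g 0\<bar> + L) g" "g \<in> borel_measurable borel" "continuous_on UNIV g"
proof -
  have "L-lipschitz_on UNIV g"
    using assms by (auto simp: lipschitz_on_def dist_real_def)
  then show c: "continuous_on UNIV g"
    by (rule lipschitz_on_continuous_on)
  then show m: "g \<in> borel_measurable borel"
    by (rule borel_measurable_continuous_onI)
  show "qbound (\<bar>g 0\<bar> + L) g"
  proof (rule qbound_linear[OF m])
    fix x show "\<bar>g x\<bar> \<le> \<bar>g 0\<bar> + L * \<bar>x\<bar>" using L[of x 0] by simp
  qed (use assms in auto)
qed

lemma heat_lipschitz:
  assumes L: "\<And>x x'. \<bar>g x - g x'\<bar> \<le> L * \<bar>x - x'\<bar>" and "0 \<le> L"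
  shows "\<bar>heat \<sigma> s g y - heat \<sigma> s g y'\<bar> \<le> L * \<bar>y - y'\<bar>"
proof -
  have q: "qbound (\<bar>g 0\<bar> + L) g" by (rule qbound_lipschitz[OF assms])
  have "\<bar>heat \<sigma> s g y - heat \<sigma> s g y'\<bar> = \<bar>\<integral>z. g (y + \<sigma> * sqrt s * z) - g (y' + \<sigma> * sqrt s * z) \<partial>stdN\<bar>"
    unfolding heat_def by (subst Bochner_Integration.integral_diff) (use q in \<open>auto intro!: qbound_integrable\<close>)
  also have "\<dots> \<le> (\<integral>z. \<bar>g (y + \<sigma> * sqrt s * z) - g (y' + \<sigma> * sqrt s * z)\<bar> \<partial>stdN)"
    by (rule integral_abs_bound)
  also have "\<dots> \<le> (\<integral>z. L * \<bar>y - y'\<bar> \<partial>stdN)"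
  proof (rule integral_mono)
    fix z show "\<bar>g (y + \<sigma> * sqrt s * z) - g (y' + \<sigma> * sqrt s * z)\<bar> \<le> L * \<bar>y - y'\<bar>"
      using L[of "y + \<sigma> * sqrt s * z" "y' + \<sigma> * sqrt s * z"] by simp
  qed (use q in \<open>auto intro!: integrable_abs Bochner_Integration.integrable_diff qbound_integrable\<close>)
  also have "\<dots> = L * \<bar>y - y'\<bar>" by (simp add: stdN.prob_space)
  finally show ?thesis .
qed

lemma heat_lipschitz_time:
  assumes L: "\<And>x x'. \<bar>g x - g x'\<bar> \<le> L * \<bar>x - x'\<bar>" and "0 \<le> L" "0 \<le> \<sigma>" "0 \<le> s"
  shows "\<bar>heat \<sigma> s g y - g y\<bar> \<le> L * \<sigma> * sqrt s"
proof -
  have [measurable]: "g \<in> borel_measurable borel" by (rule qbound_lipschitz(2)[OF assms(1,2)])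
  have q: "qbound (\<bar>g 0\<bar> + L) g" by (rule qbound_lipschitz[OF assms(1,2)])
  have "heat \<sigma> s g y - g y = heat \<sigma> s (\<lambda>x. g x - g y) y"
    using heat_diff[OF q qbound_const] by simp
  also have "heat \<sigma> s (\<lambda>x. g x - g y) y = heat \<sigma> s (\<lambda>x. g (x + y) - g y) 0"
    by (simp add: heat_def add_ac)
  also have "\<bar>\<dots>\<bar> \<le> 0 + L * (\<bar>0\<bar> + \<sigma> * sqrt s)"
  proof (rule heat_abs_le_linear)
    fix x show "\<bar>g (x + y) - g y\<bar> \<le> 0 + L * \<bar>x\<bar>" using L[of "x + y" y] by simp
  qed (use assms in auto)
  finally show ?thesis by (simp add: mult.assoc)
qed

text \<open>The factor of \<open>s\<^sup>2\<close>, uniform for \<open>s \<le> T\<close> and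
  continuous in \<open>y\<close>. The number 18 is a round majorant: the fourth and sixth Gaussian
  moments 3 and 15 produce the coefficients 3 and 30, and the latter is covered by 36.\<close>

definition far_const :: "real \<Rightarrow> real \<Rightarrow> real \<Rightarrow> real" where
  "far_const \<sigma> T y = 18 * (1 + 2 * y\<^sup>2 + 2 * \<sigma>\<^sup>2 * T) * \<sigma> ^ 4"

lemma far_const_nonneg: "0 \<le> T \<Longrightarrow> 0 \<le> far_const \<sigma> T y"
  by (simp add: far_const_def)

text \<open>Bounding the tail indicator by a fourth power already makes the contribution of points at distance
  \<open>\<ge> e\<close> of order \<open>s\<^sup>2\<close>, which is all that the local arguments below need.\<close>

lemma heat_far:
  assumes "0 \<le> s" "s \<le> T"
  shows "integrable stdN (\<lambda>z. (1 + (y + \<sigma> * sqrt s * z)\<^sup>2) * (\<sigma> * sqrt s * z) ^ 4)"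
    and "heat \<sigma> s (\<lambda>x. (1 + x\<^sup>2) * (x - y) ^ 4) y \<le> far_const \<sigma> T y * s\<^sup>2" (is ?g2)
proof -
  define r where "r = \<sigma> * sqrt s"
  have r2: "r\<^sup>2 = \<sigma>\<^sup>2 * s" and r4: "r ^ 4 = \<sigma> ^ 4 * s\<^sup>2"
  proof -
    show r2: "r\<^sup>2 = \<sigma>\<^sup>2 * s" using assms by (simp add: r_def power_mult_distrib)
    have "r ^ 4 = (r\<^sup>2)\<^sup>2" by algebra
    then show "r ^ 4 = \<sigma> ^ 4 * s\<^sup>2" unfolding r2 by (simp add: power_mult_distrib flip: power_mult)
  qed
  have e: "(\<lambda>z. (1 + (y + r * z)\<^sup>2) * (r * z) ^ 4) = (\<lambda>z. (1 + y\<^sup>2) * r ^ 4 * z ^ 4 + 2 * y * r ^ 5 * z ^ 5 + r ^ 6 * z ^ 6)"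
    by (rule ext) algebra
  show i: "integrable stdN (\<lambda>z. (1 + (y + \<sigma> * sqrt s * z)\<^sup>2) * (\<sigma> * sqrt s * z) ^ 4)"
    unfolding r_def[symmetric] e by simp
  have "heat \<sigma> s (\<lambda>x. (1 + x\<^sup>2) * (x - y) ^ 4) y = (\<integral>z. (1 + (y + r * z)\<^sup>2) * (r * z) ^ 4 \<partial>stdN)"
    by (simp add: heat_def r_def)
  also have "\<dots> \<le> (\<integral>z. (1 + 2 * y\<^sup>2) * r ^ 4 * z ^ 4 + 2 * r ^ 6 * z ^ 6 \<partial>stdN)"
  proof (rule integral_mono)
    fix z
    have "(y + r * z)\<^sup>2 \<le> 2 * y\<^sup>2 + 2 * (r * z)\<^sup>2"
      using sum_squares_bound[of y "r * z"] by (simp add: power2_sum)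
    then have "(1 + (y + r * z)\<^sup>2) * (r * z) ^ 4 \<le> (1 + (2 * y\<^sup>2 + 2 * (r * z)\<^sup>2)) * (r * z) ^ 4"
      by (intro mult_right_mono) auto
    also have "\<dots> = (1 + 2 * y\<^sup>2) * r ^ 4 * z ^ 4 + 2 * r ^ 6 * z ^ 6"
      by algebra
    finally show "(1 + (y + r * z)\<^sup>2) * (r * z) ^ 4 \<le> (1 + 2 * y\<^sup>2) * r ^ 4 * z ^ 4 + 2 * r ^ 6 * z ^ 6" .
  qed (use i r_def in auto)
  also have "\<dots> = 3 * (1 + 2 * y\<^sup>2) * r ^ 4 + 30 * (r\<^sup>2 * r ^ 4)"
    by (simp flip: power_add)
  also have "\<dots> = (3 * (1 + 2 * y\<^sup>2) + 30 * (\<sigma>\<^sup>2 * s)) * (\<sigma> ^ 4 * s\<^sup>2)"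
    unfolding r2 r4 by (simp add: algebra_simps)
  also have "\<dots> \<le> (18 * (1 + 2 * y\<^sup>2 + 2 * \<sigma>\<^sup>2 * T)) * (\<sigma> ^ 4 * s\<^sup>2)"
  proof (rule mult_right_mono)
    have *: "a \<le> b \<Longrightarrow> 0 \<le> a \<Longrightarrow> 0 \<le> c \<Longrightarrow> 3 * (1 + 2 * c) + 30 * a \<le> 18 * (1 + 2 * c + 2 * b)" for a b c :: real
      by simp
    have "\<sigma>\<^sup>2 * s \<le> \<sigma>\<^sup>2 * T" "0 \<le> \<sigma>\<^sup>2 * s" "0 \<le> y\<^sup>2" using assms by (auto intro: mult_left_mono)
    then show "3 * (1 + 2 * y\<^sup>2) + 30 * (\<sigma>\<^sup>2 * s) \<le> 18 * (1 + 2 * y\<^sup>2 + 2 * \<sigma>\<^sup>2 * T)"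
      using *[of "\<sigma>\<^sup>2 * s" "\<sigma>\<^sup>2 * T" "y\<^sup>2"] by (simp only: mult.assoc)
  qed simp
  finally show ?g2
    by (simp add: far_const_def mult.assoc)
qed

text \<open>Where \<open>\<bar>x - y\<bar> > e\<close> the difference, at most
  \<open>2 * C * (1 + x\<^sup>2)\<close>, may be multiplied by \<open>((x - y) / e) ^ 4\<close>,
  which exceeds 1 there, and then integrated by \<open>heat_far\<close>. Hence a purely local
  comparison survives the semigroup up to order \<open>s\<^sup>2\<close>; this stands in for
  stopping the process at the exit from a neighbourhood.\<close>

lemma heat_local:
  assumes g: "qbound C g" and k: "qbound C k" and s: "0 \<le> s" "s \<le> T" and e: "0 < e"
    and near: "\<And>x. \<bar>x - y\<bar> \<le> e \<Longrightarrow> g x \<le> k x"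
  shows "heat \<sigma> s g y \<le> heat \<sigma> s k y + 2 * C / e ^ 4 * far_const \<sigma> T y * s\<^sup>2"
proof -
  define r where "r = \<sigma> * sqrt s"
  have C: "0 \<le> C" by (rule qbound_nonneg[OF g])
  have "heat \<sigma> s g y - heat \<sigma> s k y = (\<integral>z. g (y + r * z) - k (y + r * z) \<partial>stdN)"
    unfolding heat_def r_def by (subst Bochner_Integration.integral_diff) (use g k in auto)
  also have "\<dots> \<le> (\<integral>z. 2 * C / e ^ 4 * ((1 + (y + r * z)\<^sup>2) * (r * z) ^ 4) \<partial>stdN)"
  proof (rule integral_mono)
    fix z
    let ?x = "y + r * z"
    show "g ?x - k ?x \<le> 2 * C / e ^ 4 * ((1 + ?x\<^sup>2) * (r * z) ^ 4)"
    proof (cases "\<bar>?x - y\<bar> \<le> e")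
      case True
      have "0 \<le> 2 * C / e ^ 4 * ((1 + ?x\<^sup>2) * (r * z) ^ 4)"
        using C e by (intro mult_nonneg_nonneg divide_nonneg_pos) auto
      with near[OF True] show ?thesis by linarith
    next
      case False
      then have "e ^ 4 \<le> \<bar>r * z\<bar> ^ 4"
        using e by (intro power_mono) auto
      then have "1 \<le> (r * z) ^ 4 / e ^ 4"
        using e by (simp add: field_simps)
      then have "2 * C * (1 + ?x\<^sup>2) * 1 \<le> 2 * C * (1 + ?x\<^sup>2) * ((r * z) ^ 4 / e ^ 4)"
        using C by (intro mult_left_mono) auto
      moreover have "g ?x - k ?x \<le> 2 * C * (1 + ?x\<^sup>2)"
        using qboundD[OF g, of ?x] qboundD[OF k, of ?x] by linarith
      ultimately show ?thesis by (simp add: field_simps)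
    qed
  next
    show "integrable stdN (\<lambda>z. 2 * C / e ^ 4 * ((1 + (y + r * z)\<^sup>2) * (r * z) ^ 4))"
      unfolding r_def by (intro integrable_mult_right heat_far(1)[OF s])
  qed (use g k in \<open>auto intro!: Bochner_Integration.integrable_diff qbound_integrable\<close>)
  also have "\<dots> = 2 * C / e ^ 4 * heat \<sigma> s (\<lambda>x. (1 + x\<^sup>2) * (x - y) ^ 4) y"
    by (simp add: heat_def r_def)
  also have "\<dots> \<le> 2 * C / e ^ 4 * (far_const \<sigma> T y * s\<^sup>2)"
    using C e by (intro mult_left_mono heat_far(2)[OF s]) auto
  finally show ?thesis by (simp add: mult.assoc)
qed

section \<open>Brownian motion\<close>

text \<open>The joint law of \<open>Y\<close> and \<open>Z\<close> agrees with the product law on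
  rectangles and therefore everywhere; Fubini then integrates \<open>Z\<close> out with
  \<open>Y\<close> frozen. Independence is assumed as a product formula for preimages, the form in
  which it is obtained from \<open>W_indep\<close>.\<close>

lemma (in prob_space) expectation_indep_stdN:
  fixes k :: "'b \<times> real \<Rightarrow> real"
  assumes [measurable]: "Y \<in> M \<rightarrow>\<^sub>M S" "Z \<in> borel_measurable M"
    and ind: "\<And>A B. A \<in> sets S \<Longrightarrow> B \<in> sets borel \<Longrightarrow>
      prob ((Y -` A \<inter> space M) \<inter> (Z -` B \<inter> space M)) = prob (Y -` A \<inter> space M) * prob (Z -` B \<inter> space M)"
    and Z: "distr M borel Z = stdN"
    and k: "k \<in> borel_measurable (S \<Otimes>\<^sub>M borel)" and int: "integrable M (\<lambda>\<omega>. k (Y \<omega>, Z \<omega>))"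
  shows "expectation (\<lambda>\<omega>. k (Y \<omega>, Z \<omega>)) = expectation (\<lambda>\<omega>. \<integral>z. k (Y \<omega>, z) \<partial>stdN)" (is ?g1)
    and "integrable M (\<lambda>\<omega>. \<integral>z. k (Y \<omega>, z) \<partial>stdN)" (is ?g2)
proof -
  note [measurable] = k
  interpret Y: prob_space "distr M S Y" by (rule prob_space_distr) simp
  interpret pair_sigma_finite "distr M S Y" stdN ..
  have eq: "distr M S Y \<Otimes>\<^sub>M stdN = distr M (S \<Otimes>\<^sub>M borel) (\<lambda>x. (Y x, Z x))"
  proof (rule pair_measure_eqI)
    show "sigma_finite_measure (distr M S Y)" "sigma_finite_measure stdN" by unfold_locales
    show "sets (distr M S Y \<Otimes>\<^sub>M stdN) = sets (distr M (S \<Otimes>\<^sub>M borel) (\<lambda>x. (Y x, Z x)))"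
      by (simp cong: sets_pair_measure_cong)
    fix A B assume "A \<in> sets (distr M S Y)" "B \<in> sets stdN"
    then have A[measurable]: "A \<in> sets S" and B[measurable]: "B \<in> sets borel" by auto
    have "(\<lambda>x. (Y x, Z x)) -` (A \<times> B) \<inter> space M = (Y -` A \<inter> space M) \<inter> (Z -` B \<inter> space M)" by auto
    then show "emeasure (distr M S Y) A * emeasure stdN B = emeasure (distr M (S \<Otimes>\<^sub>M borel) (\<lambda>x. (Y x, Z x))) (A \<times> B)"
      unfolding Z[symmetric] using ind[OF A B]
      by (simp add: emeasure_distr emeasure_eq_measure ennreal_mult'')
  qed
  have m: "(\<lambda>p. k p) \<in> borel_measurable (distr M S Y \<Otimes>\<^sub>M stdN)" by measurable
  have i: "integrable (distr M S Y \<Otimes>\<^sub>M stdN) (\<lambda>(y, z). k (y, z))"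
  proof -
    have "integrable (distr M (S \<Otimes>\<^sub>M borel) (\<lambda>x. (Y x, Z x))) k"
      by (subst integrable_distr_eq) (use int in auto)
    then show ?thesis using eq by simp
  qed
  have "expectation (\<lambda>\<omega>. k (Y \<omega>, Z \<omega>)) = integral\<^sup>L (distr M (S \<Otimes>\<^sub>M borel) (\<lambda>x. (Y x, Z x))) k"
    by (subst integral_distr) auto
  also have "\<dots> = integral\<^sup>L (distr M S Y \<Otimes>\<^sub>M stdN) (\<lambda>(y, z). k (y, z))"
    using eq by simp
  also have "\<dots> = (\<integral>y. (\<integral>z. k (y, z) \<partial>stdN) \<partial>distr M S Y)"
    using integral_fst'[OF i[unfolded split_def prod.collapse]] unfolding split_def prod.collapse by (rule sym)
  also have "\<dots> = expectation (\<lambda>\<omega>. \<integral>z. k (Y \<omega>, z) \<partial>stdN)"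
    by (subst integral_distr) auto
  finally show ?g1 .
  have "integrable (distr M S Y) (\<lambda>y. \<integral>z. k (y, z) \<partial>stdN)"
    using integrable_fst'[OF i[unfolded split_def prod.collapse]] by simp
  then show ?g2
    by (subst (asm) integrable_distr_eq) auto
qed

locale diffusion = filtered_brownian_motion M F W
  for M :: "'a measure" and F :: "real \<Rightarrow> 'a measure" and W :: "real \<Rightarrow> 'a \<Rightarrow> real" +
  fixes \<sigma> :: real
  assumes \<sigma>_pos: "0 < \<sigma>"
begin

abbreviation X :: "real \<Rightarrow> real \<Rightarrow> 'a \<Rightarrow> real" where "X \<equiv> X_proc \<sigma> W"

abbreviation P :: "real \<Rightarrow> (real \<Rightarrow> real) \<Rightarrow> real \<Rightarrow> real" where "P \<equiv> heat \<sigma>"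

lemma measurable_F_M: "g \<in> borel_measurable (F t) \<Longrightarrow> g \<in> borel_measurable M"
  using measurable_mono[OF order_refl refl sets_F_subset[of t] space_F] by auto

lemma measurable_F_mono: "s \<le> t \<Longrightarrow> g \<in> borel_measurable (F s) \<Longrightarrow> g \<in> borel_measurable (F t)"
  using measurable_mono[OF order_refl refl sets_F_mono[of s t]] by (auto simp: space_F)

lemma W_measurable: "0 \<le> t \<Longrightarrow> W t \<in> borel_measurable M"
  by (rule measurable_F_M[OF W_adapted])

lemma X_adapted: "0 \<le> t \<Longrightarrow> X y t \<in> borel_measurable (F t)"
  unfolding X_proc_def[abs_def] using W_adapted[of t] by simp

lemma X_measurable: "0 \<le> t \<Longrightarrow> X y t \<in> borel_measurable M"
  by (rule measurable_F_M[OF X_adapted])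

lemma distr_increment:
  assumes "0 \<le> s" "s < t"
  shows "distr M borel (\<lambda>\<omega>. (W t \<omega> - W s \<omega>) / sqrt (t - s)) = stdN"
proof -
  have "distributed M lborel (\<lambda>\<omega>. W t \<omega> - W s \<omega>) (normal_density 0 (sqrt (t - s)))"
    by (rule W_increment[OF assms])
  then have "distributed M lborel (\<lambda>\<omega>. (W t \<omega> - W s \<omega> - 0) / sqrt (t - s)) std_normal_density"
    using assms by (subst (asm) normal_standard_normal_convert) auto
  then have "distr M lborel (\<lambda>\<omega>. (W t \<omega> - W s \<omega>) / sqrt (t - s)) = stdN"
    unfolding stdN_def by (simp add: distributed_distr_eq_density)
  then show ?thesis by (simp cong: distr_cong)
qed

lemma integrable_increment:
  assumes "0 \<le> s" "s < t" "integrable stdN g"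
  shows "integrable M (\<lambda>\<omega>. g ((W t \<omega> - W s \<omega>) / sqrt (t - s)))" (is ?g1)
    and "expectation (\<lambda>\<omega>. g ((W t \<omega> - W s \<omega>) / sqrt (t - s))) = (\<integral>z. g z \<partial>stdN :: real)"
proof -
  have [measurable]: "W t \<in> borel_measurable M" "W s \<in> borel_measurable M"
    using assms W_measurable by auto
  have [measurable]: "g \<in> borel_measurable borel"
    using borel_measurable_integrable[OF assms(3)] by simp
  show ?g1
    using assms(3) unfolding distr_increment[OF assms(1,2), symmetric]
    by (subst (asm) integrable_distr_eq) auto
  show "expectation (\<lambda>\<omega>. g ((W t \<omega> - W s \<omega>) / sqrt (t - s))) = (\<integral>z. g z \<partial>stdN)"
    unfolding distr_increment[OF assms(1,2), symmetric] by (subst integral_distr) auto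
qed

lemma W_eq_increment:
  assumes "0 < s"
  shows "AE \<omega> in M. W s \<omega> = sqrt s * ((W s \<omega> - W 0 \<omega>) / sqrt (s - 0))"
  using W_0 by eventually_elim (use assms in simp)

lemma integrable_W_square:
  assumes "0 \<le> s"
  shows "integrable M (\<lambda>\<omega>. (W s \<omega>)\<^sup>2)" and "expectation (\<lambda>\<omega>. (W s \<omega>)\<^sup>2) = s"
proof -
  have [measurable]: "W s \<in> borel_measurable M" "W 0 \<in> borel_measurable M"
    using assms W_measurable by auto
  have "integrable M (\<lambda>\<omega>. (W s \<omega>)\<^sup>2) \<and> expectation (\<lambda>\<omega>. (W s \<omega>)\<^sup>2) = s"
  proof (cases "s = 0")
    case True
    have ae: "AE \<omega> in M. (W s \<omega>)\<^sup>2 = 0" using W_0 True by auto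
    show ?thesis
      using integrable_cong_AE[OF _ _ ae] integral_cong_AE[OF _ _ ae] True by auto
  next
    case False
    then have s: "0 < s" using assms by simp
    let ?Z = "\<lambda>\<omega>. (W s \<omega> - W 0 \<omega>) / sqrt (s - 0)"
    have ae: "AE \<omega> in M. (W s \<omega>)\<^sup>2 = s * (?Z \<omega>)\<^sup>2"
      using W_eq_increment[OF s]
    proof eventually_elim
      case (elim \<omega>)
      then have "(W s \<omega>)\<^sup>2 = (sqrt s * ?Z \<omega>)\<^sup>2" by (rule arg_cong)
      also have "\<dots> = s * (?Z \<omega>)\<^sup>2" unfolding power_mult_distrib using s by simp
      finally show ?case .
    qed
    have "integrable M (\<lambda>\<omega>. s * (?Z \<omega>)\<^sup>2)" "expectation (\<lambda>\<omega>. s * (?Z \<omega>)\<^sup>2) = s"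
      using integrable_increment[OF order_refl s, of "\<lambda>z. z\<^sup>2"] by simp_all
    then show ?thesis
      using integrable_cong_AE[OF _ _ ae] integral_cong_AE[OF _ _ ae] by simp
  qed
  then show "integrable M (\<lambda>\<omega>. (W s \<omega>)\<^sup>2)" "expectation (\<lambda>\<omega>. (W s \<omega>)\<^sup>2) = s" by auto
qed

lemma qbound_integrable_X:
  assumes g: "qbound C g" and s: "0 \<le> s"
  shows "integrable M (\<lambda>\<omega>. g (X y s \<omega>))"
proof (rule Bochner_Integration.integrable_bound)
  have [measurable]: "W s \<in> borel_measurable M" "g \<in> borel_measurable borel"
    using s W_measurable qbound_measurable[OF g] by auto
  show "integrable M (\<lambda>\<omega>. C * (1 + (2 * y\<^sup>2 + 2 * \<sigma>\<^sup>2 * (W s \<omega>)\<^sup>2)))"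
    using integrable_W_square[OF s] by simp
  show "(\<lambda>\<omega>. g (X y s \<omega>)) \<in> borel_measurable M" unfolding X_proc_def by measurable
  show "AE \<omega> in M. norm (g (X y s \<omega>)) \<le> norm (C * (1 + (2 * y\<^sup>2 + 2 * \<sigma>\<^sup>2 * (W s \<omega>)\<^sup>2)))"
  proof (rule AE_I2)
    fix \<omega>
    have "(y + \<sigma> * W s \<omega>)\<^sup>2 \<le> 2 * y\<^sup>2 + 2 * (\<sigma> * W s \<omega>)\<^sup>2"
      using sum_squares_bound[of y "\<sigma> * W s \<omega>"] by (simp add: power2_sum)
    then have "C * (1 + (X y s \<omega>)\<^sup>2) \<le> C * (1 + (2 * y\<^sup>2 + 2 * \<sigma>\<^sup>2 * (W s \<omega>)\<^sup>2))"
      using qbound_nonneg[OF g] by (intro mult_left_mono) (auto simp: X_proc_def power_mult_distrib)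
    then show "norm (g (X y s \<omega>)) \<le> norm (C * (1 + (2 * y\<^sup>2 + 2 * \<sigma>\<^sup>2 * (W s \<omega>)\<^sup>2)))"
      using qboundD[OF g, of "X y s \<omega>"] by simp
  qed
qed

lemma integrable_indicator_X:
  assumes g: "qbound C g" and s: "0 \<le> s" and A: "A \<in> sets M"
  shows "integrable M (\<lambda>\<omega>. indicator A \<omega> * g (X y s \<omega>))"
  using integrable_mult_indicator[OF A qbound_integrable_X[OF g s]] by simp

lemma markov:
  assumes g: "qbound C g" and s: "0 \<le> s" "0 \<le> r" and A: "A \<in> sets (F s)"
  shows "expectation (\<lambda>\<omega>. indicator A \<omega> * g (X y (s + r) \<omega>)) = expectation (\<lambda>\<omega>. indicator A \<omega> * P r g (X y s \<omega>))"
    and "integrable M (\<lambda>\<omega>. indicator A \<omega> * P r g (X y s \<omega>))"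
proof -
  have AM: "A \<in> sets M" using A sets_F_subset by auto
  have "expectation (\<lambda>\<omega>. indicator A \<omega> * g (X y (s + r) \<omega>)) = expectation (\<lambda>\<omega>. indicator A \<omega> * P r g (X y s \<omega>))
    \<and> integrable M (\<lambda>\<omega>. indicator A \<omega> * P r g (X y s \<omega>))"
  proof (cases "r = 0")
    case True
    then show ?thesis using integrable_indicator_X[OF g s(1) AM] by simp
  next
    case False
    then have r: "0 < r" using s by simp
    let ?Z = "\<lambda>\<omega>. (W (s + r) \<omega> - W s \<omega>) / sqrt r"
    let ?Y = "\<lambda>\<omega>. (indicator A \<omega> :: real, X y s \<omega>)"
    let ?k = "\<lambda>p. fst (fst p) * g (snd (fst p) + \<sigma> * sqrt r * snd p)"
    have [measurable]: "A \<in> sets M" "g \<in> borel_measurable borel" "X y s \<in> borel_measurable M"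
      "W (s + r) \<in> borel_measurable M" "W s \<in> borel_measurable M"
      using AM qbound_measurable[OF g] X_measurable W_measurable s by auto
    have AF: "?Y \<in> F s \<rightarrow>\<^sub>M (borel \<Otimes>\<^sub>M borel)"
      using A X_adapted[OF s(1)] by (intro measurable_Pair) auto
    have rv: "random_variable (borel \<Otimes>\<^sub>M borel) ?Y" "random_variable borel ?Z" by measurable
    have ind: "prob ((?Y -` A' \<inter> space M) \<inter> (?Z -` B \<inter> space M)) = prob (?Y -` A' \<inter> space M) * prob (?Z -` B \<inter> space M)"
      if "A' \<in> sets (borel \<Otimes>\<^sub>M borel)" "B \<in> sets borel" for A' B
    proof (rule indep_setD)
      have base: "indep_set (sets (F s)) {(\<lambda>\<omega>. W (s + r) \<omega> - W s \<omega>) -` B \<inter> space M | B. B \<in> sets borel}"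
        using W_indep[of s "s + r"] s r by simp
      show "indep_set (sets (F s)) {(\<lambda>\<omega>. W (s + r) \<omega> - W s \<omega>) -` B \<inter> space M | B. B \<in> sets borel}"
        by (rule base)
      show "?Y -` A' \<inter> space M \<in> sets (F s)"
        using measurable_sets[OF AF that(1)] by (simp add: space_F)
      have "(\<lambda>x. x / sqrt r) -` B \<inter> space borel \<in> sets borel"
        by (intro measurable_sets[of _ borel borel]) (use that in auto)
      then show "?Z -` B \<inter> space M \<in> {(\<lambda>\<omega>. W (s + r) \<omega> - W s \<omega>) -` B \<inter> space M | B. B \<in> sets borel}"
        by (auto intro!: exI[of _ "(\<lambda>x. x / sqrt r) -` B"])
    qed
    have dZ: "distr M borel ?Z = stdN" using distr_increment[of s "s + r"] s r by simp
    have kk: "?k (?Y \<omega>, ?Z \<omega>) = indicator A \<omega> * g (X y (s + r) \<omega>)" for \<omega>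
    proof -
      have "\<sigma> * sqrt r * ?Z \<omega> = \<sigma> * (W (s + r) \<omega> - W s \<omega>)" using r by simp
      then have "X y s \<omega> + \<sigma> * sqrt r * ?Z \<omega> = X y (s + r) \<omega>"
        by (simp only: X_proc_def right_diff_distrib)
      then show ?thesis by simp
    qed
    have ik: "integrable M (\<lambda>\<omega>. ?k (?Y \<omega>, ?Z \<omega>))"
      unfolding kk using integrable_indicator_X[OF g _ AM, of "s + r"] s by simp
    have e: "(\<integral>z. ?k (?Y \<omega>, z) \<partial>stdN) = indicator A \<omega> * P r g (X y s \<omega>)" for \<omega>
      by (simp add: heat_def)
    have mk: "?k \<in> borel_measurable ((borel \<Otimes>\<^sub>M borel) \<Otimes>\<^sub>M borel)" by measurable
    show ?thesis
      using expectation_indep_stdN[OF rv ind dZ mk ik] unfolding kk e by (rule conjI)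
  qed
  then show "expectation (\<lambda>\<omega>. indicator A \<omega> * g (X y (s + r) \<omega>)) = expectation (\<lambda>\<omega>. indicator A \<omega> * P r g (X y s \<omega>))"
    "integrable M (\<lambda>\<omega>. indicator A \<omega> * P r g (X y s \<omega>))" by auto
qed

lemma X_0_AE: "AE \<omega> in M. X y 0 \<omega> = y"
  using W_0 by eventually_elim (simp add: X_proc_def)

lemma qbound_heat:
  assumes "qbound C g" "0 \<le> s"
  shows "qbound (C * (1 + \<sigma>\<^sup>2 * s)) (P s g)"
proof (rule qboundI)
  have [measurable]: "g \<in> borel_measurable borel" using qbound_measurable[OF assms(1)] .
  show "P s g \<in> borel_measurable borel" by measurable
  fix x
  have "\<bar>P s g x\<bar> \<le> C * (1 + x\<^sup>2 + \<sigma>\<^sup>2 * s)" by (rule heat_abs_le[OF assms])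
  also have "\<dots> \<le> C * ((1 + \<sigma>\<^sup>2 * s) * (1 + x\<^sup>2))"
    using qbound_nonneg[OF assms(1)] assms(2) by (intro mult_left_mono) (auto simp: algebra_simps)
  finally show "\<bar>P s g x\<bar> \<le> C * (1 + \<sigma>\<^sup>2 * s) * (1 + x\<^sup>2)" by (simp add: mult.assoc)
qed

lemma expectation_X:
  assumes g: "qbound C g" and s: "0 \<le> s"
  shows "expectation (\<lambda>\<omega>. g (X y s \<omega>)) = P s g y"
proof -
  have "expectation (\<lambda>\<omega>. g (X y s \<omega>)) = expectation (\<lambda>\<omega>. indicator (space M) \<omega> * g (X y (0 + s) \<omega>))"
    by (rule Bochner_Integration.integral_cong) auto
  also have "\<dots> = expectation (\<lambda>\<omega>. indicator (space M) \<omega> * P s g (X y 0 \<omega>))"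
    by (rule markov[OF g order_refl s]) (metis sets.top space_F)
  also have "\<dots> = expectation (\<lambda>\<omega>. P s g y)"
  proof (rule integral_cong_AE)
    have [measurable]: "X y 0 \<in> borel_measurable M" "P s g \<in> borel_measurable borel"
      using X_measurable qbound_measurable[OF qbound_heat[OF g s]] by auto
    show "(\<lambda>\<omega>. indicator (space M) \<omega> * P s g (X y 0 \<omega>)) \<in> borel_measurable M" by measurable
    show "AE \<omega> in M. indicator (space M) \<omega> * P s g (X y 0 \<omega>) = P s g y"
      using X_0_AE[of y] AE_space by eventually_elim simp
  qed simp
  finally show ?thesis by (simp add: prob_space)
qed

text \<open>Both sides are the expectation of \<open>g (X y (s + r))\<close>, the right one after
  conditioning at time \<open>s\<close>. The Chapman-Kolmogorov identity is thus read off from the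
  process instead of from a convolution of Gaussian densities.\<close>

lemma heat_semigroup:
  assumes g: "qbound C g" and s: "0 \<le> s" "0 \<le> r"
  shows "P (s + r) g y = P s (P r g) y"
proof -
  have "P (s + r) g y = expectation (\<lambda>\<omega>. indicator (space M) \<omega> * g (X y (s + r) \<omega>))"
    using s by (subst expectation_X[OF g, symmetric]) (auto intro!: Bochner_Integration.integral_cong)
  also have "\<dots> = expectation (\<lambda>\<omega>. indicator (space M) \<omega> * P r g (X y s \<omega>))"
    by (rule markov[OF g s]) (metis sets.top space_F)
  also have "\<dots> = P s (P r g) y"
    using s by (subst expectation_X[OF qbound_heat[OF g s(2)], symmetric]) (auto intro!: Bochner_Integration.integral_cong)
  finally show ?thesis .
qed

end

section \<open>Joint measurability of paths and the exchange of time integral and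
  expectation\<close>

lemma (in complete_measure) borel_measurable_AE:
  fixes f g :: "'a \<Rightarrow> real"
  assumes [measurable]: "g \<in> borel_measurable M" and eq: "AE x in M. f x = g x"
  shows "f \<in> borel_measurable M"
proof (rule measurableI)
  fix B :: "real set" assume [measurable]: "B \<in> sets borel"
  have "AE x in M. x \<in> g -` B \<inter> space M \<longleftrightarrow> x \<in> f -` B \<inter> space M"
    using eq by eventually_elim simp
  then show "f -` B \<inter> space M \<in> sets M"
    by (rule in_sets_AE) auto
qed simp

text \<open>Rounding the time down to multiples of \<open>1 / Suc n\<close> leaves countably many
  values, so each approximation is jointly measurable; by continuity of the paths the approximations
  converge pointwise.\<close>

lemma continuous_process_measurable:
  fixes V :: "real \<Rightarrow> 'a \<Rightarrow> real"
  assumes [measurable]: "\<And>r. V r \<in> borel_measurable M"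
    and cont: "\<And>\<omega>. \<omega> \<in> space M \<Longrightarrow> continuous_on UNIV (\<lambda>r. V r \<omega>)"
  shows "case_prod V \<in> borel_measurable (borel \<Otimes>\<^sub>M M)"
proof (rule borel_measurable_LIMSEQ_metric)
  let ?q = "\<lambda>n r. real_of_int \<lfloor>real (Suc n) * r\<rfloor> / real (Suc n)"
  show "(\<lambda>p. V (?q n (fst p)) (snd p)) \<in> borel_measurable (borel \<Otimes>\<^sub>M M)" for n
  proof -
    have "(\<lambda>p. (\<lambda>i p. V (real_of_int i / real (Suc n)) (snd p)) (\<lfloor>real (Suc n) * fst p\<rfloor>) p)
        \<in> borel_measurable (borel \<Otimes>\<^sub>M M)"
      by (rule measurable_compose_countable) measurable
    then show ?thesis by simp
  qed
  fix p :: "real \<times> 'a" assume "p \<in> space (borel \<Otimes>\<^sub>M M)"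
  then obtain r \<omega> where p: "p = (r, \<omega>)" "\<omega> \<in> space M" by (auto simp: space_pair_measure)
  have "(\<lambda>n. ?q n r) \<longlonglongrightarrow> r"
  proof (rule tendsto_sandwich)
    show "\<forall>\<^sub>F n in sequentially. r - 1 / real (Suc n) \<le> ?q n r"
    proof (rule always_eventually, rule allI)
      fix n
      have "real (Suc n) * r - 1 \<le> real_of_int \<lfloor>real (Suc n) * r\<rfloor>" by linarith
      then have "(real (Suc n) * r - 1) / real (Suc n) \<le> ?q n r" by (rule divide_right_mono) simp
      then show "r - 1 / real (Suc n) \<le> ?q n r" by (simp add: diff_divide_distrib)
    qed
    show "\<forall>\<^sub>F n in sequentially. ?q n r \<le> r"
    proof (rule always_eventually, rule allI)
      fix n
      have "real_of_int \<lfloor>real (Suc n) * r\<rfloor> \<le> real (Suc n) * r" by linarith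
      then show "?q n r \<le> r" by (simp add: pos_divide_le_eq mult.commute)
    qed
    have "(\<lambda>n. r - 1 / real (Suc n)) \<longlonglongrightarrow> r - 0"
      by (intro tendsto_diff tendsto_const LIMSEQ_Suc[OF lim_1_over_n])
    then show "(\<lambda>n. r - 1 / real (Suc n)) \<longlonglongrightarrow> r" by simp
  qed simp
  then have "(\<lambda>n. V (?q n r) \<omega>) \<longlonglongrightarrow> V r \<omega>"
    using cont[OF p(2)] by (intro isCont_tendsto_compose[of r "\<lambda>r. V r \<omega>"]) (auto simp: continuous_on_eq_continuous_at)
  then show "(\<lambda>n. V (?q n (fst p)) (snd p)) \<longlonglongrightarrow> case_prod V p" using p by simp
qed

lemma (in prob_space) fubini_time:
  fixes \<phi> :: "real \<Rightarrow> 'a \<Rightarrow> real"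
  assumes [measurable]: "case_prod \<phi> \<in> borel_measurable (borel \<Otimes>\<^sub>M M)"
    and int: "\<And>s. s \<in> {0..a} \<Longrightarrow> integrable M (\<phi> s)"
    and bnd: "\<And>s. s \<in> {0..a} \<Longrightarrow> expectation (\<lambda>\<omega>. \<bar>\<phi> s \<omega>\<bar>) \<le> C"
  shows "expectation (\<lambda>\<omega>. LBINT s:{0..a}. \<phi> s \<omega>) = (LBINT s:{0..a}. expectation (\<phi> s))" (is ?g1)
    and "integrable M (\<lambda>\<omega>. LBINT s:{0..a}. \<phi> s \<omega>)" (is ?g2)
    and "set_integrable lborel {0..a} (\<lambda>s. expectation (\<phi> s))" (is ?g3)
    and "AE \<omega> in M. set_integrable lborel {0..a} (\<lambda>s. \<phi> s \<omega>)" (is ?g4)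
proof -
  interpret pair_sigma_finite lborel M ..
  let ?f = "\<lambda>s \<omega>. indicator {0..a} s *\<^sub>R \<phi> s \<omega>"
  have m[measurable]: "case_prod ?f \<in> borel_measurable (lborel \<Otimes>\<^sub>M M)"
    by measurable
  have i: "integrable (lborel \<Otimes>\<^sub>M M) (case_prod ?f)"
  proof (rule Fubini_integrable[OF m])
    show "integrable lborel (\<lambda>s. expectation (\<lambda>\<omega>. norm (case_prod ?f (s, \<omega>))))"
    proof (rule Bochner_Integration.integrable_bound)
      show "integrable lborel (\<lambda>s. indicator {0..a} s *\<^sub>R C)"
        by (auto intro!: integrable_scaleR_left integrable_real_indicator simp: emeasure_lborel_Icc_eq)
      show "AE s in lborel. norm (expectation (\<lambda>\<omega>. norm (case_prod ?f (s, \<omega>)))) \<le> norm (indicator {0..a} s *\<^sub>R C)"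
        using bnd by (intro AE_I2) (fastforce simp: indicator_def)
    qed measurable
    show "AE s in lborel. integrable M (\<lambda>\<omega>. case_prod ?f (s, \<omega>))"
      using int by (intro AE_I2) (auto simp: indicator_def)
  qed
  have e: "expectation (?f s) = indicator {0..a} s *\<^sub>R expectation (\<phi> s)" for s by simp
  show ?g1
    using Fubini_integral[OF i] unfolding e set_lebesgue_integral_def .
  show ?g2
    using integrable_snd[OF i] unfolding set_lebesgue_integral_def .
  show ?g3
    using integrable_fst[OF i] unfolding e set_integrable_def .
  show ?g4
    using AE_integrable_snd[OF i] unfolding set_integrable_def .
qed

context diffusion
begin

lemma W_version:
  obtains V where "\<And>\<omega>. continuous_on UNIV (\<lambda>r. V r \<omega>)" "AE \<omega> in M. \<forall>r\<ge>0. V r \<omega> = W r \<omega>"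
    "case_prod V \<in> borel_measurable (borel \<Otimes>\<^sub>M M)"
proof -
  obtain N where N: "{\<omega> \<in> space M. \<not> continuous_on {0..} (\<lambda>t. W t \<omega>)} \<subseteq> N" "N \<in> sets M" "emeasure M N = 0"
    using W_continuous by (rule AE_E)
  \<comment> \<open>On the exceptional null set the path is replaced by 0, and negative times are
    moved to 0, so that every path is continuous on the whole line.\<close>
  define V where "V r \<omega> = (if \<omega> \<in> N \<or> \<omega> \<notin> space M then 0 else W (max 0 r) \<omega>)" for r \<omega>
  have c: "continuous_on UNIV (\<lambda>r. V r \<omega>)" for \<omega>
  proof (cases "\<omega> \<in> N \<or> \<omega> \<notin> space M")
    case True then show ?thesis by (simp add: V_def)
  next
    case False
    then have "continuous_on {0..} (\<lambda>t. W t \<omega>)" using N by auto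
    then have "continuous_on UNIV (\<lambda>r. W (max 0 r) \<omega>)"
      by (rule continuous_on_compose2) (auto intro!: continuous_intros)
    then show ?thesis using False by (simp add: V_def)
  qed
  have "V r \<in> borel_measurable M" for r
  proof -
    have [measurable]: "W (max 0 r) \<in> borel_measurable M" "N \<in> sets M" using W_measurable N by auto
    have "(\<lambda>\<omega>. if \<omega> \<in> N then 0 else W (max 0 r) \<omega>) \<in> borel_measurable M" by measurable
    then show ?thesis by (rule measurable_cong[THEN iffD1, rotated]) (simp add: V_def)
  qed
  then have "case_prod V \<in> borel_measurable (borel \<Otimes>\<^sub>M M)"
    by (rule continuous_process_measurable) (rule c)
  moreover have "AE \<omega> in M. \<forall>r\<ge>0. V r \<omega> = W r \<omega>"
  proof -
    have "N \<in> null_sets M" using N by auto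
    then have "AE \<omega> in M. \<omega> \<notin> N" by (rule AE_not_in)
    then show ?thesis using AE_space by eventually_elim (simp add: V_def)
  qed
  ultimately show ?thesis using c that by blast
qed

lemma stopping_times_uptoD:
  assumes "\<tau> \<in> stopping_times_upto M F a"
  shows "\<tau> \<in> borel_measurable M" "\<And>\<omega>. \<omega> \<in> space M \<Longrightarrow> 0 \<le> \<tau> \<omega> \<and> \<tau> \<omega> \<le> a"
    "\<And>s. {\<omega> \<in> space M. s < \<tau> \<omega>} \<in> sets (F s)"
proof -
  have st: "stopping_time F \<tau>" using assms by (simp add: stopping_times_upto_def)
  show "\<tau> \<in> borel_measurable M"
    by (rule measurable_stopping_time[OF st sets_F_subset space_F])
  show "0 \<le> \<tau> \<omega> \<and> \<tau> \<omega> \<le> a" if "\<omega> \<in> space M" for \<omega>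
    using assms that by (simp add: stopping_times_upto_def)
  show "{\<omega> \<in> space M. s < \<tau> \<omega>} \<in> sets (F s)" for s
    using stopping_timeD2[OF st, of s] by (simp add: Measurable.pred_def space_F)
qed

lemma qbound_affine:
  "qbound (\<bar>c\<bar> + 1) (\<lambda>x. c - x)"
  using qbound_linear[of "\<lambda>x. c - x" "\<bar>c\<bar>" 1] by auto

lemma expectation_X_affine:
  assumes A: "A \<in> sets M" and s: "0 \<le> s"
  shows "integrable M (\<lambda>\<omega>. indicator A \<omega> * (c - X y s \<omega>))"
    and "expectation (\<lambda>\<omega>. \<bar>indicator A \<omega> * (c - X y s \<omega>)\<bar>) \<le> \<bar>c\<bar> + \<bar>y\<bar> + \<sigma> * sqrt s" (is ?g2)
proof -
  show i: "integrable M (\<lambda>\<omega>. indicator A \<omega> * (c - X y s \<omega>))"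
    by (rule integrable_indicator_X[OF qbound_affine s A])
  have q: "qbound (\<bar>c\<bar> + 1) (\<lambda>x. \<bar>c - x\<bar>)"
    using qbound_linear[of "\<lambda>x. \<bar>c - x\<bar>" "\<bar>c\<bar>" 1] by auto
  have "expectation (\<lambda>\<omega>. \<bar>indicator A \<omega> * (c - X y s \<omega>)\<bar>) \<le> expectation (\<lambda>\<omega>. \<bar>c - X y s \<omega>\<bar>)"
    using i qbound_integrable_X[OF q s] by (intro integral_mono) (auto simp: indicator_def)
  also have "\<dots> = P s (\<lambda>x. \<bar>c - x\<bar>) y"
    by (rule expectation_X[OF q s])
  also have "\<dots> \<le> \<bar>c\<bar> + 1 * (\<bar>y\<bar> + \<sigma> * sqrt s)"
    using heat_abs_le_linear[of "\<lambda>x. \<bar>c - x\<bar>" "\<bar>c\<bar>" 1 s \<sigma> y] s \<sigma>_pos by force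
  finally show ?g2 by simp
qed

lemma qbound_abs: "qbound 1 (\<lambda>x. \<bar>x\<bar>)"
  using qbound_linear[of "\<lambda>x. \<bar>x\<bar>" 0 1] by simp

text \<open>The paths of \<open>W\<close> are continuous only almost surely, so \<open>W\<close> itself need not be jointly measurable;
  the integrand is evaluated along the modification of \<open>W_version\<close> instead.\<close>

lemma path_fubini:
  fixes k :: "real \<Rightarrow> 'a \<Rightarrow> real \<Rightarrow> real"
  assumes k[measurable]: "(\<lambda>p. k (fst p) (fst (snd p)) (snd (snd p))) \<in> borel_measurable (borel \<Otimes>\<^sub>M (M \<Otimes>\<^sub>M borel))"
    and bound: "\<And>s \<omega> x. 0 \<le> s \<Longrightarrow> \<bar>k s \<omega> x\<bar> \<le> C + \<bar>x\<bar>"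
  shows "expectation (\<lambda>\<omega>. LBINT s:{0..a}. k s \<omega> (X y s \<omega>)) = (LBINT s:{0..a}. expectation (\<lambda>\<omega>. k s \<omega> (X y s \<omega>)))" (is ?g1)
    and "integrable M (\<lambda>\<omega>. LBINT s:{0..a}. k s \<omega> (X y s \<omega>))" (is ?g2)
    and "set_integrable lborel {0..a} (\<lambda>s. expectation (\<lambda>\<omega>. k s \<omega> (X y s \<omega>)))" (is ?g3)
proof -
  obtain V where V: "\<And>\<omega>. continuous_on UNIV (\<lambda>r. V r \<omega>)" "AE \<omega> in M. \<forall>r\<ge>0. V r \<omega> = W r \<omega>"
    "case_prod V \<in> borel_measurable (borel \<Otimes>\<^sub>M M)"
    using W_version by blast
  have [measurable]: "(\<lambda>p. V (fst p) (snd p)) \<in> borel_measurable (borel \<Otimes>\<^sub>M M)"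
    using V(3) by (simp add: case_prod_beta')
  define \<phi> where "\<phi> s \<omega> = k s \<omega> (y + \<sigma> * V s \<omega>)" for s \<omega>
  have m: "case_prod \<phi> \<in> borel_measurable (borel \<Otimes>\<^sub>M M)"
  proof -
    have "(\<lambda>p. (fst p, snd p, y + \<sigma> * V (fst p) (snd p))) \<in> borel \<Otimes>\<^sub>M M \<rightarrow>\<^sub>M borel \<Otimes>\<^sub>M (M \<Otimes>\<^sub>M borel)" by measurable
    from measurable_compose[OF this k] show ?thesis by (simp add: \<phi>_def split_def)
  qed
  have m1: "\<phi> s \<in> borel_measurable M" for s using m by measurable
  have ae: "AE \<omega> in M. k s \<omega> (X y s \<omega>) = \<phi> s \<omega>" if "0 \<le> s" for s
    using V(2) by eventually_elim (use that in \<open>simp add: \<phi>_def X_proc_def\<close>)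
  note m2 = borel_measurable_AE[OF m1 ae]
  have i: "integrable M (\<phi> s)" and b: "expectation (\<lambda>\<omega>. \<bar>\<phi> s \<omega>\<bar>) \<le> C + (\<bar>y\<bar> + \<sigma> * sqrt a)"
    and e: "expectation (\<phi> s) = expectation (\<lambda>\<omega>. k s \<omega> (X y s \<omega>))" if s: "s \<in> {0..a}" for s
  proof -
    have s0: "0 \<le> s" "s \<le> a" using s by auto
    have iX: "integrable M (\<lambda>\<omega>. C + \<bar>X y s \<omega>\<bar>)" using qbound_integrable_X[OF qbound_abs s0(1)] by simp
    have le: "\<bar>k s \<omega> (X y s \<omega>)\<bar> \<le> C + \<bar>X y s \<omega>\<bar>" for \<omega> by (rule bound[OF s0(1)])
    have ik: "integrable M (\<lambda>\<omega>. k s \<omega> (X y s \<omega>))"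
      by (rule Bochner_Integration.integrable_bound[OF iX m2[OF s0(1)]]) (use le in \<open>force intro: order_trans[OF _ abs_ge_self]\<close>)
    show "integrable M (\<phi> s)" using ik integrable_cong_AE[OF m2[OF s0(1)] m1 ae[OF s0(1)]] by simp
    show "expectation (\<phi> s) = expectation (\<lambda>\<omega>. k s \<omega> (X y s \<omega>))"
      using integral_cong_AE[OF m2[OF s0(1)] m1 ae[OF s0(1)]] by simp
    have "expectation (\<lambda>\<omega>. \<bar>\<phi> s \<omega>\<bar>) = expectation (\<lambda>\<omega>. \<bar>k s \<omega> (X y s \<omega>)\<bar>)"
      using ae[OF s0(1)] m1 m2[OF s0(1)] by (intro integral_cong_AE) auto
    also have "\<dots> \<le> expectation (\<lambda>\<omega>. C + \<bar>X y s \<omega>\<bar>)" by (intro integral_mono integrable_abs ik iX le)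
    also have "\<dots> = C + P s (\<lambda>x. \<bar>x\<bar>) y"
      using expectation_X[OF qbound_abs s0(1)] qbound_integrable_X[OF qbound_abs s0(1)] by (simp add: prob_space)
    also have "P s (\<lambda>x. \<bar>x\<bar>) y \<le> 0 + 1 * (\<bar>y\<bar> + \<sigma> * sqrt s)"
      using s0 \<sigma>_pos by (intro order_trans[OF abs_ge_self heat_abs_le_linear]) auto
    also have "0 + 1 * (\<bar>y\<bar> + \<sigma> * sqrt s) \<le> \<bar>y\<bar> + \<sigma> * sqrt a" using s0 \<sigma>_pos by (simp add: mult_left_mono)
    finally show "expectation (\<lambda>\<omega>. \<bar>\<phi> s \<omega>\<bar>) \<le> C + (\<bar>y\<bar> + \<sigma> * sqrt a)" by simp
  qed
  note fub = fubini_time[OF m i b]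
  have path: "AE \<omega> in M. (LBINT s:{0..a}. k s \<omega> (X y s \<omega>)) = (LBINT s:{0..a}. \<phi> s \<omega>)"
    using V(2) by eventually_elim (intro set_lebesgue_integral_cong, auto simp: \<phi>_def X_proc_def)
  note m3 = borel_measurable_integrable[OF fub(2)] and m4 = borel_measurable_AE[OF borel_measurable_integrable[OF fub(2)] path]
  have "(LBINT s:{0..a}. expectation (\<phi> s)) = (LBINT s:{0..a}. expectation (\<lambda>\<omega>. k s \<omega> (X y s \<omega>)))"
    using e by (intro set_lebesgue_integral_cong) auto
  then show ?g1
    using integral_cong_AE[OF m4 m3 path] fub(1) by simp
  show ?g2
    using fub(2) integrable_cong_AE[OF m4 m3 path] by simp
  show ?g3
    by (rule iffD1[OF set_integrable_cong[OF refl refl e] fub(3)])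
qed

text \<open>The random upper limit becomes the indicator of \<open>{s < \<tau>}\<close>; along a
  path the two integrands differ at \<open>s = \<tau> \<omega>\<close> at most. After the exchange
  the time is deterministic and the event belongs to \<open>F s\<close>, which is exactly what
  \<open>markov\<close> accepts. The last conclusion permits splitting the running cost path by path
  in \<open>value_fun_eq\<close>.\<close>

lemma payoff_fubini:
  assumes \<tau>: "\<tau> \<in> stopping_times_upto M F a" and h: "continuous_on UNIV h" and hb: "\<And>s. 0 \<le> s \<Longrightarrow> \<bar>h s\<bar> \<le> H"
    and \<rho>: "0 \<le> \<rho>"
  shows "expectation (\<lambda>\<omega>. LBINT s:{0..\<tau> \<omega>}. exp (- \<rho> * s) * (h s - X y s \<omega>)) =
      (LBINT s:{0..a}. exp (- \<rho> * s) * expectation (\<lambda>\<omega>. indicator {\<omega> \<in> space M. s < \<tau> \<omega>} \<omega> * (h s - X y s \<omega>)))" (is ?g1)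
    and "integrable M (\<lambda>\<omega>. LBINT s:{0..\<tau> \<omega>}. exp (- \<rho> * s) * (h s - X y s \<omega>))" (is ?g2)
    and "set_integrable lborel {0..a} (\<lambda>s. exp (- \<rho> * s) * expectation (\<lambda>\<omega>. indicator {\<omega> \<in> space M. s < \<tau> \<omega>} \<omega> * (h s - X y s \<omega>)))" (is ?g3)
    and "AE \<omega> in M. set_integrable lborel {0..\<tau> \<omega>} (\<lambda>s. exp (- \<rho> * s) * (h s - X y s \<omega>))" (is ?g4)
proof -
  note [measurable] = stopping_times_uptoD(1)[OF \<tau>]
  have [measurable]: "h \<in> borel_measurable borel" by (rule borel_measurable_continuous_onI[OF h])
  let ?g = "\<lambda>\<omega> s. exp (- \<rho> * s) * (h s - X y s \<omega>)"
  define k where "k s \<omega> x = exp (- \<rho> * s) * (if s < \<tau> \<omega> then h s - x else 0)" for s \<omega> x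
  have km: "(\<lambda>p. k (fst p) (fst (snd p)) (snd (snd p))) \<in> borel_measurable (borel \<Otimes>\<^sub>M (M \<Otimes>\<^sub>M borel))"
    unfolding k_def by measurable
  have kb: "\<bar>k s \<omega> x\<bar> \<le> H + \<bar>x\<bar>" if s: "0 \<le> s" for s \<omega> x
  proof -
    have "\<bar>k s \<omega> x\<bar> \<le> 1 * \<bar>h s - x\<bar>"
      unfolding k_def abs_mult using \<rho> s by (intro mult_mono) auto
    then show ?thesis using hb[OF s] by simp
  qed
  note fub = path_fubini[OF km kb, of a y]
  have kE: "expectation (\<lambda>\<omega>. k s \<omega> (X y s \<omega>)) = exp (- \<rho> * s) * expectation (\<lambda>\<omega>. indicator {\<omega> \<in> space M. s < \<tau> \<omega>} \<omega> * (h s - X y s \<omega>))" for s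
  proof -
    have "expectation (\<lambda>\<omega>. k s \<omega> (X y s \<omega>)) = expectation (\<lambda>\<omega>. exp (- \<rho> * s) * (indicator {\<omega> \<in> space M. s < \<tau> \<omega>} \<omega> * (h s - X y s \<omega>)))"
      by (rule Bochner_Integration.integral_cong) (auto simp: k_def indicator_def)
    then show ?thesis by simp
  qed
  have path: "AE \<omega> in M. (\<forall>c. set_integrable lborel {0..c} (?g \<omega>)) \<and> (LBINT s:{0..\<tau> \<omega>}. ?g \<omega> s) = (LBINT s:{0..a}. k s \<omega> (X y s \<omega>))"
    using W_continuous AE_space
  proof eventually_elim
    case (elim \<omega>)
    have \<tau>\<omega>: "0 \<le> \<tau> \<omega>" "\<tau> \<omega> \<le> a" using stopping_times_uptoD(2)[OF \<tau> elim(2)] by auto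
    have gi: "set_integrable lborel {0..c} (?g \<omega>)" for c
      unfolding X_proc_def
      by (intro borel_integrable_atLeastAtMost' continuous_intros continuous_on_subset[OF h] continuous_on_subset[OF elim(1)]) auto
    have "(LBINT s:{0..\<tau> \<omega>}. ?g \<omega> s) = (LBINT s:{0..a}. k s \<omega> (X y s \<omega>))"
      unfolding set_lebesgue_integral_def
    proof (rule integral_cong_AE)
      show "(\<lambda>s. indicator {0..\<tau> \<omega>} s *\<^sub>R ?g \<omega> s) \<in> borel_measurable lborel"
        using gi unfolding set_integrable_def by (rule borel_measurable_integrable)
      have [measurable]: "(\<lambda>s. indicator {0..a} s *\<^sub>R ?g \<omega> s) \<in> borel_measurable lborel"
        using gi unfolding set_integrable_def by (rule borel_measurable_integrable)
      have "(\<lambda>s. indicator {..<\<tau> \<omega>} s * (indicator {0..a} s *\<^sub>R ?g \<omega> s)) \<in> borel_measurable lborel" by measurable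
      also have "(\<lambda>s. indicator {..<\<tau> \<omega>} s * (indicator {0..a} s *\<^sub>R ?g \<omega> s)) = (\<lambda>s. indicator {0..a} s *\<^sub>R k s \<omega> (X y s \<omega>))"
        by (auto simp: k_def indicator_def)
      finally show "(\<lambda>s. indicator {0..a} s *\<^sub>R k s \<omega> (X y s \<omega>)) \<in> borel_measurable lborel" .
      show "AE s in lborel. indicator {0..\<tau> \<omega>} s *\<^sub>R ?g \<omega> s = indicator {0..a} s *\<^sub>R k s \<omega> (X y s \<omega>)"
        using AE_lborel_singleton[of "\<tau> \<omega>"]
        by eventually_elim (use \<tau>\<omega> in \<open>auto simp: k_def indicator_def\<close>)
    qed
    then show ?case using gi by simp
  qed
  then have ae: "AE \<omega> in M. (LBINT s:{0..\<tau> \<omega>}. ?g \<omega> s) = (LBINT s:{0..a}. k s \<omega> (X y s \<omega>))" by auto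
  note m3 = borel_measurable_integrable[OF fub(2)] and m4 = borel_measurable_AE[OF borel_measurable_integrable[OF fub(2)] ae]
  show ?g1
    using integral_cong_AE[OF m4 m3 ae] fub(1) unfolding kE by simp
  show ?g2
    using fub(2) integrable_cong_AE[OF m4 m3 ae] by simp
  show ?g3
    using fub(3) unfolding kE .
  show ?g4
    using path by auto
qed

end

section \<open>The stopping problem\<close>

lemma set_integral_combine:
  fixes g :: "real \<Rightarrow> real"
  assumes g: "set_integrable lborel {a..c} g" and "a \<le> b" "b \<le> c"
  shows "(LBINT s:{a..c}. g s) = (LBINT s:{a..b}. g s) + (LBINT s:{b..c}. g s)"
proof -
  have i: "set_integrable lborel {a..b} g" "set_integrable lborel {b..c} g"
    using assms by (auto intro: set_integrable_subset[OF g])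
  show ?thesis
    using Henstock_Kurzweil_Integration.integral_combine[OF assms(2,3) set_borel_integral_eq_integral(1)[OF g]]
    by (simp add: set_borel_integral_eq_integral(2)[OF g] set_borel_integral_eq_integral(2)[OF i(1)]
        set_borel_integral_eq_integral(2)[OF i(2)])
qed

lemma set_integral_shift:
  fixes g :: "real \<Rightarrow> real"
  shows "(LBINT s:{c..c + h}. g s) = (LBINT r:{0..h}. g (c + r))" (is ?g1)
    and "set_integrable lborel {c..c + h} g \<longleftrightarrow> set_integrable lborel {0..h} (\<lambda>r. g (c + r))" (is ?g2)
proof -
  have ind: "indicator {c..c + h} (c + 1 * x) = (indicator {0..h} x :: real)" for x by (simp add: indicator_def)
  show ?g1
    unfolding set_lebesgue_integral_def
    by (subst lborel_integral_real_affine[where c = 1 and t = c]) (simp_all add: ind[simplified])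
  show ?g2
    unfolding set_integrable_def
    using lborel_integrable_real_affine_iff[of 1 "\<lambda>s. indicator {c..c + h} s *\<^sub>R g s" c]
    by (simp add: ind[simplified])
qed

lemma set_integral_singleton [simp]: "(LBINT s:{a}. g s :: real) = 0"
  unfolding set_lebesgue_integral_def
proof (rule integral_eq_zero_AE)
  show "AE s in lborel. indicator {a} s *\<^sub>R g s = 0"
    using AE_lborel_singleton[of a] by eventually_elim simp
qed

lemma set_integral_grid:
  fixes g :: "real \<Rightarrow> real"
  assumes "set_integrable lborel {0..real n * h} g" and "0 \<le> h"
  shows "(LBINT s:{0..real n * h}. g s) = (\<Sum>k<n. LBINT s:{real k * h..real (Suc k) * h}. g s)"
  using assms(1)
proof (induction n)
  case 0
  then show ?case by simp
next
  case (Suc n)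
  have le: "real n * h \<le> real (Suc n) * h" using \<open>0 \<le> h\<close> by (intro mult_right_mono) auto
  have "set_integrable lborel {0..real n * h} g"
    using le by (intro set_integrable_subset[OF Suc.prems]) auto
  note IH = Suc.IH[OF this]
  show ?case
    using set_integral_combine[OF Suc.prems _ le] \<open>0 \<le> h\<close> by (simp add: IH)
qed

lemma set_integrable_const_Icc [simp]: "set_integrable lborel {a..b} (\<lambda>s. c :: real)" for a b :: real
  using borel_integrable_atLeastAtMost'[of a b "\<lambda>s. c"] by simp

lemma set_integral_const_Icc: "a \<le> b \<Longrightarrow> (LBINT s:{a..b}. c :: real) = (b - a) * c" for a b :: real
  unfolding set_lebesgue_integral_def by simp

lemma set_integral_bounded:
  fixes g :: "real \<Rightarrow> real"
  assumes m: "(\<lambda>s. indicator {a..b} s *\<^sub>R g s) \<in> borel_measurable lborel"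
    and g: "\<And>s. s \<in> {a..b} \<Longrightarrow> \<bar>g s\<bar> \<le> C" and ab: "a \<le> b"
  shows "set_integrable lborel {a..b} g" "\<bar>LBINT s:{a..b}. g s\<bar> \<le> (b - a) * C" (is ?g2)
proof -
  have C: "0 \<le> C" using g[of a] ab by simp
  show i: "set_integrable lborel {a..b} g"
    unfolding set_integrable_def
  proof (rule Bochner_Integration.integrable_bound[OF _ m])
    show "integrable lborel (\<lambda>s. indicator {a..b} s *\<^sub>R C)"
      using set_integrable_const_Icc[of a b C] unfolding set_integrable_def .
    show "AE s in lborel. norm (indicator {a..b} s *\<^sub>R g s) \<le> norm (indicator {a..b} s *\<^sub>R C)"
      using g C by (intro AE_I2) (simp add: indicator_def)
  qed
  have "(LBINT s:{a..b}. g s) \<le> (LBINT s:{a..b}. C)" "(LBINT s:{a..b}. - C) \<le> (LBINT s:{a..b}. g s)"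
    using g by (intro set_integral_mono i set_integrable_const_Icc; fastforce simp: abs_le_iff)+
  then show ?g2
    unfolding set_integral_const_Icc[OF ab] abs_le_iff mult_minus_right by linarith
qed

text \<open>The coefficient \<open>f\<close> lives on the whole line, so that
  \<open>f (t + s)\<close> can be written without range conditions. The given one is extended from
  \<open>[0,T]\<close> by constants, which preserves continuity, monotonicity and
  boundedness.\<close>

locale stopping_problem = diffusion M F W \<sigma>
  for M :: "'a measure" and F :: "real \<Rightarrow> 'a measure" and W :: "real \<Rightarrow> 'a \<Rightarrow> real" and \<sigma> :: real +
  fixes T \<rho> fb :: real and f :: "real \<Rightarrow> real"
  assumes T_pos: "0 < T" and \<rho>_pos: "0 < \<rho>"
    and f_cont: "continuous_on UNIV f" and f_antimono: "\<And>s t. s \<le> t \<Longrightarrow> f t \<le> f s" and f_bound: "\<And>s. \<bar>f s\<bar> \<le> fb"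
begin

abbreviation damp :: "real \<Rightarrow> real" where "damp s \<equiv> exp (- \<rho> * s)"

abbreviation gain :: "'a set \<Rightarrow> real \<Rightarrow> real \<Rightarrow> real \<Rightarrow> real" where
  "gain A t y s \<equiv> expectation (\<lambda>\<omega>. indicator A \<omega> * (f (t + s) - X y s \<omega>))"

abbreviation (input) alive :: "real \<Rightarrow> ('a \<Rightarrow> real) \<Rightarrow> 'a set" where
  "alive s \<tau> \<equiv> {\<omega> \<in> space M. s < \<tau> \<omega>}"

lemma f_measurable [measurable]: "f \<in> borel_measurable borel"
  by (rule borel_measurable_continuous_onI[OF f_cont])

lemma fb_nonneg: "0 \<le> fb" using f_bound[of 0] by simp

lemma f_shift_cont: "continuous_on A (\<lambda>s. f (t + s))"
  by (rule continuous_on_compose2[OF f_cont]) (auto intro!: continuous_intros)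

definition J :: "real \<Rightarrow> real \<Rightarrow> ('a \<Rightarrow> real) \<Rightarrow> real" where
  "J t y \<tau> = (LBINT s:{0..T - t}. damp s *
     gain (alive s \<tau>) t y s)"

text \<open>\<open>J\<close> is the expected gain with the time integral outside the expectation, and \<open>u\<close> is \<open>K\<close> minus the
  value function when \<open>f = \<alpha>(2-\<alpha>)\<theta> + \<rho>K\<close> on \<open>[0,T]\<close>.\<close>

definition u :: "real \<Rightarrow> real \<Rightarrow> real" where
  "u t y = (SUP \<tau>\<in>stopping_times_upto M F (T - t). J t y \<tau>)"

lemma J_eq_expectation:
  assumes "\<tau> \<in> stopping_times_upto M F (T - t)"
  shows "J t y \<tau> = expectation (\<lambda>\<omega>. LBINT s:{0..\<tau> \<omega>}. damp s * (f (t + s) - X y s \<omega>))"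
  unfolding J_def using payoff_fubini(1)[OF assms f_shift_cont[of UNIV t] f_bound order.strict_implies_order[OF \<rho>_pos]] by simp

lemma J_integrable:
  assumes "\<tau> \<in> stopping_times_upto M F (T - t)"
  shows "set_integrable lborel {0..T - t} (\<lambda>s. damp s *
     gain (alive s \<tau>) t y s)"
  by (rule payoff_fubini(3)[OF assms f_shift_cont[of UNIV t] f_bound order.strict_implies_order[OF \<rho>_pos]])

lemma alive_sets:
  assumes "\<tau> \<in> stopping_times_upto M F a"
  shows "alive s \<tau> \<in> sets M" "alive s \<tau> \<in> sets (F s)"
  using stopping_times_uptoD(3)[OF assms, of s] sets_F_subset by auto

lemma exp_le_1: "0 \<le> s \<Longrightarrow> damp s \<le> 1"
  using \<rho>_pos by simp

text \<open>A supremum of reals is informative only for sets bounded above; this bound, uniform in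
  the stopping time, makes \<open>u\<close> the genuine supremum.\<close>

lemma J_bound:
  assumes \<tau>: "\<tau> \<in> stopping_times_upto M F (T - t)" and t: "0 \<le> t" "t \<le> T"
  shows "J t y \<tau> \<le> T * (fb + \<bar>y\<bar> + \<sigma> * sqrt T)"
proof -
  have "\<bar>J t y \<tau>\<bar> \<le> (T - t - 0) * (fb + \<bar>y\<bar> + \<sigma> * sqrt T)"
    unfolding J_def
  proof (rule set_integral_bounded(2))
    show "(\<lambda>s. indicator {0..T - t} s *\<^sub>R (damp s *
        gain (alive s \<tau>) t y s)) \<in> borel_measurable lborel"
      using J_integrable[OF \<tau>] unfolding set_integrable_def by (rule borel_measurable_integrable)
    fix s assume s: "s \<in> {0..T - t}"
    let ?E = "gain (alive s \<tau>) t y s"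
    have "\<bar>?E\<bar> \<le> expectation (\<lambda>\<omega>. \<bar>indicator (alive s \<tau>) \<omega> * (f (t + s) - X y s \<omega>)\<bar>)"
      by (rule integral_abs_bound)
    also have "\<dots> \<le> \<bar>f (t + s)\<bar> + \<bar>y\<bar> + \<sigma> * sqrt s"
      using s by (intro expectation_X_affine alive_sets[OF \<tau>]) auto
    also have "\<dots> \<le> fb + \<bar>y\<bar> + \<sigma> * sqrt T"
      using f_bound[of "t + s"] s t \<sigma>_pos by (intro add_mono mult_left_mono) auto
    finally have "damp s * \<bar>?E\<bar> \<le> 1 * (fb + \<bar>y\<bar> + \<sigma> * sqrt T)"
      using exp_le_1[of s] s by (intro mult_mono) auto
    then show "\<bar>damp s * ?E\<bar> \<le> fb + \<bar>y\<bar> + \<sigma> * sqrt T" by (simp add: abs_mult)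
  qed (use t in simp)
  also have "\<dots> \<le> T * (fb + \<bar>y\<bar> + \<sigma> * sqrt T)"
    using t fb_nonneg \<sigma>_pos T_pos by (intro mult_right_mono) auto
  finally show ?thesis by simp
qed

lemma zero_stopping: "0 \<le> a \<Longrightarrow> (\<lambda>_. 0) \<in> stopping_times_upto M F a"
  by (simp add: stopping_times_upto_def stopping_time_const)

lemma u_upper:
  assumes "\<tau> \<in> stopping_times_upto M F (T - t)" "0 \<le> t" "t \<le> T"
  shows "J t y \<tau> \<le> u t y"
  unfolding u_def
  by (rule cSUP_upper[OF assms(1)]) (auto intro!: bdd_aboveI2 J_bound assms)

lemma u_least:
  assumes "t \<le> T" "\<And>\<tau>. \<tau> \<in> stopping_times_upto M F (T - t) \<Longrightarrow> J t y \<tau> \<le> c"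
  shows "u t y \<le> c"
  unfolding u_def using zero_stopping[of "T - t"] assms by (intro cSUP_least) auto

lemma J_zero: "J t y (\<lambda>_. 0) = 0"
proof -
  have "J t y (\<lambda>_. 0) = (LBINT s:{0..T - t}. 0)"
    unfolding J_def by (rule set_lebesgue_integral_cong) (auto simp: indicator_def)
  then show ?thesis by simp
qed

lemma u_nonneg: "0 \<le> t \<Longrightarrow> t \<le> T \<Longrightarrow> 0 \<le> u t y"
  using u_upper[OF zero_stopping, of t y] by (simp add: J_zero)

text \<open>One stopping time serves both starting points, because
  \<open>X y' s - X y s = y' - y\<close> along every path; while the process runs, the gain thus
  falls by at most \<open>y' - y\<close> per unit of time.\<close>

lemma J_diff_space:
  assumes \<tau>: "\<tau> \<in> stopping_times_upto M F (T - t)" and t: "t \<le> T" and y: "y \<le> y'"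
  shows "J t y' \<tau> \<le> J t y \<tau>" and "J t y \<tau> \<le> J t y' \<tau> + (T - t) * (y' - y)" (is ?g2)
proof -
  let ?E = "\<lambda>y s. gain (alive s \<tau>) t y s"
  have i: "integrable M (\<lambda>\<omega>. indicator (alive s \<tau>) \<omega> * (f (t + s) - X y s \<omega>))" if "0 \<le> s" for s y
    by (rule expectation_X_affine(1)[OF alive_sets(1)[OF \<tau>] that])
  have 1: "?E y' s \<le> ?E y s" if "0 \<le> s" for s
    using y by (intro integral_mono i that mult_left_mono) (auto simp: X_proc_def)
  have 2: "?E y s \<le> ?E y' s + (y' - y)" if "0 \<le> s" for s
  proof -
    have "?E y s \<le> expectation (\<lambda>\<omega>. indicator (alive s \<tau>) \<omega> * (f (t + s) - X y' s \<omega>) + (y' - y))"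
      using y by (intro integral_mono i that Bochner_Integration.integrable_add) (auto simp: X_proc_def indicator_def)
    then show ?thesis using i[OF that] by (simp add: prob_space)
  qed
  show "J t y' \<tau> \<le> J t y \<tau>"
    unfolding J_def by (rule set_integral_mono[OF J_integrable[OF \<tau>] J_integrable[OF \<tau>]]) (use 1 in auto)
  have "J t y \<tau> \<le> (LBINT s:{0..T - t}. damp s * ?E y' s + (y' - y))"
    unfolding J_def
  proof (rule set_integral_mono[OF J_integrable[OF \<tau>]])
    show "set_integrable lborel {0..T - t} (\<lambda>s. damp s * ?E y' s + (y' - y))"
      by (intro set_integral_add J_integrable[OF \<tau>] set_integrable_const_Icc)
    fix s assume s: "s \<in> {0..T - t}"
    have "damp s * ?E y s \<le> damp s * (?E y' s + (y' - y))"
      using 2[of s] s by (intro mult_left_mono) auto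
    also have "\<dots> \<le> damp s * ?E y' s + 1 * (y' - y)"
      unfolding distrib_left using y exp_le_1[of s] s by (intro add_left_mono mult_right_mono) auto
    finally show "damp s * ?E y s \<le> damp s * ?E y' s + (y' - y)" by simp
  qed
  also have "\<dots> = J t y' \<tau> + (T - t) * (y' - y)"
    unfolding J_def using set_integral_add(2)[OF J_integrable[OF \<tau>] set_integrable_const_Icc] t
    by (simp add: set_integral_const_Icc)
  finally show ?g2 .
qed

lemma u_antimono_space:
  assumes "0 \<le> t" "t \<le> T" "y \<le> y'"
  shows "u t y' \<le> u t y"
proof (rule u_least[OF assms(2)])
  fix \<tau> assume "\<tau> \<in> stopping_times_upto M F (T - t)"
  then show "J t y' \<tau> \<le> u t y"
    using J_diff_space(1)[OF _ assms(2,3)] u_upper[OF _ assms(1,2)] order_trans by blast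
qed

lemma u_lipschitz:
  assumes "0 \<le> t" "t \<le> T"
  shows "\<bar>u t y - u t y'\<bar> \<le> (T - t) * \<bar>y - y'\<bar>"
proof -
  have *: "u t y \<le> u t y' + (T - t) * (y' - y)" if "y \<le> y'" for y y'
  proof (rule u_least[OF assms(2)])
    fix \<tau> assume "\<tau> \<in> stopping_times_upto M F (T - t)"
    then show "J t y \<tau> \<le> u t y' + (T - t) * (y' - y)"
      using J_diff_space(2)[OF _ assms(2) that] u_upper[OF _ assms, of \<tau> y'] by fastforce
  qed
  show ?thesis
    using *[of y y'] *[of y' y] u_antimono_space[OF assms, of y y'] u_antimono_space[OF assms, of y' y]
    by (cases "y \<le> y'") (auto simp: abs_if)
qed

text \<open>A stopping time for the shorter horizon is admissible for the longer one, and since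
  \<open>f\<close> is non-increasing, the earlier start collects at least as much along it.\<close>

lemma J_mono_time:
  assumes \<tau>: "\<tau> \<in> stopping_times_upto M F (T - t')" and t: "0 \<le> t" "t \<le> t'" "t' \<le> T"
  shows "\<tau> \<in> stopping_times_upto M F (T - t)" and "J t' y \<tau> \<le> J t y \<tau>"
proof -
  show \<tau>2: "\<tau> \<in> stopping_times_upto M F (T - t)"
    using \<tau> t by (force simp: stopping_times_upto_def)
  let ?E = "\<lambda>t s. gain (alive s \<tau>) t y s"
  have i: "integrable M (\<lambda>\<omega>. indicator (alive s \<tau>) \<omega> * (f (t + s) - X y s \<omega>))" if "0 \<le> s" for s t
    by (rule expectation_X_affine(1)[OF alive_sets(1)[OF \<tau>] that])
  have 1: "?E t' s \<le> ?E t s" if "0 \<le> s" for s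
    using f_antimono[of "t + s" "t' + s"] t by (intro integral_mono i that mult_left_mono) auto
  have i1: "set_integrable lborel {0..T - t'} (\<lambda>s. damp s * ?E t s)"
    using t by (intro set_integrable_subset[OF J_integrable[OF \<tau>2]]) auto
  have "J t' y \<tau> \<le> (LBINT s:{0..T - t'}. damp s * ?E t s)"
    unfolding J_def by (rule set_integral_mono[OF J_integrable[OF \<tau>] i1]) (use 1 in auto)
  also have "\<dots> = J t y \<tau>"
    unfolding J_def set_lebesgue_integral_def
  proof (rule Bochner_Integration.integral_cong[OF refl])
    fix s
    \<comment> \<open>Beyond the shorter horizon nobody is alive, so enlarging the interval of
      integration adds nothing.\<close>
    have "?E t s = 0" if "T - t' < s"
    proof -
      have "alive s \<tau> = {}" using stopping_times_uptoD(2)[OF \<tau>] that by fastforce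
      then show ?thesis by simp
    qed
    then show "indicator {0..T - t'} s *\<^sub>R (damp s * ?E t s) = indicator {0..T - t} s *\<^sub>R (damp s * ?E t s)"
      using t by (auto simp: indicator_def)
  qed
  finally show "J t' y \<tau> \<le> J t y \<tau>" .
qed

lemma u_antimono_time:
  assumes "0 \<le> t" "t \<le> t'" "t' \<le> T"
  shows "u t' y \<le> u t y"
proof (rule u_least[OF assms(3)])
  fix \<tau> assume \<tau>: "\<tau> \<in> stopping_times_upto M F (T - t')"
  have "J t' y \<tau> \<le> J t y \<tau>" by (rule J_mono_time(2)[OF \<tau> assms])
  also have "\<dots> \<le> u t y" using J_mono_time(1)[OF \<tau> assms] assms by (intro u_upper) auto
  finally show "J t' y \<tau> \<le> u t y" .
qed

lemma u_T [simp]: "u T y = 0"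
proof (rule antisym)
  show "u T y \<le> 0"
  proof (rule u_least)
    fix \<tau> :: "'a \<Rightarrow> real"
    have "J T y \<tau> = 0"
      unfolding J_def by simp
    then show "J T y \<tau> \<le> 0" by simp
  qed simp
qed (use u_nonneg T_pos in auto)

section \<open>Bermudan approximation\<close>

text \<open>\<open>B h n s\<close> is the value at time \<open>s\<close> when stopping is allowed at the dates \<open>s, s + h, \<dots>, s + nh\<close> only,
  and \<open>H h s\<close> is the gain collected between two dates.\<close>

definition disc :: "real \<Rightarrow> real" where
  "disc h = (LBINT r:{0..h}. damp r)"

definition H :: "real \<Rightarrow> real \<Rightarrow> real \<Rightarrow> real" where
  "H h s x = (LBINT r:{0..h}. damp r * (f (s + r) - x))"

primrec B :: "real \<Rightarrow> nat \<Rightarrow> real \<Rightarrow> real \<Rightarrow> real" where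
  "B h 0 s x = 0"
| "B h (Suc n) s x = max 0 (H h s x + damp h * P h (B h n (s + h)) x)"

lemma disc_integrable: "set_integrable lborel {a..b} (\<lambda>r. damp r)"
  by (rule borel_integrable_atLeastAtMost') (intro continuous_intros)

lemma H_integrable: "set_integrable lborel {a..b} (\<lambda>r. damp r * (f (s + r) - x))"
  by (rule borel_integrable_atLeastAtMost') (intro continuous_intros f_shift_cont)

lemma disc_bounds:
  assumes "0 \<le> h"
  shows "0 \<le> disc h" "disc h \<le> h" "damp h * h \<le> disc h"
proof -
  show "0 \<le> disc h" unfolding disc_def set_lebesgue_integral_def by (intro Bochner_Integration.integral_nonneg) simp
  have "disc h \<le> (LBINT r:{0..h}. 1)"
    unfolding disc_def using exp_le_1 by (intro set_integral_mono disc_integrable) auto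
  then show "disc h \<le> h" using assms set_integral_const_Icc[of 0 h 1] by simp
  have "(LBINT r:{0..h}. damp h) \<le> disc h"
    unfolding disc_def using \<rho>_pos by (intro set_integral_mono disc_integrable) auto
  then show "damp h * h \<le> disc h" using assms set_integral_const_Icc[of 0 h] by (simp add: mult.commute)
qed

text \<open>This exact relation turns the discounted terminal cost \<open>K\<close> into the running
  gain \<open>\<rho> * K\<close>, and it balances the quadratic barrier over one step without an
  error term.\<close>

lemma disc_eq:
  assumes "0 \<le> h"
  shows "\<rho> * disc h = 1 - damp h"
proof -
  have "(LBINT r:{0..h}. damp r) = (- damp h / \<rho>) - (- damp 0 / \<rho>)"
    unfolding set_lebesgue_integral_def real_scaleR_def mult.commute[of "indicator _ _"]
    by (rule integral_FTC_Icc_real[OF assms])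
      (use \<rho>_pos in \<open>auto intro!: derivative_eq_intros continuous_intros\<close>)
  then show ?thesis unfolding disc_def using \<rho>_pos by (simp add: field_simps)
qed

lemma H_affine: "H h s x = H h s 0 - disc h * x"
proof -
  have "H h s x = (LBINT r:{0..h}. damp r * (f (s + r) - 0) - damp r * x)"
    unfolding H_def by (simp add: algebra_simps)
  also have "\<dots> = H h s 0 - (LBINT r:{0..h}. damp r * x)"
    unfolding H_def by (rule set_integral_diff(2)[OF H_integrable]) (intro set_integrable_mult_left disc_integrable)
  finally show ?thesis by (simp add: disc_def)
qed

lemma H_bound:
  assumes h: "0 \<le> h"
  shows "\<bar>H h s x\<bar> \<le> h * (fb + \<bar>x\<bar>)"
proof -
  have "\<bar>damp r * (f (s + r) - x)\<bar> \<le> fb + \<bar>x\<bar>" if "r \<in> {0..h}" for r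
  proof -
    have "\<bar>damp r * (f (s + r) - x)\<bar> \<le> 1 * \<bar>f (s + r) - x\<bar>"
      unfolding abs_mult using exp_le_1[of r] that by (intro mult_right_mono) auto
    then show ?thesis using f_bound[of "s + r"] by simp
  qed
  from set_integral_bounded(2)[OF _ this h] show ?thesis unfolding H_def by simp
qed

lemma H_lipschitz: "0 \<le> h \<Longrightarrow> \<bar>H h s x - H h s y\<bar> \<le> h * \<bar>x - y\<bar>"
proof -
  assume h: "0 \<le> h"
  have "H h s x - H h s y = - (disc h * (x - y))"
    using H_affine[of h s x] H_affine[of h s y] by (simp add: algebra_simps)
  then show ?thesis using disc_bounds[OF h] by (simp add: abs_mult mult_right_mono)
qed

lemma B_nonneg: "0 \<le> B h n s x"
  by (cases n) auto

lemma B_lipschitz: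
  assumes "0 \<le> h"
  shows "\<bar>B h n s x - B h n s y\<bar> \<le> (real n * h) * \<bar>x - y\<bar>"
proof (induction n arbitrary: s x y)
  case (Suc n)
  let ?p = "\<lambda>x. damp h * P h (B h n (s + h)) x"
  have a: "\<bar>P h (B h n (s + h)) x - P h (B h n (s + h)) y\<bar> \<le> (real n * h) * \<bar>x - y\<bar>"
    using Suc.IH assms by (intro heat_lipschitz) auto
  have b: "\<bar>?p x - ?p y\<bar> \<le> 1 * \<bar>P h (B h n (s + h)) x - P h (B h n (s + h)) y\<bar>"
    unfolding right_diff_distrib[symmetric] abs_mult using exp_le_1[OF assms] by (intro mult_right_mono) auto
  have "\<bar>?p x - ?p y\<bar> \<le> (real n * h) * \<bar>x - y\<bar>"
    by (rule order_trans[OF b[unfolded mult_1] a])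
  moreover have "\<bar>H h s x - H h s y\<bar> \<le> h * \<bar>x - y\<bar>" by (rule H_lipschitz[OF assms])
  moreover have "\<bar>B h (Suc n) s x - B h (Suc n) s y\<bar> \<le> \<bar>H h s x - H h s y\<bar> + \<bar>?p x - ?p y\<bar>"
    unfolding B.simps by linarith
  moreover have "real (Suc n) * h * \<bar>x - y\<bar> = h * \<bar>x - y\<bar> + real n * h * \<bar>x - y\<bar>"
    by (simp add: algebra_simps)
  ultimately show ?case by linarith
qed simp

lemma B_qbound: "0 \<le> h \<Longrightarrow> qbound (\<bar>B h n s 0\<bar> + real n * h) (B h n s)"
  by (rule qbound_lipschitz(1)[OF B_lipschitz]) auto

lemma B_measurable: "0 \<le> h \<Longrightarrow> B h n s \<in> borel_measurable borel"
  by (rule qbound_measurable[OF B_qbound])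

text \<open>\<open>(y - x0)\<^sup>2\<close> is a supersolution vanishing at \<open>x0\<close>; this bounds the stopping boundary from above.\<close>

definition x0 :: real where "x0 = fb + \<sigma>\<^sup>2 + 1 / (4 * \<rho>)"

lemma qbound_sq: "qbound (2 * (1 + a\<^sup>2)) (\<lambda>x. (x - a)\<^sup>2)"
proof (rule qboundI)
  fix x :: real
  have "(x - a)\<^sup>2 \<le> 2 * x\<^sup>2 + 2 * a\<^sup>2"
    using sum_squares_bound[of x "- a"] by (simp add: power2_diff)
  also have "\<dots> \<le> 2 * (1 + a\<^sup>2) * (1 + x\<^sup>2)" by (simp add: algebra_simps)
  finally show "\<bar>(x - a)\<^sup>2\<bar> \<le> 2 * (1 + a\<^sup>2) * (1 + x\<^sup>2)" by simp
qed measurable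

lemma B_le_sq:
  assumes h: "0 \<le> h"
  shows "B h n s x \<le> (x - x0)\<^sup>2"
proof (induction n arbitrary: s x)
  case (Suc n)
  have "P h (B h n (s + h)) x \<le> P h (\<lambda>x. (x - x0)\<^sup>2) x"
    by (rule heat_mono[OF B_qbound[OF h] qbound_sq Suc.IH])
  then have 1: "damp h * P h (B h n (s + h)) x \<le> damp h * ((x - x0)\<^sup>2 + \<sigma>\<^sup>2 * h)"
    unfolding heat_sq[OF h] by (rule mult_left_mono) simp
  have "H h s x \<le> (LBINT r:{0..h}. damp r * (fb - x))"
    unfolding H_def
  proof (rule set_integral_mono[OF H_integrable])
    show "set_integrable lborel {0..h} (\<lambda>r. damp r * (fb - x))"
      by (intro set_integrable_mult_left disc_integrable)
    show "damp r * (f (s + r) - x) \<le> damp r * (fb - x)" for r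
      using f_bound[of "s + r"] by (intro mult_left_mono) auto
  qed
  then have 2: "H h s x \<le> disc h * (fb - x)" by (simp add: disc_def)
  have 3: "\<sigma>\<^sup>2 * (damp h * h) \<le> \<sigma>\<^sup>2 * disc h"
    using disc_bounds(3)[OF h] by (intro mult_left_mono) auto
  \<comment> \<open>Completing the square is the origin of \<open>x0\<close>: the summand
    \<open>1 / (4 * \<rho>)\<close> absorbs the gain that is linear in \<open>x\<close>, and
    \<open>\<sigma>\<^sup>2\<close> pays for the growth of the variance.\<close>
  have "0 \<le> \<rho> * (x - x0 + 1 / (2 * \<rho>))\<^sup>2" using \<rho>_pos by simp
  also have "\<dots> = \<rho> * (x - x0)\<^sup>2 + (x - x0) + 1 / (4 * \<rho>)"
    using \<rho>_pos by (simp add: power2_eq_square field_simps)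
  finally have "fb - x + \<sigma>\<^sup>2 \<le> \<rho> * (x - x0)\<^sup>2" by (simp add: x0_def)
  then have 4: "disc h * (fb - x + \<sigma>\<^sup>2) \<le> disc h * (\<rho> * (x - x0)\<^sup>2)"
    using disc_bounds(1)[OF h] by (intro mult_left_mono) auto
  have "disc h * (\<rho> * (x - x0)\<^sup>2) = (1 - damp h) * (x - x0)\<^sup>2"
    unfolding disc_eq[OF h, symmetric] by simp
  then have "H h s x + damp h * P h (B h n (s + h)) x \<le> (x - x0)\<^sup>2"
    using 1 2 3 4 by (simp add: algebra_simps)
  then show ?case by simp
qed simp


section \<open>Bermudan values against stopping times\<close>

abbreviation (input) grid_gain :: "real \<Rightarrow> real \<Rightarrow> real \<Rightarrow> (nat \<Rightarrow> 'a set) \<Rightarrow> nat \<Rightarrow> real" where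
  "grid_gain h t y A k \<equiv> expectation (\<lambda>\<omega>. indicator (A k) \<omega> * H h (t + real k * h) (X y (real k * h) \<omega>))"

lemma H_qbound: "0 \<le> h \<Longrightarrow> qbound (\<bar>H h s 0\<bar> + h) (H h s)"
  by (rule qbound_lipschitz(1)[OF H_lipschitz]) auto

lemma F_sets_M: "A \<in> sets (F s) \<Longrightarrow> A \<in> sets M"
  using sets_F_subset by auto

lemma B_step_expectation:
  assumes h: "0 \<le> h" and A: "A \<in> sets (F (real k * h))"
  shows "expectation (\<lambda>\<omega>. indicator A \<omega> * (H h s (X y (real k * h) \<omega>) + damp h * P h (B h m s') (X y (real k * h) \<omega>)))
    = expectation (\<lambda>\<omega>. indicator A \<omega> * H h s (X y (real k * h) \<omega>))
      + damp h * expectation (\<lambda>\<omega>. indicator A \<omega> * B h m s' (X y (real (Suc k) * h) \<omega>))" (is ?g1)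
    and "integrable M (\<lambda>\<omega>. indicator A \<omega> * (H h s (X y (real k * h) \<omega>) + damp h * P h (B h m s') (X y (real k * h) \<omega>)))" (is ?g2)
proof -
  have kh: "0 \<le> real k * h" using h by simp
  have e: "real (Suc k) * h = real k * h + h" by (simp add: algebra_simps)
  note mk = markov[OF B_qbound[OF h] kh h A, of m s' y]
  have i1: "integrable M (\<lambda>\<omega>. indicator A \<omega> * H h s (X y (real k * h) \<omega>))"
    by (rule integrable_indicator_X[OF H_qbound[OF h] kh F_sets_M[OF A]])
  have i2: "integrable M (\<lambda>\<omega>. damp h * (indicator A \<omega> * P h (B h m s') (X y (real k * h) \<omega>)))"
    using mk(2) by (rule integrable_mult_right)
  have eq: "indicator A \<omega> * (H h s (X y (real k * h) \<omega>) + damp h * P h (B h m s') (X y (real k * h) \<omega>))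
      = indicator A \<omega> * H h s (X y (real k * h) \<omega>) + damp h * (indicator A \<omega> * P h (B h m s') (X y (real k * h) \<omega>))" for \<omega>
    by (simp add: algebra_simps)
  show ?g2
    unfolding eq by (rule Bochner_Integration.integrable_add[OF i1 i2])
  show ?g1
    unfolding eq Bochner_Integration.integral_add[OF i1 i2] e mk(1) by simp
qed

lemma sum_discount_Suc:
  "(\<Sum>j<Suc m. damp (real j * h) * v (k + j)) = v k + damp h * (\<Sum>j<m. damp (real j * h) * v (Suc k + j))"
proof -
  have "damp (real (Suc j) * h) = damp h * damp (real j * h)" for j
    by (simp add: algebra_simps flip: exp_add)
  then show ?thesis unfolding sum.lessThan_Suc_shift by (simp add: sum_distrib_left mult.assoc)
qed

text \<open>Decreasing events \<open>A k\<close> of \<open>F (k h)\<close> are a discrete stopping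
  rule: on \<open>A k\<close> the gain after date \<open>k\<close> is still collected. Backward in
  the number of remaining dates, \<open>A (Suc k)\<close> may be enlarged to \<open>A k\<close>
  because \<open>B\<close> is nonnegative, the Markov property moves the next value back to date
  \<open>k\<close>, and continuing is one of the two options in the maximum.\<close>

lemma grid_gain_le:
  assumes h: "0 \<le> h" and A: "\<And>k. A k \<in> sets (F (real k * h))" and dec: "\<And>k. A (Suc k) \<subseteq> A k"
  shows "(\<Sum>j<m. damp (real j * h) * grid_gain h t y A (k + j))
    \<le> expectation (\<lambda>\<omega>. indicator (A k) \<omega> * B h m (t + real k * h) (X y (real k * h) \<omega>))"
proof (induction m arbitrary: k)
  case (Suc m)
  let ?X = "X y (real k * h)" and ?s = "t + real k * h"
  have kh: "0 \<le> real k * h" "0 \<le> real (Suc k) * h" using h by auto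
  have s: "t + real (Suc k) * h = ?s + h" by (simp add: algebra_simps)
  note A' = F_sets_M[OF A]
  have "(\<Sum>j<Suc m. damp (real j * h) * grid_gain h t y A (k + j))
      \<le> grid_gain h t y A k + damp h * expectation (\<lambda>\<omega>. indicator (A (Suc k)) \<omega> * B h m (?s + h) (X y (real (Suc k) * h) \<omega>))"
    unfolding sum_discount_Suc[where v = "\<lambda>k. grid_gain h t y A k" and k = k] using Suc.IH[of "Suc k"] unfolding s by (intro add_left_mono mult_left_mono) auto
  also have "\<dots> \<le> grid_gain h t y A k + damp h * expectation (\<lambda>\<omega>. indicator (A k) \<omega> * B h m (?s + h) (X y (real (Suc k) * h) \<omega>))"
    using dec[of k] B_nonneg
    by (intro add_left_mono mult_left_mono integral_mono integrable_indicator_X[OF B_qbound[OF h] kh(2)] A')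
      (auto simp: indicator_def)
  also have "\<dots> = expectation (\<lambda>\<omega>. indicator (A k) \<omega> * (H h ?s (?X \<omega>) + damp h * P h (B h m (?s + h)) (?X \<omega>)))"
    by (rule B_step_expectation(1)[OF h A, symmetric])
  also have "\<dots> \<le> expectation (\<lambda>\<omega>. indicator (A k) \<omega> * B h (Suc m) ?s (?X \<omega>))"
    by (intro integral_mono integrable_indicator_X[OF B_qbound[OF h] kh(1)] A' B_step_expectation(2)[OF h A] mult_left_mono) auto
  finally show ?case .
qed simp

text \<open>\<open>X\<close> is a martingale: on an event of \<open>F c\<close> its expectation at
  any later time equals that at \<open>c\<close>, so the state may be frozen at the start of the
  block and the gain becomes \<open>H\<close>. Both sides reduce to the probability \<open>p\<close>
  and the restricted mean \<open>m\<close>.\<close>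

lemma block_eq:
  assumes h: "0 \<le> h" and A: "A \<in> sets (F c)" and c: "0 \<le> c"
  shows "(LBINT s:{c..c + h}. damp s * gain A t y s)
      = damp c * expectation (\<lambda>\<omega>. indicator A \<omega> * H h (t + c) (X y c \<omega>))" (is ?g1)
    and "set_integrable lborel {c..c + h} (\<lambda>s. damp s * gain A t y s)" (is ?g2)
proof -
  note AM = F_sets_M[OF A]
  define p where "p = prob A"
  define m where "m = expectation (\<lambda>\<omega>. indicator A \<omega> * X y c \<omega>)"
  have qid: "qbound 1 (\<lambda>x. x)" using qbound_linear[of "\<lambda>x. x" 0 1] by simp
  have iA: "integrable M (\<lambda>\<omega>. indicator A \<omega> * X y c \<omega>)" by (rule integrable_indicator_X[OF qid c AM])
  have iA1: "integrable M (\<lambda>\<omega>. indicator A \<omega> :: real)" using AM by (simp add: integrable_indicator_iff emeasure_eq_measure)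
  have aff: "expectation (\<lambda>\<omega>. indicator A \<omega> * (a - d * X y c \<omega>)) = a * p - d * m" for a d
  proof -
    have "expectation (\<lambda>\<omega>. indicator A \<omega> * (a - d * X y c \<omega>)) = expectation (\<lambda>\<omega>. a * indicator A \<omega> - d * (indicator A \<omega> * X y c \<omega>))"
      by (simp add: algebra_simps)
    then show ?thesis using iA iA1 AM by (simp add: p_def m_def)
  qed
  have mk: "expectation (\<lambda>\<omega>. indicator A \<omega> * (a - X y (c + r) \<omega>)) = a * p - m" if "0 \<le> r" for a r
    using markov(1)[OF qbound_affine c that A, of a y] aff[of a 1] by simp
  let ?g = "\<lambda>r. damp c * (p * (damp r * (f (t + c + r) - 0)) - m * damp r)"
  have e: "damp (c + r) * expectation (\<lambda>\<omega>. indicator A \<omega> * (f (t + (c + r)) - X y (c + r) \<omega>)) = ?g r" if "r \<in> {0..h}" for r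
  proof -
    have "expectation (\<lambda>\<omega>. indicator A \<omega> * (f (t + (c + r)) - X y (c + r) \<omega>)) = f (t + c + r) * p - m"
      using that mk[of r "f (t + (c + r))"] by (simp add: add.assoc)
    moreover have "damp (c + r) = damp c * damp r"
      by (simp add: algebra_simps flip: exp_add)
    ultimately show ?thesis by (simp only:) (simp add: algebra_simps)
  qed
  have gi: "set_integrable lborel {0..h} ?g"
    by (intro set_integrable_mult_right set_integral_diff H_integrable disc_integrable)
  show ?g2
    unfolding set_integral_shift(2) by (subst set_integrable_cong[OF refl refl e], assumption, rule gi)
  have "(LBINT s:{c..c + h}. damp s * gain A t y s) = (LBINT r:{0..h}. ?g r)"
    unfolding set_integral_shift(1) by (rule set_lebesgue_integral_cong, simp) (intro allI impI, rule e)
  also have "\<dots> = damp c * (p * H h (t + c) 0 - m * disc h)"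
  proof -
    have "(LBINT r:{0..h}. p * (damp r * (f (t + c + r) - 0)) - m * damp r)
      = (LBINT r:{0..h}. p * (damp r * (f (t + c + r) - 0))) - (LBINT r:{0..h}. m * damp r)"
      by (intro set_integral_diff(2) set_integrable_mult_right H_integrable disc_integrable)
    then show ?thesis unfolding set_integral_mult_right H_def disc_def by (rule arg_cong)
  qed
  also have "\<dots> = damp c * expectation (\<lambda>\<omega>. indicator A \<omega> * H h (t + c) (X y c \<omega>))"
    unfolding H_affine[of h "t + c" "X y c _"] aff by (simp add: algebra_simps)
  finally show ?g1 .
qed


text \<open>\<open>A k\<close> records that the value was positive at all dates up to
  \<open>k\<close>, so the optimal rule has not yet stopped. Both inequalities of
  \<open>grid_gain_le\<close> become equalities for it: passing from \<open>A k\<close> to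
  \<open>A (Suc k)\<close> discards only paths on which the next value is 0, and positivity on
  \<open>A k\<close> means that the maximum is attained by continuing. For \<open>k \<ge> n\<close>
  the set is empty since \<open>B h 0\<close> is 0, so stopping is forced at the last date.\<close>

lemma exercise_set_B:
  fixes t y h n
  defines "A \<equiv> \<lambda>k. {\<omega> \<in> space M. \<forall>j\<le>k. 0 < B h (n - j) (t + real j * h) (X y (real j * h) \<omega>)}"
  assumes h: "0 < h"
  shows "A k \<in> sets (F (real k * h))" and "A (Suc k) \<subseteq> A k"
    and "k + m = n \<Longrightarrow> (\<Sum>j<m. damp (real j * h) * grid_gain h t y A (k + j))
      = expectation (\<lambda>\<omega>. indicator (A k) \<omega> * B h m (t + real k * h) (X y (real k * h) \<omega>))"
proof -
  show AF: "A k \<in> sets (F (real k * h))" for k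
  proof -
    have "A k = (\<Inter>j\<in>{..k}. {\<omega> \<in> space M. 0 < B h (n - j) (t + real j * h) (X y (real j * h) \<omega>)})"
      by (auto simp: A_def)
    also have "\<dots> \<in> sets (F (real k * h))"
    proof (intro sets.finite_INT)
      fix j assume "j \<in> {..k}"
      then have "real j * h \<le> real k * h" using h by (intro mult_right_mono) auto
      then have [measurable]: "X y (real j * h) \<in> borel_measurable (F (real k * h))"
        using h by (intro measurable_F_mono[OF _ X_adapted]) auto
      have [measurable]: "B h (n - j) (t + real j * h) \<in> borel_measurable borel"
        using h by (intro B_measurable) auto
      have "{\<omega> \<in> space (F (real k * h)). 0 < B h (n - j) (t + real j * h) (X y (real j * h) \<omega>)} \<in> sets (F (real k * h))"
        by measurable
      then show "{\<omega> \<in> space M. 0 < B h (n - j) (t + real j * h) (X y (real j * h) \<omega>)} \<in> sets (F (real k * h))"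
        by (simp add: space_F)
    qed auto
    finally show ?thesis .
  qed
  show "A (Suc k) \<subseteq> A k" by (auto simp: A_def)
  show "(\<Sum>j<m. damp (real j * h) * grid_gain h t y A (k + j))
      = expectation (\<lambda>\<omega>. indicator (A k) \<omega> * B h m (t + real k * h) (X y (real k * h) \<omega>))" if "k + m = n" for k m
    using that
  proof (induction m arbitrary: k)
    case (Suc m)
    let ?X = "X y (real k * h)" and ?s = "t + real k * h"
    have s: "t + real (Suc k) * h = ?s + h" by (simp add: algebra_simps)
    have n: "n - k = Suc m" "n - Suc k = m" "Suc k + m = n" using Suc.prems by auto
    have "(\<Sum>j<Suc m. damp (real j * h) * grid_gain h t y A (k + j))
        = grid_gain h t y A k + damp h * expectation (\<lambda>\<omega>. indicator (A (Suc k)) \<omega> * B h m (?s + h) (X y (real (Suc k) * h) \<omega>))"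
      unfolding sum_discount_Suc[where v = "\<lambda>k. grid_gain h t y A k" and k = k] Suc.IH[OF n(3)] s ..
    also have "(\<lambda>\<omega>. indicator (A (Suc k)) \<omega> * B h m (?s + h) (X y (real (Suc k) * h) \<omega>))
        = (\<lambda>\<omega>. indicator (A k) \<omega> * B h m (?s + h) (X y (real (Suc k) * h) \<omega>))"
    proof
      fix \<omega>
      let ?b = "B h m (?s + h) (X y (real (Suc k) * h) \<omega>)"
      have "\<omega> \<in> A (Suc k) \<longleftrightarrow> \<omega> \<in> A k \<and> 0 < ?b"
        unfolding A_def s[symmetric] using n(2) le_Suc_eq by auto
      then show "indicator (A (Suc k)) \<omega> * ?b = indicator (A k) \<omega> * ?b"
        using B_nonneg[of h m "?s + h" "X y (real (Suc k) * h) \<omega>"] by (auto simp: indicator_def)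
    qed
    also have "grid_gain h t y A k + damp h * expectation (\<lambda>\<omega>. indicator (A k) \<omega> * B h m (?s + h) (X y (real (Suc k) * h) \<omega>))
        = expectation (\<lambda>\<omega>. indicator (A k) \<omega> * (H h ?s (?X \<omega>) + damp h * P h (B h m (?s + h)) (?X \<omega>)))"
      using h by (intro B_step_expectation(1)[symmetric] AF) auto
    also have "\<dots> = expectation (\<lambda>\<omega>. indicator (A k) \<omega> * B h (Suc m) ?s (?X \<omega>))"
    proof (rule Bochner_Integration.integral_cong[OF refl])
      fix \<omega>
      have "0 < B h (Suc m) ?s (?X \<omega>)" if "\<omega> \<in> A k"
        using that n(1) by (force simp: A_def)
      then show "indicator (A k) \<omega> * (H h ?s (?X \<omega>) + damp h * P h (B h m (?s + h)) (?X \<omega>))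
          = indicator (A k) \<omega> * B h (Suc m) ?s (?X \<omega>)"
        by (cases "\<omega> \<in> A k") (auto simp: max_def split: if_splits)
    qed
    finally show ?case .
  qed simp
qed

lemma floor_grid:
  fixes s h :: real
  assumes "0 < h"
  shows "real m * h \<le> s \<longleftrightarrow> int m \<le> \<lfloor>s / h\<rfloor>"
  using assms by (simp add: le_floor_iff pos_le_divide_eq)

text \<open>As the sets decrease, the number of \<open>k < n\<close> with
  \<open>\<omega> \<in> A k\<close> is the first index outside, capped at \<open>n\<close>; counting
  thus treats paths that never leave like all others. Between two dates the event
  \<open>{s < \<tau>}\<close> is one of the \<open>A k\<close>, hence known at the earlier
  date.\<close>

lemma grid_stopping_time:
  fixes n :: nat
  assumes h: "0 < h" and A: "\<And>k. A k \<in> sets (F (real k * h))" and dec: "\<And>k. A (Suc k) \<subseteq> A k"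
  defines "\<tau> \<equiv> \<lambda>\<omega>. real (card {k. k < n \<and> \<omega> \<in> A k}) * h"
  shows "\<tau> \<in> stopping_times_upto M F (real n * h)" (is ?g1)
    and "k < n \<Longrightarrow> real k * h \<le> s \<Longrightarrow> s < real (Suc k) * h \<Longrightarrow> alive s \<tau> = A k"
proof -
  have mono: "A k \<subseteq> A j" if "j \<le> k" for j k
    using that by (rule lift_Suc_antimono_le[of A, OF dec])
  have c_le: "card {k. k < n \<and> \<omega> \<in> A k} \<le> n" for \<omega>
    using card_mono[of "{..<n}" "{k. k < n \<and> \<omega> \<in> A k}"] by auto
  have c_gt: "k < card {k. k < n \<and> \<omega> \<in> A k} \<longleftrightarrow> \<omega> \<in> A k" if "k < n" for k \<omega>
  proof
    assume "\<omega> \<in> A k"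
    then have "{..k} \<subseteq> {k. k < n \<and> \<omega> \<in> A k}" using mono that by auto
    then have "card {..k} \<le> card {k. k < n \<and> \<omega> \<in> A k}" by (intro card_mono) auto
    then show "k < card {k. k < n \<and> \<omega> \<in> A k}" by simp
  next
    assume l: "k < card {k. k < n \<and> \<omega> \<in> A k}"
    show "\<omega> \<in> A k"
    proof (rule ccontr)
      assume "\<omega> \<notin> A k"
      then have "{k. k < n \<and> \<omega> \<in> A k} \<subseteq> {..<k}" using mono by (metis (mono_tags, lifting) lessThan_iff linorder_not_le mem_Collect_eq subset_iff)
      then have "card {k. k < n \<and> \<omega> \<in> A k} \<le> card {..<k}" by (intro card_mono) auto
      then show False using l by simp
    qed
  qed
  have AM: "A k \<subseteq> space M" for k using sets.sets_into_space[OF A[of k]] by (simp add: space_F)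
  show alive: "alive s \<tau> = A k" if "k < n" "real k * h \<le> s" "s < real (Suc k) * h" for k s
  proof -
    have "s < \<tau> \<omega> \<longleftrightarrow> \<omega> \<in> A k" for \<omega>
    proof -
      have fl: "\<lfloor>s / h\<rfloor> = int k"
        using that h by (intro floor_unique) (auto simp: pos_le_divide_eq pos_divide_less_eq add.commute)
      have "s < \<tau> \<omega> \<longleftrightarrow> \<not> int (card {k. k < n \<and> \<omega> \<in> A k}) \<le> int k"
        unfolding \<tau>_def fl[symmetric] floor_grid[OF h, symmetric] by auto
      also have "\<dots> \<longleftrightarrow> \<omega> \<in> A k" using c_gt[OF that(1), of \<omega>] by (simp add: not_le)
      finally show ?thesis .
    qed
    then show ?thesis using AM by auto
  qed
  show ?g1
    unfolding stopping_times_upto_def stopping_time_def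
  proof (safe)
    fix s
    have "{\<omega> \<in> space M. \<tau> \<omega> \<le> s} \<in> sets (F s)"
    proof (cases "0 \<le> s \<and> s < real n * h")
      case True
      define k where "k = nat \<lfloor>s / h\<rfloor>"
      have "0 \<le> s / h" using True h by simp
      then have k0: "int k = \<lfloor>s / h\<rfloor>" by (simp add: k_def)
      have "real k * h \<le> s" "\<not> real (Suc k) * h \<le> s" unfolding floor_grid[OF h] k0[symmetric] by auto
      then have k: "real k * h \<le> s" "s < real (Suc k) * h" by auto
      have "real k * h < real n * h" using k True by linarith
      then have "k < n" using h by simp
      have "{\<omega> \<in> space M. \<tau> \<omega> \<le> s} = space (F s) - alive s \<tau>" by (auto simp: space_F)
      moreover have "alive s \<tau> \<in> sets (F s)"
        unfolding alive[OF \<open>k < n\<close> k] using A[of k] sets_F_mono[OF k(1)] by auto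
      ultimately show ?thesis by auto
    next
      case False
      have "{\<omega> \<in> space M. \<tau> \<omega> \<le> s} = (if 0 \<le> s then space (F s) else {})"
      proof (cases "0 \<le> s")
        case True
        have "\<tau> \<omega> \<le> s" for \<omega>
        proof -
          have "\<tau> \<omega> \<le> real n * h" unfolding \<tau>_def using c_le[of \<omega>] h by (intro mult_right_mono) auto
          then show ?thesis using False True by linarith
        qed
        then show ?thesis using True by (simp add: space_F)
      next
        case False
        have "0 \<le> \<tau> \<omega>" for \<omega> unfolding \<tau>_def using h by simp
        then have "\<not> \<tau> \<omega> \<le> s" for \<omega> using False by (meson order_trans)
        then show ?thesis using False by simp
      qed
      then show ?thesis by auto
    qed
    then show "Measurable.pred (F s) (\<lambda>x. \<tau> x \<le> s)" by (simp add: Measurable.pred_def space_F)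
  next
    fix \<omega>
    show "\<tau> \<omega> \<in> {0..real n * h}" unfolding \<tau>_def using c_le[of \<omega>] h by (auto intro: mult_right_mono)
  qed
qed

text \<open>The optimal Bermudan rule is an ordinary admissible stopping time, and its gain is
  exactly \<open>B h n t y\<close>.\<close>

lemma B_le_u:
  assumes h: "0 < h" and t: "0 \<le> t" "t + real n * h = T"
  shows "B h n t y \<le> u t y"
proof -
  define A where "A k = {\<omega> \<in> space M. \<forall>j\<le>k. 0 < B h (n - j) (t + real j * h) (X y (real j * h) \<omega>)}" for k
  define \<tau> where "\<tau> = (\<lambda>\<omega>. real (card {k. k < n \<and> \<omega> \<in> A k}) * h)"
  note A = exercise_set_B[OF h, where n = n and t = t and y = y, folded A_def]
  have nh: "T - t = real n * h" using t by simp
  have \<tau>T: "\<tau> \<in> stopping_times_upto M F (T - t)"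
    unfolding nh \<tau>_def by (rule grid_stopping_time(1)[OF h A(1,2)])
  have alive: "alive s \<tau> = A k" if "k < n" "real k * h \<le> s" "s < real (Suc k) * h" for k s
    unfolding \<tau>_def by (rule grid_stopping_time(2)[OF h A(1,2) that])
  let ?\<phi> = "\<lambda>s. damp s * gain (alive s \<tau>) t y s"
  have e: "real (Suc k) * h = real k * h + h" for k by (simp add: algebra_simps)
  have block: "(LBINT s:{real k * h..real (Suc k) * h}. ?\<phi> s) = damp (real k * h) * grid_gain h t y A k" if "k < n" for k
  proof -
    have kh: "0 \<le> real k * h" using h by simp
    note bl = block_eq[OF order.strict_implies_order[OF h] A(1) kh, of t y, folded e]
    have le: "real k * h \<le> real (Suc k) * h" "real (Suc k) * h \<le> real n * h" using h that by (auto intro!: mult_right_mono)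
    have "(LBINT s:{real k * h..real (Suc k) * h}. ?\<phi> s)
      = (LBINT s:{real k * h..real (Suc k) * h}. damp s * gain (A k) t y s)"
      unfolding set_lebesgue_integral_def
    proof (rule integral_cong_AE)
      have "set_integrable lborel {real k * h..real (Suc k) * h} ?\<phi>"
        using le kh unfolding nh[symmetric] by (intro set_integrable_subset[OF J_integrable[OF \<tau>T]]) auto
      then show "(\<lambda>s. indicator {real k * h..real (Suc k) * h} s *\<^sub>R ?\<phi> s) \<in> borel_measurable lborel"
        unfolding set_integrable_def by (rule borel_measurable_integrable)
      show "(\<lambda>s. indicator {real k * h..real (Suc k) * h} s *\<^sub>R (damp s * gain (A k) t y s)) \<in> borel_measurable lborel"
        using bl(2) unfolding set_integrable_def by (rule borel_measurable_integrable)
      \<comment> \<open>At the right end of the block the rule may already have stopped; this single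
        instant carries no Lebesgue mass.\<close>
      show "AE s in lborel. indicator {real k * h..real (Suc k) * h} s *\<^sub>R ?\<phi> s
          = indicator {real k * h..real (Suc k) * h} s *\<^sub>R (damp s * gain (A k) t y s)"
        using AE_lborel_singleton[of "real (Suc k) * h"]
      proof eventually_elim
        case (elim s)
        show ?case
        proof (cases "s \<in> {real k * h..real (Suc k) * h}")
          case True
          then have "real k * h \<le> s" "s < real (Suc k) * h" using elim by auto
          from alive[OF that this] show ?thesis by (simp only:)
        qed simp
      qed
    qed
    also have "\<dots> = damp (real k * h) * grid_gain h t y A k" by (rule bl(1))
    finally show ?thesis .
  qed
  have "J t y \<tau> = (\<Sum>k<n. LBINT s:{real k * h..real (Suc k) * h}. ?\<phi> s)"
    unfolding J_def nh using J_integrable[OF \<tau>T, of y] h unfolding nh by (intro set_integral_grid) auto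
  also have "\<dots> = (\<Sum>k<n. damp (real k * h) * grid_gain h t y A (0 + k))"
    by (intro sum.cong refl) (simp only: block lessThan_iff add_0)
  also have "\<dots> = expectation (\<lambda>\<omega>. indicator (A 0) \<omega> * B h n (t + real 0 * h) (X y (real 0 * h) \<omega>))"
    by (rule A(3)) simp
  also have "\<dots> = expectation (\<lambda>\<omega>. B h n t (X y 0 \<omega>))"
    using B_nonneg[of h n t] by (intro Bochner_Integration.integral_cong) (auto simp: A_def indicator_def not_less intro: antisym)
  also have "\<dots> = B h n t y"
    using expectation_X[OF B_qbound[of h n t], of 0 y] h by simp
  finally have "J t y \<tau> = B h n t y" .
  moreover have "0 \<le> real n * h" using h by simp
  then have "t \<le> T" using nh by linarith
  ultimately show ?thesis using u_upper[OF \<tau>T t(1), of y] by simp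
qed

text \<open>The cost of delaying a stopping time to the next grid point.\<close>

definition err :: "real \<Rightarrow> real \<Rightarrow> real" where
  "err h y = (fb + \<bar>y\<bar>) * h + \<sigma> * sqrt h * (1 + T\<^sup>2) / 2"

text \<open>Delaying \<open>\<tau>\<close> to the grid replaces \<open>{s < \<tau>}\<close> in block
  \<open>k\<close> by \<open>A k\<close>. The additional part lies in the difference of
  \<open>A k\<close> and \<open>A (Suc k)\<close>, and the probabilities of these differences
  telescope to at most 1. Since \<open>X\<close> is unbounded and not independent of these events,
  its size is split by Young's inequality with weight \<open>sqrt h\<close>, and the total cost is
  of order \<open>sqrt h\<close>.\<close>

lemma J_le_B:
  assumes h: "0 < h" and t: "0 \<le> t" "t + real n * h = T" and \<tau>: "\<tau> \<in> stopping_times_upto M F (T - t)"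
  shows "J t y \<tau> \<le> B h n t y + err h y"
proof -
  have nh: "T - t = real n * h" using t by simp
  define A where "A k = alive (real k * h) \<tau>" for k
  have AF: "A k \<in> sets (F (real k * h))" for k unfolding A_def by (rule alive_sets[OF \<tau>])
  have dec: "A (Suc k) \<subseteq> A k" for k
  proof -
    have "real k * h \<le> real (Suc k) * h" using h by (intro mult_right_mono) auto
    then show ?thesis unfolding A_def by auto
  qed
  \<comment> \<open>In \<open>\<bar>w\<bar> \<le> sqrt h / 2 * w\<^sup>2 + 1 / (2 * sqrt h)\<close>
    the constant part multiplies the telescoping probabilities and enters \<open>c1\<close>; the
    quadratic part has expectation at most \<open>sqrt h / 2 * T\<close> for \<open>w = W s\<close>
    and enters \<open>c2\<close>. After multiplication by the block length \<open>h\<close> and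
    summation both are of order \<open>sqrt h\<close>.\<close>
  define c1 where "c1 = fb + \<bar>y\<bar> + \<sigma> / (2 * sqrt h)"
  define c2 where "c2 = \<sigma> * sqrt h / 2 * T"
  have c1: "0 \<le> c1" using fb_nonneg \<sigma>_pos h by (simp add: c1_def)
  let ?\<phi> = "\<lambda>s. damp s * gain (alive s \<tau>) t y s"
  have e: "real (Suc k) * h = real k * h + h" for k by (simp add: algebra_simps)
  have block: "(LBINT s:{real k * h..real (Suc k) * h}. ?\<phi> s)
      \<le> damp (real k * h) * grid_gain h t y A k + h * (c1 * (prob (A k) - prob (A (Suc k))) + c2)" if "k < n" for k
  proof -
    have kh: "0 \<le> real k * h" using h by simp
    have le: "real k * h \<le> real (Suc k) * h" "real (Suc k) * h \<le> real n * h" using h that by (auto intro!: mult_right_mono)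
    note bl = block_eq[OF order.strict_implies_order[OF h] AF kh, of t y, folded e]
    let ?d = "c1 * (prob (A k) - prob (A (Suc k))) + c2"
    let ?\<psi> = "\<lambda>s. damp s * gain (A k) t y s"
    have "(LBINT s:{real k * h..real (Suc k) * h}. ?\<phi> s) \<le> (LBINT s:{real k * h..real (Suc k) * h}. ?\<psi> s + ?d)"
    proof (rule set_integral_mono)
      show "set_integrable lborel {real k * h..real (Suc k) * h} ?\<phi>"
        using le kh unfolding nh[symmetric] by (intro set_integrable_subset[OF J_integrable[OF \<tau>]]) auto
      show "set_integrable lborel {real k * h..real (Suc k) * h} (\<lambda>s. ?\<psi> s + ?d)"
        by (intro set_integral_add bl(2) set_integrable_const_Icc)
      fix s assume s: "s \<in> {real k * h..real (Suc k) * h}"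
      then have s0: "0 \<le> s" "s \<le> T" using kh le t by auto
      have sub: "A (Suc k) \<subseteq> alive s \<tau>" "alive s \<tau> \<subseteq> A k" using s by (auto simp: A_def)
      note AM = alive_sets(1)[OF \<tau>, of s] F_sets_M[OF AF[of k]] F_sets_M[OF AF[of "Suc k"]]
      have i1: "integrable M (\<lambda>\<omega>. indicator (alive s \<tau>) \<omega> * (f (t + s) - X y s \<omega>))"
        "integrable M (\<lambda>\<omega>. indicator (A k) \<omega> * (f (t + s) - X y s \<omega>))"
        by (intro expectation_X_affine AM s0)+
      have i2: "integrable M (\<lambda>\<omega>. c1 * (indicator (A k) \<omega> - indicator (A (Suc k)) \<omega>) + \<sigma> * sqrt h / 2 * (W s \<omega>)\<^sup>2)"
        using AM integrable_W_square[OF s0(1)] by (intro Bochner_Integration.integrable_add integrable_mult_right Bochner_Integration.integrable_diff integrable_real_indicator) (auto simp: emeasure_eq_measure)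
      have "gain (alive s \<tau>) t y s
        \<le> expectation (\<lambda>\<omega>. indicator (A k) \<omega> * (f (t + s) - X y s \<omega>) + (c1 * (indicator (A k) \<omega> - indicator (A (Suc k)) \<omega>) + \<sigma> * sqrt h / 2 * (W s \<omega>)\<^sup>2))"
      proof (rule integral_mono[OF i1(1) Bochner_Integration.integrable_add[OF i1(2) i2]])
        fix \<omega>
        have "\<sigma> * \<bar>W s \<omega>\<bar> \<le> \<sigma> * (sqrt h / 2 * (W s \<omega>)\<^sup>2 + 1 / (2 * sqrt h))"
        proof (rule mult_left_mono)
          have "0 \<le> (sqrt h * \<bar>W s \<omega>\<bar> - 1)\<^sup>2" by simp
          also have "\<dots> = h * (W s \<omega>)\<^sup>2 + 1 - 2 * (sqrt h * \<bar>W s \<omega>\<bar>)"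
            using h by (simp add: power2_diff power_mult_distrib)
          finally have "sqrt h * \<bar>W s \<omega>\<bar> \<le> h / 2 * (W s \<omega>)\<^sup>2 + 1 / 2" by simp
          also have "\<dots> = sqrt h * (sqrt h / 2 * (W s \<omega>)\<^sup>2 + 1 / (2 * sqrt h))"
            using h by (simp add: field_simps)
          finally show "\<bar>W s \<omega>\<bar> \<le> sqrt h / 2 * (W s \<omega>)\<^sup>2 + 1 / (2 * sqrt h)" using h by simp
        qed (use \<sigma>_pos in simp)
        then have ab: "\<sigma> * \<bar>W s \<omega>\<bar> \<le> \<sigma> * sqrt h / 2 * (W s \<omega>)\<^sup>2 + \<sigma> / (2 * sqrt h)"
          by (simp add: algebra_simps)
        have "\<bar>f (t + s) - X y s \<omega>\<bar> \<le> fb + \<bar>y\<bar> + \<bar>\<sigma> * W s \<omega>\<bar>"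
          using f_bound[of "t + s"] by (simp add: X_proc_def)
        also have "\<bar>\<sigma> * W s \<omega>\<bar> = \<sigma> * \<bar>W s \<omega>\<bar>" using \<sigma>_pos by (simp add: abs_mult)
        finally have abs: "- (f (t + s) - X y s \<omega>) \<le> c1 + \<sigma> * sqrt h / 2 * (W s \<omega>)\<^sup>2"
          using ab by (simp add: c1_def)
        have W0: "0 \<le> \<sigma> * sqrt h / 2 * (W s \<omega>)\<^sup>2" using \<sigma>_pos h by simp
        show "indicator (alive s \<tau>) \<omega> * (f (t + s) - X y s \<omega>) \<le>
          indicator (A k) \<omega> * (f (t + s) - X y s \<omega>) + (c1 * (indicator (A k) \<omega> - indicator (A (Suc k)) \<omega>) + \<sigma> * sqrt h / 2 * (W s \<omega>)\<^sup>2)"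
        proof (cases "\<omega> \<in> alive s \<tau>")
          case True
          then have "\<omega> \<in> A k" using sub by auto
          moreover have "0 \<le> c1 * (1 - indicator (A (Suc k)) \<omega>)" using c1 by (simp add: indicator_def)
          ultimately show ?thesis using True W0 by (simp only: indicator_simps if_True mult_1)
        next
          case False
          then have "\<omega> \<notin> A (Suc k)" using sub by auto
          then have z: "indicator (alive s \<tau>) \<omega> = (0::real)" "indicator (A (Suc k)) \<omega> = (0::real)"
            using False by auto
          show ?thesis
          proof (cases "\<omega> \<in> A k")
            case True
            then have "indicator (A k) \<omega> = (1::real)" by simp
            then show ?thesis unfolding z mult_zero_left diff_0_right using abs by simp
          next
            case False
            then have "indicator (A k) \<omega> = (0::real)" by simp
            then show ?thesis unfolding z mult_zero_left diff_0_right using W0 by simp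
          qed
        qed
      qed
      also have "\<dots> = gain (A k) t y s + (c1 * (prob (A k) - prob (A (Suc k))) + \<sigma> * sqrt h / 2 * s)"
      proof -
        have "expectation (\<lambda>\<omega>. c1 * (indicator (A k) \<omega> - indicator (A (Suc k)) \<omega>) + \<sigma> * sqrt h / 2 * (W s \<omega>)\<^sup>2)
            = c1 * (prob (A k) - prob (A (Suc k))) + \<sigma> * sqrt h / 2 * s"
          using AM integrable_W_square[OF s0(1)] by (simp add: emeasure_eq_measure)
        then show ?thesis using Bochner_Integration.integral_add[OF i1(2) i2] by simp
      qed
      also have "\<dots> \<le> gain (A k) t y s + ?d"
        unfolding c2_def using s0 \<sigma>_pos h by (intro add_left_mono mult_left_mono) auto
      finally have "?\<phi> s \<le> damp s * (gain (A k) t y s + ?d)"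
        by (rule mult_left_mono) simp
      also have "\<dots> \<le> ?\<psi> s + 1 * ?d"
      proof (subst distrib_left, intro add_mono order_refl mult_right_mono exp_le_1 s0)
        have "prob (A (Suc k)) \<le> prob (A k)" using dec AM by (intro finite_measure_mono) auto
        then show "0 \<le> ?d" using c1 \<sigma>_pos h T_pos by (simp add: c2_def)
      qed
      finally show "?\<phi> s \<le> ?\<psi> s + ?d" by simp
    qed
    also have "\<dots> = (LBINT s:{real k * h..real (Suc k) * h}. ?\<psi> s) + (LBINT s:{real k * h..real (Suc k) * h}. ?d)"
      by (rule set_integral_add(2)[OF bl(2) set_integrable_const_Icc])
    also have "(LBINT s:{real k * h..real (Suc k) * h}. ?d) = h * ?d"
      using le(1) by (subst set_integral_const_Icc) (auto simp: algebra_simps)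
    also have "(LBINT s:{real k * h..real (Suc k) * h}. ?\<psi> s) = damp (real k * h) * grid_gain h t y A k" by (rule bl(1))
    finally show ?thesis .
  qed
  have "J t y \<tau> = (\<Sum>k<n. LBINT s:{real k * h..real (Suc k) * h}. ?\<phi> s)"
    unfolding J_def nh using J_integrable[OF \<tau>, of y] h unfolding nh by (intro set_integral_grid) auto
  also have "\<dots> \<le> (\<Sum>k<n. damp (real k * h) * grid_gain h t y A k + h * (c1 * (prob (A k) - prob (A (Suc k))) + c2))"
    by (intro sum_mono block) auto
  also have "\<dots> = (\<Sum>k<n. damp (real k * h) * grid_gain h t y A (0 + k)) + h * (c1 * (\<Sum>k<n. prob (A k) - prob (A (Suc k))) + real n * c2)"
    by (simp add: sum.distrib sum_distrib_left distrib_left)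
  also have "(\<Sum>k<n. prob (A k) - prob (A (Suc k))) = prob (A 0) - prob (A n)" by (rule sum_lessThan_telescope')
  finally have main: "J t y \<tau> \<le> (\<Sum>k<n. damp (real k * h) * grid_gain h t y A (0 + k)) + h * (c1 * (prob (A 0) - prob (A n)) + real n * c2)" .
  have "(\<Sum>k<n. damp (real k * h) * grid_gain h t y A (0 + k)) \<le> expectation (\<lambda>\<omega>. indicator (A 0) \<omega> * B h n (t + real 0 * h) (X y (real 0 * h) \<omega>))"
    using h by (intro grid_gain_le AF dec) auto
  also have "\<dots> \<le> expectation (\<lambda>\<omega>. B h n t (X y 0 \<omega>))"
    using h B_nonneg[of h n t] F_sets_M[OF AF[of 0]]
    by (simp only: of_nat_0 mult_zero_left add_0_right)
      (intro integral_mono integrable_indicator_X[OF B_qbound] qbound_integrable_X[OF B_qbound], auto simp: indicator_def)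
  also have "\<dots> = B h n t y"
    using expectation_X[OF B_qbound[of h n t], of 0 y] h by simp
  finally have S: "(\<Sum>k<n. damp (real k * h) * grid_gain h t y A (0 + k)) \<le> B h n t y" .
  have "h * (c1 * (prob (A 0) - prob (A n)) + real n * c2) \<le> h * (c1 * 1 + real n * c2)"
  proof -
    have "prob (A 0) - prob (A n) \<le> 1" using prob_le_1[of "A 0"] measure_nonneg[of M "A n"] by linarith
    then show ?thesis using h c1 by (intro mult_left_mono add_right_mono) auto
  qed
  also have "h * (c1 * 1 + real n * c2) \<le> err h y"
  proof -
    have "h / sqrt h = sqrt h" using h by (simp add: real_div_sqrt)
    then have "h * c1 = (fb + \<bar>y\<bar>) * h + \<sigma> * sqrt h / 2"
      unfolding c1_def by (simp add: distrib_left mult.commute) (metis times_divide_eq_right)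
    moreover have "h * (real n * c2) = (T - t) * c2" unfolding nh by simp
    moreover have "(T - t) * c2 \<le> T * c2" using t h \<sigma>_pos T_pos by (intro mult_right_mono) (auto simp: c2_def)
    moreover have "T * c2 = \<sigma> * sqrt h * T\<^sup>2 / 2" by (simp add: c2_def power2_eq_square)
    moreover have "err h y = ((fb + \<bar>y\<bar>) * h + \<sigma> * sqrt h / 2) + \<sigma> * sqrt h * T\<^sup>2 / 2"
      by (simp add: err_def distrib_left add_divide_distrib)
    moreover have "h * (c1 * 1 + real n * c2) = h * c1 + h * (real n * c2)" by (simp add: distrib_left)
    ultimately show ?thesis by linarith
  qed
  finally show ?thesis using main S by linarith
qed

lemma u_le_B:
  assumes h: "0 < h" and t: "0 \<le> t" "t + real n * h = T"
  shows "u t y \<le> B h n t y + err h y"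
proof (rule u_least)
  have "0 \<le> real n * h" using h by simp
  then show "t \<le> T" using t by linarith
qed (rule J_le_B[OF assms])


section \<open>The free boundary and the early exercise premium\<close>

text \<open>Outside \<open>[0,T]\<close> the boundary is extended by constants.\<close>

definition b :: "real \<Rightarrow> real" where
  "b t = (if max 0 t < T then Inf {y. u (max 0 t) y \<le> 0} else f T)"

lemma err_tendsto:
  assumes "h \<longlonglongrightarrow> 0" "y \<longlonglongrightarrow> a"
  shows "(\<lambda>n. err (h n) (y n)) \<longlonglongrightarrow> 0"
proof -
  have "(\<lambda>n. (fb + \<bar>y n\<bar>) * h n + \<sigma> * sqrt (h n) * (1 + T\<^sup>2) / 2) \<longlonglongrightarrow> (fb + \<bar>a\<bar>) * 0 + \<sigma> * sqrt 0 * (1 + T\<^sup>2) / 2"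
    by (intro tendsto_intros assms) auto
  then show ?thesis by (simp add: err_def)
qed

definition mesh :: "real \<Rightarrow> nat \<Rightarrow> real" where
  "mesh t N = (T - t) / real (Suc N)"

lemma mesh:
  assumes "t < T"
  shows "0 < mesh t N" "t + real (Suc N) * mesh t N = T" "mesh t \<longlonglongrightarrow> 0"
proof -
  show "0 < mesh t N" "t + real (Suc N) * mesh t N = T" using assms by (simp_all add: mesh_def)
  have "(\<lambda>N. (T - t) * (1 / real (Suc N))) \<longlonglongrightarrow> (T - t) * 0"
    by (intro tendsto_intros LIMSEQ_Suc[OF lim_1_over_n])
  then show "mesh t \<longlonglongrightarrow> 0" by (simp add: mesh_def[abs_def])
qed

lemma u_le_sq:
  assumes "0 \<le> t" "t \<le> T"
  shows "u t y \<le> (y - x0)\<^sup>2"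
proof (cases "t = T")
  case False
  then have t: "t < T" using assms by simp
  have "u t y \<le> (y - x0)\<^sup>2 + err (mesh t N) y" for N
    using u_le_B[OF mesh(1)[OF t] assms(1) mesh(2)[OF t], of y N] B_le_sq[of "mesh t N" "Suc N" t y] mesh(1)[OF t, of N]
    by linarith
  moreover have "(\<lambda>N. (y - x0)\<^sup>2 + err (mesh t N) y) \<longlonglongrightarrow> (y - x0)\<^sup>2 + 0"
    by (intro tendsto_intros err_tendsto[OF mesh(3)[OF t] tendsto_const])
  ultimately show ?thesis by (intro LIMSEQ_le_const) auto
qed simp

lemma u_x0: "0 \<le> t \<Longrightarrow> t \<le> T \<Longrightarrow> u t x0 = 0"
  using u_le_sq[of t x0] u_nonneg[of t x0] by simp

lemma u_linear:
  assumes "0 \<le> t" "t \<le> T"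
  shows "u t y \<le> T * (\<bar>y\<bar> + \<bar>x0\<bar>)"
proof -
  have "u t y \<le> (T - t) * \<bar>y - x0\<bar>" using u_lipschitz[OF assms, of y x0] u_x0[OF assms] by simp
  also have "\<dots> \<le> T * (\<bar>y\<bar> + \<bar>x0\<bar>)" using assms by (intro mult_mono) auto
  finally show ?thesis .
qed

text \<open>By continuity \<open>f\<close> stays above \<open>y\<close> for one short step, so
  collecting over this step alone has the positive value \<open>H\<close>; a Bermudan value is at
  least that and at most \<open>u\<close>.\<close>

lemma u_pos_below_f:
  assumes t: "0 \<le> t" "t < T" and y: "y < f t"
  shows "0 < u t y"
proof -
  define e where "e = (f t - y) / 2"
  have e: "0 < e" using y by (simp add: e_def)
  have "isCont f t" using f_cont by (simp add: continuous_on_eq_continuous_at)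
  then obtain d where d: "0 < d" "\<And>s. \<bar>s - t\<bar> < d \<Longrightarrow> \<bar>f s - f t\<bar> < e"
    unfolding continuous_at_eps_delta dist_real_def using e by meson
  from mesh(3)[OF t(2)] obtain N where N: "\<bar>mesh t N\<bar> < d"
    unfolding LIMSEQ_iff using d(1) by fastforce
  let ?h = "mesh t N"
  have h: "0 < ?h" by (rule mesh(1)[OF t(2)])
  have "e * disc ?h \<le> H ?h t y"
  proof -
    have "(LBINT r:{0..?h}. damp r * e) \<le> H ?h t y"
      unfolding H_def
    proof (rule set_integral_mono[OF _ H_integrable])
      show "set_integrable lborel {0..?h} (\<lambda>r. damp r * e)" by (intro set_integrable_mult_left disc_integrable)
      fix r assume "r \<in> {0..?h}"
      then have "\<bar>f (t + r) - f t\<bar> < e" using N by (intro d) auto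
      then have "e \<le> f (t + r) - y" unfolding e_def abs_less_iff by (simp add: field_simps)
      then show "damp r * e \<le> damp r * (f (t + r) - y)" by (intro mult_left_mono) auto
    qed
    then show ?thesis by (simp add: disc_def mult.commute)
  qed
  moreover have "0 < e * disc ?h"
  proof -
    have "0 < damp ?h * ?h" using h by simp
    also have "\<dots> \<le> disc ?h" using h by (intro disc_bounds) auto
    finally show ?thesis using e by simp
  qed
  moreover have "H ?h t y \<le> B ?h (Suc N) t y"
  proof -
    have "0 \<le> damp ?h * P ?h (B ?h N (t + ?h)) y" by (intro mult_nonneg_nonneg heat_nonneg B_nonneg) simp
    then show ?thesis unfolding B.simps by linarith
  qed
  moreover have "B ?h (Suc N) t y \<le> u t y" by (rule B_le_u[OF h t(1) mesh(2)[OF t(2)]])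
  ultimately show ?thesis by linarith
qed

text \<open>The infimum defining \<open>b\<close> is a minimum: the set contains the barrier point,
  lies above \<open>f t\<close> by positivity of \<open>u\<close> below \<open>f\<close>, and is
  closed by the Lipschitz bound.\<close>

lemma stop_set:
  assumes t: "0 \<le> t" "t < T"
  shows "x0 \<in> {y. u t y \<le> 0}" "bdd_below {y. u t y \<le> 0}" "closed {y. u t y \<le> 0}"
proof -
  show "x0 \<in> {y. u t y \<le> 0}" using u_x0 t by simp
  show "bdd_below {y. u t y \<le> 0}"
    using u_pos_below_f[OF t] by (intro bdd_belowI[of _ "f t"]) (auto simp: not_less[symmetric])
  have "continuous_on UNIV (u t)"
    using qbound_lipschitz(3)[of "u t" "T - t"] u_lipschitz[of t] t by simp
  then show "closed {y. u t y \<le> 0}" by (intro closed_Collect_le) auto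
qed

lemma b_eq_Inf: "0 \<le> t \<Longrightarrow> t < T \<Longrightarrow> b t = Inf {y. u t y \<le> 0}"
  by (simp add: b_def max_def)

lemma b_T: "b T = f T"
  using T_pos by (simp add: b_def)

lemma u_pos_iff:
  assumes t: "0 \<le> t" "t < T"
  shows "0 < u t y \<longleftrightarrow> y < b t"
proof
  assume "y < b t"
  then show "0 < u t y"
    unfolding b_eq_Inf[OF t] using cInf_lower[OF _ stop_set(2)[OF t], of y] by (auto simp: not_less[symmetric])
next
  assume "0 < u t y"
  have "b t \<in> {y. u t y \<le> 0}"
    unfolding b_eq_Inf[OF t] using stop_set[OF t] by (intro closed_contains_Inf) auto
  then show "y < b t"
    using u_antimono_space[of t "b t" y] t \<open>0 < u t y\<close> by (auto simp: not_less[symmetric])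
qed

lemma u_zero_above:
  assumes "0 \<le> t" "t \<le> T" "b t \<le> y"
  shows "u t y = 0"
proof (cases "t = T")
  case False
  then show ?thesis using u_pos_iff[of t y] u_nonneg[of t y] assms by auto
qed simp

lemma f_le_b:
  assumes "0 \<le> t" "t \<le> T"
  shows "f t \<le> b t"
proof (cases "t = T")
  case False
  then have t: "t < T" using assms by simp
  show ?thesis
  proof (rule ccontr)
    assume "\<not> f t \<le> b t"
    then have "0 < u t (b t)" using assms(1) t by (intro u_pos_below_f) auto
    then show False using u_pos_iff[OF assms(1) t] by simp
  qed
qed (simp add: b_T)

lemma b_antimono: "s \<le> t \<Longrightarrow> b t \<le> b s"
proof -
  have *: "b t \<le> b s" if "0 \<le> s" "s \<le> t" for s t
  proof (cases "t < T")
    case True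
    then show ?thesis
      unfolding b_eq_Inf[OF that(1) le_less_trans[OF that(2) True]] b_eq_Inf[OF order_trans[OF that] True]
      using that u_antimono_time[OF that] stop_set[of s] stop_set[of t]
      by (intro cInf_superset_mono) (force intro: order_trans)+
  next
    case False
    then have "b t = b T" using that T_pos by (simp add: b_def max_def)
    show ?thesis
    proof (cases "s < T")
      case True
      then show ?thesis using f_le_b[OF that(1)] f_antimono[of s T] \<open>b t = b T\<close> b_T by simp
    next
      case False
      then have "b s = b T" using that T_pos by (simp add: b_def max_def)
      then show ?thesis using \<open>b t = b T\<close> by simp
    qed
  qed
  have "b s = b (max 0 s)" for s by (simp add: b_def)
  then show "s \<le> t \<Longrightarrow> b t \<le> b s" using *[of "max 0 s" "max 0 t"] by (metis max.cobounded1 max.mono order_refl)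
qed

lemma b_neg_mono: "mono (\<lambda>t. - b t)"
  by (rule monoI) (use b_antimono in simp)

lemma b_measurable [measurable]: "b \<in> borel_measurable borel"
  using borel_measurable_uminus[OF borel_measurable_mono[OF b_neg_mono]] by simp

lemma b_AE_cont: "AE s in lborel. isCont b (t + s)"
proof -
  have "countable ((\<lambda>x. x - t) ` {s. \<not> isCont (\<lambda>t. - b t) s})"
    by (intro countable_image mono_ctble_discont[OF b_neg_mono])
  moreover have "{s. \<not> isCont b (t + s)} \<subseteq> (\<lambda>x. x - t) ` {s. \<not> isCont (\<lambda>t. - b t) s}"
  proof safe
    fix s assume "\<not> isCont b (t + s)"
    then have "t + s \<in> {s. \<not> isCont (\<lambda>t. - b t) s}" using isCont_minus[of _ "\<lambda>t. - b t"] by auto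
    then show "s \<in> (\<lambda>x. x - t) ` {s. \<not> isCont (\<lambda>t. - b t) s}" by (intro image_eqI[of _ _ "t + s"]) auto
  qed
  ultimately have "countable {s. \<not> isCont b (t + s)}" by (rule countable_subset[rotated])
  then have "{s. \<not> isCont b (t + s)} \<in> null_sets lborel" by (rule countable_imp_null_set_lborel)
  then have "AE s in lborel. s \<notin> {s. \<not> isCont b (t + s)}" by (rule AE_not_in)
  then show ?thesis by simp
qed

section \<open>Passage to the limit in the telescoped recursion\<close>

definition q :: "(real \<Rightarrow> real) \<Rightarrow> real \<Rightarrow> real \<Rightarrow> real" where
  "q c t x = (if x \<le> c t then f t - x else 0)"

text \<open>The right side of the premium formula for an arbitrary boundary \<open>c\<close>: it
  will be \<open>u\<close> for \<open>c = b\<close>, and for a competing solution it is the function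
  \<open>w\<close> of the overview.\<close>

definition G :: "(real \<Rightarrow> real) \<Rightarrow> real \<Rightarrow> real \<Rightarrow> real" where
  "G c t y = (LBINT s:{0..T - t}. damp s * P s (q c (t + s)) y)"

lemma q_measurable [measurable]:
  assumes [measurable]: "c \<in> borel_measurable borel" "g \<in> borel_measurable N" "k \<in> borel_measurable N"
  shows "(\<lambda>w. q c (g w) (k w)) \<in> borel_measurable N"
  unfolding q_def by measurable

lemma q_bound: "\<bar>q c t x\<bar> \<le> fb + \<bar>x\<bar>"
  using f_bound[of t] fb_nonneg by (auto simp: q_def)

text \<open>The one-step decrease of the Bermudan value: it is \<open>H\<close> where waiting is optimal and \<open>O(h\<^sup>2)\<close> above \<open>b\<close>.\<close>

definition incr :: "real \<Rightarrow> real \<Rightarrow> nat \<Rightarrow> nat \<Rightarrow> real \<Rightarrow> real" where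
  "incr h t n k x = B h (n - k) (t + real k * h) x - damp h * P h (B h (n - Suc k) (t + real (Suc k) * h)) x"

text \<open>With the continuation value \<open>p \<ge> 0\<close> one has
  \<open>max 0 (H + p) - p = max (- p) H\<close>, whose modulus is at most that of \<open>H\<close>.
  The resulting bound of order \<open>h\<close>, uniform over all dates, dominates the increments
  divided by \<open>h\<close> in \<open>u_eq_G\<close>.\<close>

lemma incr_bound:
  assumes h: "0 \<le> h"
  shows "\<bar>incr h t n k x\<bar> \<le> h * (fb + \<bar>x\<bar>)"
proof (cases "k < n")
  case True
  let ?s = "t + real k * h"
  have n: "n - k = Suc (n - Suc k)" using True by simp
  have s: "t + real (Suc k) * h = ?s + h" by (simp add: algebra_simps)
  have "0 \<le> damp h * P h (B h (n - Suc k) (?s + h)) x" by (intro mult_nonneg_nonneg heat_nonneg B_nonneg) simp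
  then have "\<bar>incr h t n k x\<bar> \<le> \<bar>H h ?s x\<bar>" unfolding incr_def n s B.simps by linarith
  then show ?thesis using H_bound[OF h, of ?s x] by linarith
next
  case False
  \<comment> \<open>Truncated subtraction: from the last date on, both terms of the increment come
    from \<open>B h 0\<close>.\<close>
  then have n: "n - k = 0" "n - Suc k = 0" by auto
  have "B h 0 s = (\<lambda>x. 0)" for s by (rule ext) simp
  then have "incr h t n k x = 0" unfolding incr_def n by simp
  then show ?thesis using h fb_nonneg by simp
qed

lemma incr_measurable:
  assumes h: "0 \<le> h"
  shows "incr h t n k \<in> borel_measurable borel"
proof -
  have [measurable]: "B h (n - k) (t + real k * h) \<in> borel_measurable borel"
    "P h (B h (n - Suc k) (t + real (Suc k) * h)) \<in> borel_measurable borel"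
    using B_measurable[OF h] qbound_measurable[OF qbound_heat[OF B_qbound[OF h] h]] by auto
  show ?thesis unfolding incr_def[abs_def] by measurable
qed

lemma incr_qbound: "0 \<le> h \<Longrightarrow> qbound (h * fb + h) (incr h t n k)"
  using fb_nonneg by (intro qbound_linear incr_measurable) (auto simp: algebra_simps dest: incr_bound[of h t n k])

lemma B_telescope:
  assumes h: "0 \<le> h"
  shows "B h n t y = (\<Sum>k<n. damp (real k * h) * P (real k * h) (incr h t n k) y)"
proof -
  have "B h n t y = (\<Sum>k<j. damp (real k * h) * P (real k * h) (incr h t n k) y)
      + damp (real j * h) * P (real j * h) (B h (n - j) (t + real j * h)) y" for j
  proof (induction j)
    case (Suc j)
    let ?B' = "B h (n - Suc j) (t + real (Suc j) * h)"
    have jh: "0 \<le> real j * h" using h by simp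
    have "B h (n - j) (t + real j * h) = (\<lambda>x. incr h t n j x + damp h * P h ?B' x)"
      by (rule ext) (simp add: incr_def)
    then have "P (real j * h) (B h (n - j) (t + real j * h)) y
        = P (real j * h) (incr h t n j) y + P (real j * h) (\<lambda>x. damp h * P h ?B' x) y"
      by (simp only:) (rule heat_add[OF incr_qbound[OF h] qbound_cmult[OF qbound_heat[OF B_qbound[OF h] h]]])
    also have "P (real j * h) (\<lambda>x. damp h * P h ?B' x) y = damp h * P (real j * h + h) ?B' y"
      unfolding heat_cmult heat_semigroup[OF B_qbound[OF h] jh h] ..
    also have "real j * h + h = real (Suc j) * h" by (simp add: algebra_simps)
    finally have "damp (real j * h) * P (real j * h) (B h (n - j) (t + real j * h)) y
      = damp (real j * h) * P (real j * h) (incr h t n j) y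
        + (damp (real j * h) * damp h) * P (real (Suc j) * h) ?B' y"
      by (simp add: distrib_left mult.assoc)
    also have "damp (real j * h) * damp h = damp (real (Suc j) * h)"
      by (simp add: algebra_simps flip: exp_add)
    finally show ?case using Suc.IH by simp
  qed simp
  from this[of n] have "B h n t y = (\<Sum>k<n. damp (real k * h) * P (real k * h) (incr h t n k) y)
      + damp (real n * h) * P (real n * h) (B h 0 (t + real n * h)) y" by simp
  moreover have "B h 0 s = (\<lambda>x. 0)" for s by (rule ext) simp
  ultimately show ?thesis by simp
qed

text \<open>Monotonicity of \<open>f\<close> encloses its average over a step between the two end
  values. Adding \<open>fb\<close> makes \<open>f + fb\<close> nonnegative, so that discount factor
  and coefficient can be estimated separately; the linear part is accounted for exactly by
  \<open>disc\<close>. Start and state move with the mesh because grid dates do.\<close>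

lemma H_div_tendsto:
  assumes h: "h \<longlonglongrightarrow> 0" "\<And>n. 0 < h n" and s: "s \<longlonglongrightarrow> a" and x: "x \<longlonglongrightarrow> z"
  shows "(\<lambda>n. H (h n) (s n) (x n) / h n) \<longlonglongrightarrow> f a - z"
proof -
  have fc: "isCont f x" for x using f_cont by (simp add: continuous_on_eq_continuous_at)
  have lower: "(\<lambda>n. damp (h n) * f (s n + h n)) \<longlonglongrightarrow> damp 0 * f (a + 0)"
    by (intro tendsto_intros h s isCont_tendsto_compose[OF fc])
  have upper: "(\<lambda>n. f (s n)) \<longlonglongrightarrow> f a"
    by (intro s isCont_tendsto_compose[OF fc])
  have eq: "H h s x = (LBINT r:{0..h}. damp r * (f (s + r) + fb)) - disc h * (fb + x)" if "0 < h" for h s x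
  proof -
    have "H h s x = (LBINT r:{0..h}. damp r * (f (s + r) - (- fb)) - damp r * (fb + x))"
      unfolding H_def by (intro set_lebesgue_integral_cong) (auto simp: algebra_simps)
    also have "\<dots> = (LBINT r:{0..h}. damp r * (f (s + r) - (- fb))) - (LBINT r:{0..h}. damp r * (fb + x))"
      by (rule set_integral_diff(2)[OF H_integrable]) (intro set_integrable_mult_left disc_integrable)
    finally show ?thesis by (simp add: disc_def)
  qed
  have fbf: "0 \<le> f s + fb" for s using f_bound[of s] by (simp add: abs_le_iff)
  have up: "(LBINT r:{0..h}. damp r * (f (s + r) + fb)) \<le> h * (f s + fb)" if "0 < h" for h s
  proof -
    have "(LBINT r:{0..h}. damp r * (f (s + r) - (- fb))) \<le> (LBINT r:{0..h}. f s + fb)"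
    proof (rule set_integral_mono[OF H_integrable])
      fix r assume r: "r \<in> {0..h}"
      have "damp r * (f (s + r) - (- fb)) \<le> 1 * (f s + fb)"
        using f_antimono[of s "s + r"] fbf[of "s + r"] exp_le_1[of r] r by (intro mult_mono) auto
      then show "damp r * (f (s + r) - (- fb)) \<le> f s + fb" by simp
    qed simp
    then show ?thesis using that set_integral_const_Icc[of 0 h "f s + fb"] by simp
  qed
  have lo: "h * (damp h * (f (s + h) + fb)) \<le> (LBINT r:{0..h}. damp r * (f (s + r) + fb))" if "0 < h" for h s
  proof -
    have "(LBINT r:{0..h}. damp h * (f (s + h) + fb)) \<le> (LBINT r:{0..h}. damp r * (f (s + r) - (- fb)))"
    proof (rule set_integral_mono[OF _ H_integrable])
      fix r assume r: "r \<in> {0..h}"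
      have "damp h * (f (s + h) + fb) \<le> damp r * (f (s + r) + fb)"
        using f_antimono[of "s + r" "s + h"] fbf[of "s + h"] \<rho>_pos r by (intro mult_mono) auto
      then show "damp h * (f (s + h) + fb) \<le> damp r * (f (s + r) - (- fb))" by simp
    qed simp
    then show ?thesis
      unfolding set_integral_const_Icc[OF order.strict_implies_order[OF that]] by (simp add: mult.left_commute)
  qed
  have disc_lim: "(\<lambda>n. disc (h n) / h n) \<longlonglongrightarrow> 1"
  proof (rule tendsto_sandwich)
    show "(\<lambda>n. damp (h n)) \<longlonglongrightarrow> 1" using tendsto_exp[OF tendsto_mult_right_zero[OF h(1), of "- \<rho>"]] by simp
    show "\<forall>\<^sub>F n in sequentially. damp (h n) \<le> disc (h n) / h n"
      using disc_bounds(3)[OF order.strict_implies_order[OF h(2)]] h(2) by (intro always_eventually allI) (simp add: pos_le_divide_eq)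
    show "\<forall>\<^sub>F n in sequentially. disc (h n) / h n \<le> 1"
      using disc_bounds(2)[OF order.strict_implies_order[OF h(2)]] h(2) by (intro always_eventually allI) (simp add: pos_divide_le_eq)
  qed simp
  let ?I = "\<lambda>n. (LBINT r:{0..h n}. damp r * (f (s n + r) + fb)) / h n"
  have I_lim: "?I \<longlonglongrightarrow> f a + fb"
  proof (rule tendsto_sandwich)
    show "\<forall>\<^sub>F n in sequentially. damp (h n) * (f (s n + h n) + fb) \<le> ?I n"
      using lo[OF h(2)] h(2) by (intro always_eventually allI) (simp add: pos_le_divide_eq mult.commute)
    show "\<forall>\<^sub>F n in sequentially. ?I n \<le> f (s n) + fb"
      using up[OF h(2)] h(2) by (intro always_eventually allI) (simp add: pos_divide_le_eq mult.commute)
    show "(\<lambda>n. f (s n) + fb) \<longlonglongrightarrow> f a + fb" by (intro tendsto_intros upper)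
    have "(\<lambda>n. damp (h n) * f (s n + h n) + damp (h n) * fb) \<longlonglongrightarrow> damp 0 * f (a + 0) + damp 0 * fb"
      by (intro tendsto_intros lower h)
    then show "(\<lambda>n. damp (h n) * (f (s n + h n) + fb)) \<longlonglongrightarrow> f a + fb" by (simp add: distrib_left)
  qed
  have "(\<lambda>n. ?I n - disc (h n) / h n * (fb + x n)) \<longlonglongrightarrow> (f a + fb) - 1 * (fb + z)"
    by (intro tendsto_intros I_lim disc_lim x)
  moreover have "?I n - disc (h n) / h n * (fb + x n) = H (h n) (s n) (x n) / h n" for n
    unfolding eq[OF h(2)] by (simp add: diff_divide_distrib)
  ultimately show ?thesis by simp
qed


lemma floor_mesh:
  assumes s: "0 \<le> s" and h: "0 < (h::real)"
  defines "k \<equiv> nat \<lfloor>s / h\<rfloor>"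
  shows "real k * h \<le> s" "s < real k * h + h" "s < real n * h \<Longrightarrow> k < n"
proof -
  have k0: "int k = \<lfloor>s / h\<rfloor>" using s h by (simp add: k_def)
  have *: "real k * h \<le> s" "\<not> real (Suc k) * h \<le> s" unfolding floor_grid[OF h] k0[symmetric] by auto
  then show "real k * h \<le> s" "s < real k * h + h" by (auto simp: algebra_simps)
  show "k < n" if "s < real n * h"
  proof -
    have "real k * h < real n * h" using * that by linarith
    then show ?thesis using h by simp
  qed
qed

text \<open>At such a point the current Bermudan value vanishes with \<open>u\<close>. Since
  \<open>b\<close> does not increase, the next value vanishes on the whole ball of radius
  \<open>e\<close>; only mass leaving this ball within time \<open>h\<close> contributes, and
  \<open>heat_local\<close> bounds it by order \<open>h\<^sup>2\<close>.\<close>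

lemma incr_above_b_small:
  assumes t: "0 \<le> t" and n: "t + real n * h = T" and k: "k < n" and h: "0 < h" and e: "0 < e"
    and x: "b (t + real k * h) + e \<le> x"
  shows "\<bar>incr h t n k x\<bar> \<le> 2 * (T * (1 + \<bar>x0\<bar>)) / e ^ 4 * far_const \<sigma> T x * h\<^sup>2"
proof -
  let ?s = "t + real k * h" and ?B = "B h (n - Suc k) (t + real (Suc k) * h)"
  have kn: "real k * h \<le> real n * h" "real (Suc k) * h \<le> real n * h" "real k * h \<le> real (Suc k) * h"
    using k h by (auto intro!: mult_right_mono)
  have kh: "0 \<le> real k * h" "h \<le> real (Suc k) * h" using h by (auto simp: algebra_simps)
  have s: "0 \<le> ?s" "?s \<le> T" "0 \<le> t + real (Suc k) * h" "t + real (Suc k) * h \<le> T" "h \<le> T"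
    using kh kn t n by linarith+
  have sn: "?s + real (n - k) * h = T" "t + real (Suc k) * h + real (n - Suc k) * h = T"
    using n k by (auto simp: of_nat_diff algebra_simps)
  have "B h (n - k) ?s x \<le> u ?s x" by (rule B_le_u[OF h s(1) sn(1)])
  also have "u ?s x = 0" using x e s by (intro u_zero_above) auto
  finally have "B h (n - k) ?s x = 0" using B_nonneg[of h "n - k" ?s x] by simp
  then have i: "\<bar>incr h t n k x\<bar> = damp h * \<bar>P h ?B x\<bar>"
    unfolding incr_def by (simp add: abs_mult)
  have Bu: "?B z \<le> u (t + real (Suc k) * h) z" for z by (rule B_le_u[OF h s(3) sn(2)])
  have near: "?B z \<le> 0" if "\<bar>z - x\<bar> \<le> e" for z
  proof -
    have "b (t + real (Suc k) * h) \<le> b ?s" using kn by (intro b_antimono) auto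
    then have "b (t + real (Suc k) * h) \<le> z" using x that by linarith
    then have "u (t + real (Suc k) * h) z = 0" using s by (intro u_zero_above) auto
    then show ?thesis using Bu[of z] by simp
  qed
  have qb: "qbound (T * (1 + \<bar>x0\<bar>)) ?B"
  proof -
    have "qbound (T * \<bar>x0\<bar> + T) ?B"
    proof (rule qbound_linear)
      show "?B \<in> borel_measurable borel" using h by (intro B_measurable) auto
      show "\<bar>?B z\<bar> \<le> T * \<bar>x0\<bar> + T * \<bar>z\<bar>" for z
        using Bu[of z] B_nonneg[of h "n - Suc k" "t + real (Suc k) * h" z] u_linear[OF s(3,4), of z] by (simp add: algebra_simps)
    qed (use T_pos in auto)
    then show ?thesis by (simp add: algebra_simps)
  qed
  have "P h ?B x \<le> P h (\<lambda>x. 0) x + 2 * (T * (1 + \<bar>x0\<bar>)) / e ^ 4 * far_const \<sigma> T x * h\<^sup>2"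
  proof (rule heat_local[OF qb _ _ s(5) e near])
    show "qbound (T * (1 + \<bar>x0\<bar>)) (\<lambda>x. 0)" using T_pos by (intro qboundI) auto
  qed (use h in auto)
  moreover have "0 \<le> P h ?B x" by (intro heat_nonneg B_nonneg)
  moreover have "damp h * \<bar>P h ?B x\<bar> \<le> 1 * \<bar>P h ?B x\<bar>" using h exp_le_1[of h] by (intro mult_right_mono) auto
  ultimately show ?thesis unfolding i by simp
qed

text \<open>Below \<open>b\<close> the limit point has \<open>u > 0\<close>. The Lipschitz bound in
  the state and monotonicity in time transfer this to the nearby grid points, and
  \<open>u \<le> B + err\<close> makes \<open>B\<close> positive there for fine meshes, so the
  increment is \<open>H\<close>. Above \<open>b\<close> the increment is
  \<open>O(h\<^sup>2)\<close>; continuity of \<open>b\<close> at \<open>t + s\<close> keeps the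
  distance to the boundary at the rounded dates.\<close>

lemma incr_tendsto:
  assumes t: "0 \<le> t" "t < T" and s: "0 < s" "s < T - t" and cont: "isCont b (t + s)"
    and x: "x \<longlonglongrightarrow> z" and z: "z \<noteq> b (t + s)"
  defines "k \<equiv> \<lambda>N. nat \<lfloor>s / mesh t N\<rfloor>"
  shows "(\<lambda>N. real (k N) * mesh t N) \<longlonglongrightarrow> s"
    and "(\<lambda>N. incr (mesh t N) t (Suc N) (k N) (x N) / mesh t N) \<longlonglongrightarrow> q b (t + s) z"
proof -
  let ?h = "mesh t"
  note h = mesh[OF t(2)]
  have h0: "0 \<le> ?h N" for N using h(1)[of N] by simp
  have nh: "real (Suc N) * ?h N = T - t" for N using h(2)[of N] by simp
  have k: "real (k N) * ?h N \<le> s" "s < real (k N) * ?h N + ?h N" "k N < Suc N" for N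
    unfolding k_def using floor_mesh(1,2)[of s "?h N"] floor_mesh(3)[of s "?h N" "Suc N"] s h(1)[of N] nh[of N] by auto
  show sl: "(\<lambda>N. real (k N) * ?h N) \<longlonglongrightarrow> s"
  proof (rule tendsto_sandwich)
    have "(\<lambda>N. s - ?h N) \<longlonglongrightarrow> s - 0" by (intro tendsto_intros h(3))
    then show "(\<lambda>N. s - ?h N) \<longlonglongrightarrow> s" by simp
    show "\<forall>\<^sub>F N in sequentially. s - ?h N \<le> real (k N) * ?h N"
      using k(2) by (intro always_eventually allI) (smt (verit))
    show "\<forall>\<^sub>F N in sequentially. real (k N) * ?h N \<le> s"
      using k(1) by (intro always_eventually allI)
  qed simp
  let ?s = "\<lambda>N. t + real (k N) * ?h N"
  have tsl: "?s \<longlonglongrightarrow> t + s" by (intro tendsto_intros sl)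
  have sN: "0 \<le> ?s N" "?s N \<le> t + s" "?s N \<le> T" for N
    using k(1)[of N] h0[of N] t s by (auto intro: add_nonneg_nonneg)
  have rest: "?s N + real (Suc N - k N) * ?h N = T" for N
    using h(2)[of N] k(3)[of N] by (simp add: of_nat_diff algebra_simps)
  show "(\<lambda>N. incr (?h N) t (Suc N) (k N) (x N) / ?h N) \<longlonglongrightarrow> q b (t + s) z"
  proof (cases "z < b (t + s)")
    case True
    have pos: "0 < u (t + s) z" using True s t by (subst u_pos_iff) auto
    have "(\<lambda>N. u (t + s) z - T * \<bar>z - x N\<bar> - err (?h N) (x N)) \<longlonglongrightarrow> u (t + s) z - T * \<bar>z - z\<bar> - 0"
      by (intro tendsto_intros err_tendsto[OF h(3) x] x)
    then have "\<forall>\<^sub>F N in sequentially. 0 < u (t + s) z - T * \<bar>z - x N\<bar> - err (?h N) (x N)"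
      using pos by (intro order_tendstoD(1)[where y = "u (t + s) z"]) auto
    then have ev: "\<forall>\<^sub>F N in sequentially. incr (?h N) t (Suc N) (k N) (x N) / ?h N = H (?h N) (?s N) (x N) / ?h N"
    proof eventually_elim
      case (elim N)
      have "u (t + s) z - u (t + s) (x N) \<le> (T - (t + s)) * \<bar>z - x N\<bar>"
        using u_lipschitz[of "t + s" z "x N"] s t by simp
      also have "\<dots> \<le> T * \<bar>z - x N\<bar>" using s t by (intro mult_right_mono) auto
      finally have "u (t + s) z - T * \<bar>z - x N\<bar> \<le> u (t + s) (x N)" by simp
      also have "\<dots> \<le> u (?s N) (x N)" using sN[of N] s by (intro u_antimono_time) auto
      also have "\<dots> \<le> B (?h N) (Suc N - k N) (?s N) (x N) + err (?h N) (x N)"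
        by (rule u_le_B[OF h(1) sN(1) rest])
      finally have pB: "0 < B (?h N) (Suc N - k N) (?s N) (x N)" using elim by linarith
      have n: "Suc N - k N = Suc (Suc N - Suc (k N))" using k(3)[of N] by simp
      have e: "t + real (Suc (k N)) * ?h N = ?s N + ?h N" by (simp add: algebra_simps)
      show ?case using pB unfolding incr_def n e B.simps by (simp add: max_def split: if_splits)
    qed
    have "(\<lambda>N. H (?h N) (?s N) (x N) / ?h N) \<longlonglongrightarrow> f (t + s) - z"
      by (rule H_div_tendsto[OF h(3) h(1) tsl x])
    then show ?thesis using True by (simp add: q_def tendsto_cong[OF ev])
  next
    case False
    then have gt: "b (t + s) < z" using z by simp
    define e where "e = (z - b (t + s)) / 2"
    have e: "0 < e" using gt by (simp add: e_def)
    let ?c = "\<lambda>N. 2 * (T * (1 + \<bar>x0\<bar>)) / e ^ 4 * far_const \<sigma> T (x N) * ?h N"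
    have "(\<lambda>N. x N - b (?s N)) \<longlonglongrightarrow> z - b (t + s)"
      by (intro tendsto_intros x isCont_tendsto_compose[OF cont tsl])
    moreover have "e < z - b (t + s)" using gt by (simp add: e_def)
    ultimately have "\<forall>\<^sub>F N in sequentially. e < x N - b (?s N)" by (intro order_tendstoD(1))
    then have ev: "\<forall>\<^sub>F N in sequentially. \<bar>incr (?h N) t (Suc N) (k N) (x N) / ?h N\<bar> \<le> ?c N"
    proof eventually_elim
      case (elim N)
      have "\<bar>incr (?h N) t (Suc N) (k N) (x N)\<bar> \<le> 2 * (T * (1 + \<bar>x0\<bar>)) / e ^ 4 * far_const \<sigma> T (x N) * (?h N)\<^sup>2"
        using elim by (intro incr_above_b_small[OF t(1) h(2) k(3) h(1) e]) simp
      then have "\<bar>incr (?h N) t (Suc N) (k N) (x N)\<bar> / ?h N \<le> (?c N * ?h N) / ?h N"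
        using h0[of N] by (intro divide_right_mono) (auto simp: power2_eq_square mult_ac)
      then show ?case using h(1)[of N] h0[of N] by simp
    qed
    have "?c \<longlonglongrightarrow> 2 * (T * (1 + \<bar>x0\<bar>)) / e ^ 4 * far_const \<sigma> T z * 0"
      unfolding far_const_def by (intro tendsto_intros x h(3))
    then have "?c \<longlonglongrightarrow> 0" by simp
    then have "(\<lambda>N. incr (?h N) t (Suc N) (k N) (x N) / ?h N) \<longlonglongrightarrow> 0"
      by (rule Lim_null_comparison[rotated]) (use ev in simp)
    then show ?thesis using False z by (simp add: q_def)
  qed
qed

lemma heat_q_measurable [measurable]:
  assumes [measurable]: "c \<in> borel_measurable borel"
  shows "(\<lambda>s. P s (q c (t + s)) y) \<in> borel_measurable borel"
proof -
  have "case_prod (\<lambda>s. q c (t + s)) \<in> borel_measurable (borel \<Otimes>\<^sub>M borel)"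
    unfolding split_def by measurable
  then show ?thesis by (rule heat_measurable) simp_all
qed

lemma q_qbound:
  assumes [measurable]: "c \<in> borel_measurable borel"
  shows "qbound (fb + 1) (q c t)"
proof (rule qbound_linear)
  show "q c t \<in> borel_measurable borel" by measurable
  show "\<bar>q c t x\<bar> \<le> fb + 1 * \<bar>x\<bar>" for x using q_bound[of c t x] by simp
qed (simp_all add: fb_nonneg)

lemma heat_q_bound:
  assumes "c \<in> borel_measurable borel" "0 \<le> s" "s \<le> T"
  shows "\<bar>P s (q c t) y\<bar> \<le> fb + \<bar>y\<bar> + \<sigma> * sqrt T"
proof -
  have "\<bar>P s (q c t) y\<bar> \<le> fb + 1 * (\<bar>y\<bar> + \<sigma> * sqrt s)"
    using assms fb_nonneg \<sigma>_pos q_bound[of c t] by (intro heat_abs_le_linear) auto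
  also have "\<dots> \<le> fb + \<bar>y\<bar> + \<sigma> * sqrt T" using assms \<sigma>_pos by (simp add: mult_left_mono)
  finally show ?thesis .
qed

text \<open>The telescoped sum is the time integral of the step function \<open>g N\<close>, so it
  converges by dominated convergence under the Gaussian measure and then in time. The squeeze
  \<open>B \<le> u \<le> B + err\<close> identifies its limit with \<open>u\<close>.\<close>

theorem u_eq_G:
  assumes t: "0 \<le> t" "t \<le> T"
  shows "u t y = G b t y"
proof (cases "t = T")
  case True
  then show ?thesis by (simp add: G_def)
next
  case False
  then have tT: "t < T" using t by simp
  note h = mesh[OF tT]
  let ?h = "mesh t"
  have h0: "0 \<le> ?h N" for N using h(1)[of N] by simp
  have nh: "real (Suc N) * ?h N = T - t" for N using h(2)[of N] by simp
  let ?C = "fb + \<bar>y\<bar> + \<sigma> * sqrt T"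
  have C0: "0 \<le> ?C" using fb_nonneg \<sigma>_pos T_pos by simp
  define v where "v N k = damp (real k * ?h N) * P (real k * ?h N) (incr (?h N) t (Suc N) k) y / ?h N" for N k
  define g where "g N s = v N (nat \<lfloor>s / ?h N\<rfloor>)" for N s
  have vb: "\<bar>v N k\<bar> \<le> ?C" if "real k * ?h N \<le> T" for N k
  proof -
    have kh: "0 \<le> real k * ?h N" using h0 by simp
    have "\<bar>P (real k * ?h N) (incr (?h N) t (Suc N) k) y\<bar> \<le> ?h N * fb + ?h N * (\<bar>y\<bar> + \<sigma> * sqrt (real k * ?h N))"
      using incr_bound[OF h0[of N], of t "Suc N" k] incr_measurable[OF h0[of N]] kh fb_nonneg h0 \<sigma>_pos
      by (intro heat_abs_le_linear) (auto simp: distrib_left)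
    also have "\<dots> = ?h N * (fb + \<bar>y\<bar> + \<sigma> * sqrt (real k * ?h N))" by (simp add: distrib_left)
    also have "\<dots> \<le> ?h N * ?C" using h0 \<sigma>_pos that by (intro mult_left_mono add_left_mono real_sqrt_le_mono) auto
    finally have *: "\<bar>P (real k * ?h N) (incr (?h N) t (Suc N) k) y\<bar> \<le> ?h N * ?C" .
    have "damp (real k * ?h N) * \<bar>P (real k * ?h N) (incr (?h N) t (Suc N) k) y\<bar> \<le> 1 * (?h N * ?C)"
      using * exp_le_1[OF kh] by (intro mult_mono) auto
    then have "damp (real k * ?h N) * \<bar>P (real k * ?h N) (incr (?h N) t (Suc N) k) y\<bar> / ?h N \<le> ?C"
      using h(1)[of N] by (simp add: pos_divide_le_eq mult.commute)
    then show ?thesis using h(1)[of N] by (simp add: v_def abs_mult)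
  qed
  have gm: "g N \<in> borel_measurable borel" for N unfolding g_def[abs_def] by measurable
  have gb: "\<bar>g N s\<bar> \<le> ?C" if "s \<in> {0..T - t}" for N s
  proof -
    have "real (nat \<lfloor>s / ?h N\<rfloor>) * ?h N \<le> s" using that by (intro floor_mesh h) auto
    also have "s \<le> T" using that t by simp
    finally show ?thesis unfolding g_def by (rule vb)
  qed
  have gi: "set_integrable lborel {0..T - t} (g N)" for N
  proof -
    have "(\<lambda>s. indicator {0..T - t} s *\<^sub>R g N s) \<in> borel_measurable lborel" using gm by measurable
    from set_integral_bounded(1)[OF this gb] show ?thesis using t by simp
  qed
  have sum_eq: "B (?h N) (Suc N) t y = (LBINT s:{0..T - t}. g N s)" for N
  proof -
    have "(LBINT s:{0..T - t}. g N s) = (\<Sum>k<Suc N. LBINT s:{real k * ?h N..real (Suc k) * ?h N}. g N s)"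
      using gi[of N] h0[of N] unfolding nh[of N, symmetric] by (rule set_integral_grid)
    also have "\<dots> = (\<Sum>k<Suc N. damp (real k * ?h N) * P (real k * ?h N) (incr (?h N) t (Suc N) k) y)"
    proof (rule sum.cong[OF refl])
      fix k
      have le: "real k * ?h N \<le> real (Suc k) * ?h N" using h0 by (intro mult_right_mono) auto
      have "(LBINT s:{real k * ?h N..real (Suc k) * ?h N}. g N s) = (LBINT s:{real k * ?h N..real (Suc k) * ?h N}. v N k)"
        unfolding set_lebesgue_integral_def
      proof (rule integral_cong_AE)
        show "AE s in lborel. indicator {real k * ?h N..real (Suc k) * ?h N} s *\<^sub>R g N s = indicator {real k * ?h N..real (Suc k) * ?h N} s *\<^sub>R v N k"
          using AE_lborel_singleton[of "real (Suc k) * ?h N"]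
        proof eventually_elim
          case (elim s)
          show ?case
          proof (cases "s \<in> {real k * ?h N..real (Suc k) * ?h N}")
            case True
            then have "real k * ?h N \<le> s" "s < real (Suc k) * ?h N" using elim by auto
            then have "\<lfloor>s / ?h N\<rfloor> = int k"
              using h(1)[of N] by (intro floor_unique) (auto simp: pos_le_divide_eq pos_divide_less_eq add.commute)
            then show ?thesis by (simp add: g_def)
          qed simp
        qed
      qed (use gm in measurable)
      also have "\<dots> = ?h N * v N k"
        unfolding set_integral_const_Icc[OF le] by (simp add: algebra_simps)
      also have "\<dots> = damp (real k * ?h N) * P (real k * ?h N) (incr (?h N) t (Suc N) k) y"
        using h(1)[of N] by (simp add: v_def)
      finally show "(LBINT s:{real k * ?h N..real (Suc k) * ?h N}. g N s) = damp (real k * ?h N) * P (real k * ?h N) (incr (?h N) t (Suc N) k) y" .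
    qed
    finally show ?thesis using B_telescope[OF h0[of N], of "Suc N" t y] by simp
  qed
  have g_lim: "(\<lambda>N. g N s) \<longlonglongrightarrow> damp s * P s (q b (t + s)) y"
    if s: "0 < s" "s < T - t" and cont: "isCont b (t + s)" for s
  proof -
    define k where "k N = nat \<lfloor>s / ?h N\<rfloor>" for N
    let ?r = "\<lambda>N. real (k N) * ?h N"
    have rs: "?r N \<le> s" for N unfolding k_def using s by (intro floor_mesh h) auto
    have r0: "0 \<le> ?r N" for N using h0 by simp
    have rl: "?r \<longlonglongrightarrow> s"
      unfolding k_def using incr_tendsto(1)[OF t(1) tT s cont tendsto_const[of "b (t + s) + 1"]] by simp
    have "(\<lambda>N. \<integral>z. incr (?h N) t (Suc N) (k N) (y + \<sigma> * sqrt (?r N) * z) / ?h N \<partial>stdN) \<longlonglongrightarrow> (\<integral>z. q b (t + s) (y + \<sigma> * sqrt s * z) \<partial>stdN)"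
    proof (rule integral_dominated_convergence)
      show "(\<lambda>z. q b (t + s) (y + \<sigma> * sqrt s * z)) \<in> borel_measurable stdN" by measurable
      show "(\<lambda>z. incr (?h N) t (Suc N) (k N) (y + \<sigma> * sqrt (?r N) * z) / ?h N) \<in> borel_measurable stdN" for N
        using incr_measurable[OF h0[of N], of t "Suc N" "k N"] by measurable
      show "integrable stdN (\<lambda>z. fb + \<bar>y\<bar> + \<sigma> * sqrt s * \<bar>z\<bar>)" by simp
      show "AE z in stdN. norm (incr (?h N) t (Suc N) (k N) (y + \<sigma> * sqrt (?r N) * z) / ?h N) \<le> fb + \<bar>y\<bar> + \<sigma> * sqrt s * \<bar>z\<bar>" for N
      proof (rule AE_I2)
        fix z
        have "\<bar>incr (?h N) t (Suc N) (k N) (y + \<sigma> * sqrt (?r N) * z)\<bar> / ?h N \<le> fb + \<bar>y + \<sigma> * sqrt (?r N) * z\<bar>"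
          using incr_bound[OF h0[of N], of t "Suc N" "k N" "y + \<sigma> * sqrt (?r N) * z"] h(1)[of N] by (simp add: pos_divide_le_eq mult.commute)
        also have "\<dots> \<le> fb + (\<bar>y\<bar> + \<sigma> * sqrt (?r N) * \<bar>z\<bar>)" using \<sigma>_pos r0 by (intro add_left_mono abs_shift_le) auto
        also have "\<sigma> * sqrt (?r N) * \<bar>z\<bar> \<le> \<sigma> * sqrt s * \<bar>z\<bar>" using \<sigma>_pos rs[of N] by (intro mult_right_mono mult_left_mono) auto
        finally show "norm (incr (?h N) t (Suc N) (k N) (y + \<sigma> * sqrt (?r N) * z) / ?h N) \<le> fb + \<bar>y\<bar> + \<sigma> * sqrt s * \<bar>z\<bar>"
          using h(1)[of N] by simp
      qed
      \<comment> \<open>The source jumps at the boundary; a Gaussian variable of positive variance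
        hits that point with probability 0.\<close>
      show "AE z in stdN. (\<lambda>N. incr (?h N) t (Suc N) (k N) (y + \<sigma> * sqrt (?r N) * z) / ?h N) \<longlonglongrightarrow> q b (t + s) (y + \<sigma> * sqrt s * z)"
        using AE_stdN_neq[of "(b (t + s) - y) / (\<sigma> * sqrt s)"]
      proof eventually_elim
        case (elim z)
        have ne: "y + \<sigma> * sqrt s * z \<noteq> b (t + s)" using elim \<sigma>_pos s by (auto simp: field_simps)
        have "(\<lambda>N. y + \<sigma> * sqrt (?r N) * z) \<longlonglongrightarrow> y + \<sigma> * sqrt s * z" by (intro tendsto_intros rl)
        from incr_tendsto(2)[OF t(1) tT s cont this ne] show ?case unfolding k_def .
      qed
    qed
    then have "(\<lambda>N. damp (?r N) * (\<integral>z. incr (?h N) t (Suc N) (k N) (y + \<sigma> * sqrt (?r N) * z) / ?h N \<partial>stdN))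
        \<longlonglongrightarrow> damp s * P s (q b (t + s)) y"
      unfolding heat_def by (intro tendsto_intros rl)
    then show ?thesis by (simp add: g_def v_def k_def heat_def)
  qed
  have "(\<lambda>N. LBINT s:{0..T - t}. g N s) \<longlonglongrightarrow> G b t y"
    unfolding G_def set_lebesgue_integral_def
  proof (rule integral_dominated_convergence)
    show "(\<lambda>s. indicator {0..T - t} s *\<^sub>R (damp s * P s (q b (t + s)) y)) \<in> borel_measurable lborel" by measurable
    show "(\<lambda>s. indicator {0..T - t} s *\<^sub>R g N s) \<in> borel_measurable lborel" for N using gm by measurable
    show "integrable lborel (\<lambda>s. indicator {0..T - t} s *\<^sub>R ?C)"
      using set_integrable_const_Icc[of 0 "T - t" ?C] unfolding set_integrable_def .
    show "AE s in lborel. norm (indicator {0..T - t} s *\<^sub>R g N s) \<le> indicator {0..T - t} s *\<^sub>R ?C" for N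
      using gb C0 by (intro AE_I2) (simp add: indicator_def)
    have "AE s in lborel. isCont b (t + s)"
      by (rule b_AE_cont)
    then show "AE s in lborel. (\<lambda>N. indicator {0..T - t} s *\<^sub>R g N s) \<longlonglongrightarrow> indicator {0..T - t} s *\<^sub>R (damp s * P s (q b (t + s)) y)"
      using AE_lborel_singleton[of 0] AE_lborel_singleton[of "T - t"]
    proof eventually_elim
      case (elim s)
      show ?case
      proof (cases "s \<in> {0..T - t}")
        case True
        then have "0 < s" "s < T - t" using elim by auto
        from g_lim[OF this elim(1)] show ?thesis using True by simp
      qed simp
    qed
  qed
  then have lim: "(\<lambda>N. B (?h N) (Suc N) t y) \<longlonglongrightarrow> G b t y" unfolding sum_eq .
  show ?thesis
  proof (rule antisym)
    have "(\<lambda>N. B (?h N) (Suc N) t y + err (?h N) y) \<longlonglongrightarrow> G b t y + 0"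
      by (intro tendsto_intros lim err_tendsto[OF h(3) tendsto_const])
    then show "u t y \<le> G b t y"
      using u_le_B[OF h(1) t(1) h(2)] by (intro LIMSEQ_le_const[of _ _ "u t y"]) auto
    show "G b t y \<le> u t y"
      using B_le_u[OF h(1) t(1) h(2)] by (intro LIMSEQ_le_const2[OF lim]) auto
  qed
qed


section \<open>Continuity of the free boundary\<close>

lemma heat_q_joint_measurable:
  assumes [measurable]: "c \<in> borel_measurable borel" "a \<in> borel_measurable N" "s \<in> borel_measurable N" "y \<in> borel_measurable N"
  shows "(\<lambda>w. P (s w) (q c (a w)) (y w)) \<in> borel_measurable N"
proof -
  have "case_prod (\<lambda>w. q c (a w)) \<in> borel_measurable (N \<Otimes>\<^sub>M borel)"
    unfolding split_def by measurable
  then show ?thesis by (rule heat_measurable) (rule assms)+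
qed

lemma heat_q_integral:
  assumes [measurable]: "c \<in> borel_measurable borel" and r: "0 \<le> r" "r \<le> T"
  shows "set_integrable lborel {0..r} (\<lambda>s. damp s * P s (q c (t + s)) y)"
    and "\<bar>LBINT s:{0..r}. damp s * P s (q c (t + s)) y\<bar> \<le> r * (fb + \<bar>y\<bar> + \<sigma> * sqrt T)"
proof -
  let ?g = "\<lambda>s. damp s * P s (q c (t + s)) y"
  have m: "(\<lambda>s. indicator {0..r} s *\<^sub>R ?g s) \<in> borel_measurable lborel" by measurable
  have b: "\<bar>?g s\<bar> \<le> fb + \<bar>y\<bar> + \<sigma> * sqrt T" if "s \<in> {0..r}" for s
  proof -
    have "damp s * \<bar>P s (q c (t + s)) y\<bar> \<le> 1 * (fb + \<bar>y\<bar> + \<sigma> * sqrt T)"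
      using that r by (intro mult_mono exp_le_1 heat_q_bound) auto
    then show ?thesis by (simp add: abs_mult)
  qed
  show "set_integrable lborel {0..r} ?g" "\<bar>LBINT s:{0..r}. ?g s\<bar> \<le> r * (fb + \<bar>y\<bar> + \<sigma> * sqrt T)"
    using set_integral_bounded[OF m b r(1)] by simp_all
qed

lemma G_measurable:
  assumes [measurable]: "c \<in> borel_measurable borel"
  shows "G c t \<in> borel_measurable borel"
proof -
  have "(\<lambda>p. P (snd p) (q c (t + snd p)) (fst p)) \<in> borel_measurable (borel \<Otimes>\<^sub>M lborel)"
    by (rule heat_q_joint_measurable) measurable
  then have [measurable]: "(\<lambda>p. indicator {0..T - t} (snd p) *\<^sub>R (damp (snd p) * P (snd p) (q c (t + snd p)) (fst p))) \<in> borel_measurable (borel \<Otimes>\<^sub>M lborel)"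
    by measurable
  show ?thesis
    unfolding G_def[abs_def] set_lebesgue_integral_def
    by (rule lborel.borel_measurable_lebesgue_integral) (simp add: split_def)
qed

lemma G_bound:
  assumes "c \<in> borel_measurable borel" "0 \<le> t" "t \<le> T"
  shows "\<bar>G c t y\<bar> \<le> T * (fb + \<sigma> * sqrt T) + T * \<bar>y\<bar>"
proof -
  have "\<bar>G c t y\<bar> \<le> (T - t) * (fb + \<bar>y\<bar> + \<sigma> * sqrt T)"
    unfolding G_def using assms by (intro heat_q_integral(2)) auto
  also have "\<dots> \<le> T * (fb + \<bar>y\<bar> + \<sigma> * sqrt T)"
    using assms fb_nonneg \<sigma>_pos T_pos by (intro mult_right_mono) auto
  finally show ?thesis by (simp add: algebra_simps)
qed

definition Gc :: real where "Gc = T * (fb + \<sigma> * sqrt T) + T"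

lemma G_qbound:
  assumes "c \<in> borel_measurable borel" "0 \<le> t" "t \<le> T"
  shows "qbound Gc (G c t)"
  unfolding Gc_def
proof (rule qbound_linear[OF G_measurable[OF assms(1)] G_bound[OF assms]])
  show "0 \<le> T * (fb + \<sigma> * sqrt T)" "0 \<le> T" using fb_nonneg \<sigma>_pos T_pos by auto
qed

text \<open>Beyond \<open>r\<close> the semigroup property and Fubini pull \<open>P r\<close> out of
  the time integral. This dynamic programming identity at a deterministic time links the values of
  \<open>G c\<close> at different times and takes the place of Ito's formula in all later
  comparisons.\<close>

lemma G_flow:
  assumes c[measurable]: "c \<in> borel_measurable borel" and t: "0 \<le> t" and r: "0 \<le> r" "t + r \<le> T"
  shows "G c t y = (LBINT s:{0..r}. damp s * P s (q c (t + s)) y) + damp r * P r (G c (t + r)) y"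
proof -
  let ?g = "\<lambda>s. damp s * P s (q c (t + s)) y"
  let ?\<phi> = "\<lambda>s z. damp s * P s (q c (t + r + s)) (y + \<sigma> * sqrt r * z)"
  let ?a = "T - (t + r)"
  have m: "case_prod ?\<phi> \<in> borel_measurable (borel \<Otimes>\<^sub>M stdN)"
  proof -
    have "(\<lambda>w. P (fst w) (q c (t + r + fst w)) (y + \<sigma> * sqrt r * snd w)) \<in> borel_measurable (borel \<Otimes>\<^sub>M stdN)"
      by (rule heat_q_joint_measurable) measurable
    then show ?thesis unfolding split_def by measurable
  qed
  have qb: "qbound ((fb + 1) * (1 + \<sigma>\<^sup>2 * s)) (P s (q c (t + r + s)))" if "0 \<le> s" for s
    by (rule qbound_heat[OF q_qbound[OF c] that])
  have int: "integrable stdN (?\<phi> s)" if "s \<in> {0..?a}" for s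
    using qbound_integrable[OF qb[of s]] that by simp
  have bnd: "(\<integral>z. \<bar>?\<phi> s z\<bar> \<partial>stdN) \<le> fb + \<bar>y\<bar> + \<sigma> * sqrt r + \<sigma> * sqrt T" if s: "s \<in> {0..?a}" for s
  proof -
    have "(\<integral>z. \<bar>?\<phi> s z\<bar> \<partial>stdN) \<le> (\<integral>z. (fb + \<bar>y\<bar> + \<sigma> * sqrt T) + \<sigma> * sqrt r * \<bar>z\<bar> \<partial>stdN)"
    proof (rule integral_mono)
      fix z
      have "\<bar>?\<phi> s z\<bar> \<le> 1 * \<bar>P s (q c (t + r + s)) (y + \<sigma> * sqrt r * z)\<bar>"
        unfolding abs_mult using s exp_le_1[of s] by (intro mult_right_mono) auto
      also have "\<dots> \<le> 1 * (fb + \<bar>y + \<sigma> * sqrt r * z\<bar> + \<sigma> * sqrt T)"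
        using s t r by (intro mult_left_mono heat_q_bound[OF c]) auto
      also have "\<bar>y + \<sigma> * sqrt r * z\<bar> \<le> \<bar>y\<bar> + \<sigma> * sqrt r * \<bar>z\<bar>" using \<sigma>_pos r by (intro abs_shift_le) auto
      finally show "\<bar>?\<phi> s z\<bar> \<le> (fb + \<bar>y\<bar> + \<sigma> * sqrt T) + \<sigma> * sqrt r * \<bar>z\<bar>" by simp
    qed (use int[OF s] in auto)
    also have "\<dots> = (fb + \<bar>y\<bar> + \<sigma> * sqrt T) + \<sigma> * sqrt r * (\<integral>z. \<bar>z\<bar> \<partial>stdN)" by simp
    also have "\<dots> \<le> (fb + \<bar>y\<bar> + \<sigma> * sqrt T) + \<sigma> * sqrt r * 1"
      using integral_stdN_abs \<sigma>_pos r by (intro add_left_mono mult_left_mono) auto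
    finally show ?thesis by simp
  qed
  have fub: "P r (G c (t + r)) y = (LBINT s:{0..?a}. (\<integral>z. ?\<phi> s z \<partial>stdN))"
    using stdN.fubini_time(1)[OF m int bnd] unfolding heat_def[of \<sigma> r] G_def by simp
  have "(LBINT s:{r..r + ?a}. ?g s) = (LBINT s:{0..?a}. ?g (r + s))" by (rule set_integral_shift)
  also have "\<dots> = (LBINT s:{0..?a}. damp r * (\<integral>z. ?\<phi> s z \<partial>stdN))"
  proof (rule set_lebesgue_integral_cong, simp, intro allI impI)
    fix s assume s: "s \<in> {0..?a}"
    have "P (r + s) (q c (t + (r + s))) y = P r (P s (q c (t + r + s))) y"
      using s r by (subst heat_semigroup[OF q_qbound[OF c]]) (auto simp: add.assoc)
    moreover have "damp (r + s) = damp r * damp s" by (simp add: algebra_simps flip: exp_add)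
    ultimately show "?g (r + s) = damp r * (\<integral>z. ?\<phi> s z \<partial>stdN)"
      by (simp add: heat_def[of \<sigma> r])
  qed
  also have "\<dots> = damp r * P r (G c (t + r)) y" unfolding fub by simp
  finally have "(LBINT s:{r..r + ?a}. ?g s) = damp r * P r (G c (t + r)) y" .
  moreover have "G c t y = (LBINT s:{0..r}. ?g s) + (LBINT s:{r..T - t}. ?g s)"
    unfolding G_def using t r by (intro set_integral_combine heat_q_integral(1)) auto
  ultimately show ?thesis by (simp add: algebra_simps)
qed

text \<open>As \<open>m \<le> 0\<close>, the discount factor is replaced by its smallest value
  \<open>damp r\<close> in front of \<open>m\<close> and by 1 in front of the error. The hypothesis
  concerns the smoothed source, because in \<open>excess_impossible\<close> the source is negative
  with a fixed Gaussian probability rather than on a whole neighbourhood.\<close>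

lemma source_le_pointwise:
  assumes m: "m \<le> 0" and D: "0 \<le> D" and r: "0 \<le> r"
    and int: "set_integrable lborel {0..r} (\<lambda>s. damp s * P s (k s) y)"
    and le: "\<And>s. 0 < s \<Longrightarrow> s < r \<Longrightarrow> P s (k s) y \<le> m + D * s\<^sup>2"
  shows "(LBINT s:{0..r}. damp s * P s (k s) y) \<le> r * (damp r * m + D * r\<^sup>2)"
proof -
  have "(LBINT s:{0..r}. damp s * P s (k s) y) \<le> (LBINT s:{0..r}. damp r * m + D * r\<^sup>2)"
    unfolding set_lebesgue_integral_def
  proof (rule integral_mono_AE)
    show "integrable lborel (\<lambda>s. indicator {0..r} s *\<^sub>R (damp s * P s (k s) y))"
      using int unfolding set_integrable_def .
    show "integrable lborel (\<lambda>s. indicator {0..r} s *\<^sub>R (damp r * m + D * r\<^sup>2))"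
      using set_integrable_const_Icc[of 0 r] unfolding set_integrable_def .
    show "AE s in lborel. indicator {0..r} s *\<^sub>R (damp s * P s (k s) y) \<le> indicator {0..r} s *\<^sub>R (damp r * m + D * r\<^sup>2)"
      using AE_lborel_singleton[of 0] AE_lborel_singleton[of r]
    proof eventually_elim
      case (elim s)
      show ?case
      proof (cases "s \<in> {0..r}")
        case True
        then have s: "0 < s" "s < r" using elim by auto
        have "P s (k s) y \<le> m + D * s\<^sup>2" by (rule le[OF s])
        also have "D * s\<^sup>2 \<le> D * r\<^sup>2" using D s by (intro mult_left_mono power_mono) auto
        finally have "damp s * P s (k s) y \<le> damp s * (m + D * r\<^sup>2)" by (intro mult_left_mono) auto
        also have "\<dots> = damp s * m + damp s * (D * r\<^sup>2)" by (rule distrib_left)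
        also have "\<dots> \<le> damp r * m + 1 * (D * r\<^sup>2)"
        proof (rule add_mono)
          show "damp s * m \<le> damp r * m"
            using m(1) s \<rho>_pos by (intro mult_right_mono_neg) auto
          show "damp s * (D * r\<^sup>2) \<le> 1 * (D * r\<^sup>2)"
            using s by (intro mult_right_mono[OF exp_le_1 mult_nonneg_nonneg[OF D zero_le_power2]]) auto
        qed
        finally show ?thesis using True by simp
      qed simp
    qed
  qed
  also have "\<dots> = r * (damp r * m + D * r\<^sup>2)" unfolding set_integral_const_Icc[OF r] by simp
  finally show ?thesis .
qed

lemma source_le:
  assumes k: "\<And>s. s \<in> {0..r} \<Longrightarrow> qbound C (k s)" and m: "m \<le> 0" "\<bar>m\<bar> \<le> C" and r: "0 \<le> r" "r \<le> T" and e: "0 < e"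
    and int: "set_integrable lborel {0..r} (\<lambda>s. damp s * P s (k s) y)"
    and near: "\<And>s x. 0 < s \<Longrightarrow> s < r \<Longrightarrow> \<bar>x - y\<bar> \<le> e \<Longrightarrow> k s x \<le> m"
  shows "(LBINT s:{0..r}. damp s * P s (k s) y) \<le> r * (damp r * m + 2 * C / e ^ 4 * far_const \<sigma> T y * r\<^sup>2)"
proof (rule source_le_pointwise[OF m(1) _ r(1) int])
  have C: "0 \<le> C" using m by linarith
  then show "0 \<le> 2 * C / e ^ 4 * far_const \<sigma> T y" using e far_const_nonneg[of T \<sigma> y] T_pos by simp
  fix s assume s: "0 < s" "s < r"
  have "P s (k s) y \<le> P s (\<lambda>x. m) y + 2 * C / e ^ 4 * far_const \<sigma> T y * s\<^sup>2"
    using s r by (intro heat_local[OF k qbound_weaken[OF qbound_const m(2)] _ _ e near]) auto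
  then show "P s (k s) y \<le> m + 2 * C / e ^ 4 * far_const \<sigma> T y * s\<^sup>2" by simp
qed

text \<open>For \<open>r\<close> tending to 0 the inequality becomes
  \<open>\<kappa> \<le> 0\<close>. The users have divided by \<open>r\<close> beforehand, so
  \<open>\<kappa>\<close> is the rate of the strictly signed term and the right side collects the
  errors.\<close>

lemma small_r_contradiction:
  fixes \<kappa> D D' d :: real
  assumes "0 < \<kappa>" "0 < d" and le: "\<And>r. 0 < r \<Longrightarrow> r < d \<Longrightarrow> \<kappa> * damp r \<le> D * r\<^sup>2 + D' * r"
  shows False
proof -
  have "((\<lambda>r. \<kappa> * damp r) \<longlongrightarrow> \<kappa> * damp 0) (at_right 0)"
    by (intro tendsto_intros)
  moreover have "((\<lambda>r. D * r\<^sup>2 + D' * r) \<longlongrightarrow> D * 0\<^sup>2 + D' * 0) (at_right 0)"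
    by (intro tendsto_intros)
  moreover have "\<forall>\<^sub>F r in at_right 0. \<kappa> * damp r \<le> D * r\<^sup>2 + D' * r"
    unfolding eventually_at_right_field using assms(2) le by auto
  ultimately have "\<kappa> * damp 0 \<le> D * 0\<^sup>2 + D' * 0"
    using tendsto_le[OF trivial_limit_at_right_real] by blast
  then show False using assms(1) by simp
qed

text \<open>By the flow identity and the Lipschitz bound, \<open>u\<close> at \<open>y\<close> loses
  at most \<open>r * C + T * \<sigma> * sqrt r\<close> in time \<open>r\<close>, where
  \<open>C\<close> bounds the source; so positivity at \<open>t\<close>, and with it
  \<open>y < b\<close>, persists for a while.\<close>

lemma b_right_lower_bound:
  assumes t: "0 \<le> t" "t < T" and y: "y < b t"
  shows "\<exists>d>0. \<forall>s. t \<le> s \<and> s < t + d \<longrightarrow> y < b s"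
proof -
  have pos: "0 < u t y" using y u_pos_iff[OF t] by simp
  let ?C = "fb + \<bar>y\<bar> + \<sigma> * sqrt T"
  have "((\<lambda>r. r * ?C + T * \<sigma> * sqrt r) \<longlongrightarrow> 0 * ?C + T * \<sigma> * sqrt 0) (at_right 0)"
    by (intro tendsto_intros)
  then have "\<forall>\<^sub>F r in at_right 0. r * ?C + T * \<sigma> * sqrt r < u t y"
    using pos by (intro order_tendstoD(2)) auto
  then obtain d0 where d0: "0 < d0" "\<And>r. 0 < r \<Longrightarrow> r < d0 \<Longrightarrow> r * ?C + T * \<sigma> * sqrt r < u t y"
    unfolding eventually_at_right_field by auto
  define d where "d = min d0 (T - t)"
  have "y < b (t + r)" if r: "0 < r" "r < d" for r
  proof -
    have tr: "0 \<le> t + r" "t + r < T" using r t by (auto simp: d_def)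
    have "u t y = (LBINT s:{0..r}. damp s * P s (q b (t + s)) y) + damp r * P r (u (t + r)) y"
    proof -
      have "u (t + r) = G b (t + r)" using tr by (intro ext u_eq_G) auto
      then show ?thesis using u_eq_G[of t y] G_flow[OF b_measurable t(1), of r y] tr t r by simp
    qed
    moreover have "(LBINT s:{0..r}. damp s * P s (q b (t + s)) y) \<le> r * ?C"
      using heat_q_integral(2)[OF b_measurable, of r t y] r t by (simp add: d_def abs_le_iff)
    moreover have "damp r * P r (u (t + r)) y \<le> 1 * P r (u (t + r)) y"
      using r exp_le_1[of r] tr by (intro mult_right_mono heat_nonneg u_nonneg) auto
    moreover have "\<bar>P r (u (t + r)) y - u (t + r) y\<bar> \<le> (T - (t + r)) * \<sigma> * sqrt r"
      using tr r \<sigma>_pos by (intro heat_lipschitz_time u_lipschitz) auto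
    moreover have "(T - (t + r)) * \<sigma> * sqrt r \<le> T * \<sigma> * sqrt r"
      using tr \<sigma>_pos r by (intro mult_right_mono) auto
    moreover have "r * ?C + T * \<sigma> * sqrt r < u t y" using r by (intro d0) (auto simp: d_def)
    ultimately have "0 < u (t + r) y" by linarith
    then show ?thesis using u_pos_iff[OF tr] by simp
  qed
  then have "y < b s" if "t \<le> s" "s < t + d" for s
    using that y by (cases "s = t") (auto dest: meta_spec[of _ "s - t"])
  moreover have "0 < d" using d0 t by (simp add: d_def)
  ultimately show ?thesis by blast
qed

text \<open>If \<open>b\<close> stayed above \<open>y\<close> up to time \<open>t\<close>, the strip
  between \<open>b t\<close> and \<open>y\<close> would be a region of waiting. Since
  \<open>f t \<le> b t\<close>, the source is negative inside it, and \<open>u\<close> vanishes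
  there at time \<open>t\<close>; starting shortly before \<open>t\<close> would make
  \<open>u\<close> negative. For \<open>t = T\<close> this forces \<open>b\<close> to end at
  \<open>f T\<close>.\<close>

lemma b_left_upper_bound:
  assumes t: "0 < t" "t \<le> T" and y: "b t < y"
  shows "\<exists>s. 0 \<le> s \<and> s < t \<and> b s \<le> y"
proof (rule ccontr)
  assume "\<not> ?thesis"
  then have above: "y < b s" if "0 \<le> s" "s < t" for s using that by force
  \<comment> \<open>The midpoint \<open>y0\<close> lies \<open>e\<close> above \<open>b t\<close>. A
    ball of radius \<open>e / 2\<close> and a variation of \<open>f\<close> by \<open>e / 4\<close>
    leave the source at most \<open>- (e / 4)\<close>.\<close>
  define e where "e = (y - b t) / 2"
  define y0 where "y0 = b t + e"
  have e: "0 < e" "y0 + e = y" using y by (auto simp: e_def y0_def field_simps)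
  have "isCont f t" using f_cont by (simp add: continuous_on_eq_continuous_at)
  then obtain d0 where d0: "0 < d0" "\<And>s. \<bar>s - t\<bar> < d0 \<Longrightarrow> \<bar>f s - f t\<bar> < e / 4"
    unfolding continuous_at_eps_delta dist_real_def using e by (metis zero_less_divide_iff zero_less_numeral)
  define d where "d = min d0 t"
  define C where "C = fb + 1 + Gc + e"
  have Gc: "0 \<le> Gc" using fb_nonneg \<sigma>_pos T_pos by (simp add: Gc_def)
  define D where "D = 2 * C / (e / 2) ^ 4 * far_const \<sigma> T y0"
  show False
  proof (rule small_r_contradiction[of "e / 4" d D D])
    show "0 < e / 4" "0 < d" using e d0 t by (auto simp: d_def)
    fix r assume r: "0 < r" "r < d"
    define s where "s = t - r"
    have s: "0 \<le> s" "s < t" "s + r = t" using r by (auto simp: s_def d_def)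
    have e2: "0 < e / 2" using e by simp
    have "(LBINT r':{0..r}. damp r' * P r' (q b (s + r')) y0) \<le> r * (damp r * - (e / 4) + D * r\<^sup>2)"
      unfolding D_def
    proof (rule source_le[OF _ _ _ _ _ e2])
      show "qbound C (q b (s + r'))" for r'
        using qbound_weaken[OF q_qbound[OF b_measurable]] Gc e by (simp add: C_def)
      show "- (e / 4) \<le> 0" "\<bar>- (e / 4)\<bar> \<le> C" using e Gc fb_nonneg by (auto simp: C_def)
      show "set_integrable lborel {0..r} (\<lambda>r'. damp r' * P r' (q b (s + r')) y0)"
        using s t r by (intro heat_q_integral(1)) auto
      fix r' x assume r': "0 < r'" "r' < r" "\<bar>x - y0\<bar> \<le> e / 2"
      have "y < b (s + r')" using s r' by (intro above) auto
      then have "q b (s + r') x = f (s + r') - x" using r' e by (auto simp: q_def)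
      moreover have "\<bar>f (s + r') - f t\<bar> < e / 4" using r' s r by (intro d0) (auto simp: d_def)
      moreover have "f t \<le> y0 - e" using f_le_b[of t] t by (simp add: y0_def)
      ultimately show "q b (s + r') x \<le> - (e / 4)" using r'(3) unfolding abs_le_iff abs_less_iff by linarith
    qed (use r s t in auto)
    moreover have "damp r * P r (u t) y0 \<le> D * r\<^sup>2"
    proof -
      have "u t = G b t" using t by (intro ext u_eq_G) auto
      then have qu: "qbound C (u t)"
        using qbound_weaken[OF G_qbound[OF b_measurable, of t]] t fb_nonneg e by (simp add: C_def)
      have "P r (u t) y0 \<le> P r (\<lambda>x. 0) y0 + D * r\<^sup>2"
        unfolding D_def
      proof (rule heat_local[OF qu _ _ _ e2])
        show "qbound C (\<lambda>x. 0)" using qbound_weaken[OF qbound_const[of 0]] Gc e fb_nonneg by (simp add: C_def)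
        fix x assume "\<bar>x - y0\<bar> \<le> e / 2"
        then have "b t \<le> x" using e(1) unfolding y0_def by linarith
        then show "u t x \<le> 0" using u_zero_above[of t x] t by simp
      qed (use r s t in auto)
      moreover have "damp r * P r (u t) y0 \<le> 1 * P r (u t) y0"
        using r exp_le_1[of r] t by (intro mult_right_mono heat_nonneg u_nonneg) auto
      ultimately show ?thesis by simp
    qed
    moreover have "u s y0 = (LBINT r':{0..r}. damp r' * P r' (q b (s + r')) y0) + damp r * P r (u t) y0"
    proof -
      have "u t = G b t" using t by (intro ext u_eq_G) auto
      then show ?thesis using u_eq_G[of s y0] G_flow[OF b_measurable s(1), of r y0] s t r by simp
    qed
    moreover have "0 \<le> u s y0" using s t by (intro u_nonneg) auto
    ultimately have "0 \<le> r * (damp r * - (e / 4) + D * r\<^sup>2) + D * r\<^sup>2" by linarith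
    also have "\<dots> = r * (damp r * - (e / 4) + D * r\<^sup>2 + D * r)" by (simp add: algebra_simps power2_eq_square)
    finally have "0 \<le> damp r * - (e / 4) + D * r\<^sup>2 + D * r" using r by (simp add: zero_le_mult_iff)
    then show "e / 4 * damp r \<le> D * r\<^sup>2 + D * r" by (simp add: mult.commute)
  qed
qed

lemma b_cont: "continuous_on UNIV b"
proof -
  have "continuous_on {0..T} b"
    unfolding continuous_on_iff
  proof (intro ballI allI impI)
    fix t \<epsilon> :: real assume t: "t \<in> {0..T}" and \<epsilon>: "0 < \<epsilon>"
    \<comment> \<open>Monotonicity supplies two of the four one-sided estimates; what remains is the
      lower one on the right and the upper one on the left.\<close>
    have "\<exists>d>0. \<forall>s\<in>{0..T}. t \<le> s \<and> s < t + d \<longrightarrow> b t - \<epsilon> < b s"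
    proof (cases "t = T")
      case True
      then show ?thesis using \<epsilon> by (intro exI[of _ 1]) (auto intro: order_antisym)
    next
      case False
      then show ?thesis using b_right_lower_bound[of t "b t - \<epsilon>"] t \<epsilon> by auto
    qed
    then obtain d1 where d1: "0 < d1" "\<And>s. s \<in> {0..T} \<Longrightarrow> t \<le> s \<Longrightarrow> s < t + d1 \<Longrightarrow> b t - \<epsilon> < b s" by blast
    have "\<exists>d>0. \<forall>s\<in>{0..T}. s \<le> t \<and> t - d < s \<longrightarrow> b s < b t + \<epsilon>"
    proof (cases "t = 0")
      case True
      then show ?thesis using \<epsilon> by (intro exI[of _ 1]) (auto intro: order_antisym)
    next
      case False
      then obtain s0 where s0: "0 \<le> s0" "s0 < t" "b s0 \<le> b t + \<epsilon> / 2"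
        using b_left_upper_bound[of t "b t + \<epsilon> / 2"] t \<epsilon> by auto
      show ?thesis
      proof (intro exI[of _ "t - s0"] conjI ballI impI)
        fix s assume "s \<le> t \<and> t - (t - s0) < s"
        then have "b s \<le> b s0" by (intro b_antimono) auto
        then show "b s < b t + \<epsilon>" using s0 \<epsilon> by linarith
      qed (use s0 in simp)
    qed
    then obtain d2 where d2: "0 < d2" "\<And>s. s \<in> {0..T} \<Longrightarrow> s \<le> t \<Longrightarrow> t - d2 < s \<Longrightarrow> b s < b t + \<epsilon>" by blast
    show "\<exists>d>0. \<forall>s\<in>{0..T}. dist s t < d \<longrightarrow> dist (b s) (b t) < \<epsilon>"
    proof (intro exI[of _ "min d1 d2"] conjI ballI impI)
      fix s assume s: "s \<in> {0..T}" "dist s t < min d1 d2"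
      show "dist (b s) (b t) < \<epsilon>"
      proof (cases "t \<le> s")
        case True
        then have "b t - \<epsilon> < b s" using s by (intro d1) (auto simp: dist_real_def)
        then show ?thesis using b_antimono[OF True] \<epsilon> by (simp add: dist_real_def abs_less_iff)
      next
        case False
        then have "b s < b t + \<epsilon>" using s by (intro d2) (auto simp: dist_real_def)
        then show ?thesis using b_antimono[of s t] False \<epsilon> by (simp add: dist_real_def abs_less_iff)
      qed
    qed (use d1 d2 in simp)
  qed
  then have "continuous_on UNIV (\<lambda>t. b (max 0 (min T t)))"
    by (rule continuous_on_compose2) (use T_pos in \<open>auto intro!: continuous_intros\<close>)
  moreover have "b (max 0 (min T t)) = b t" for t
    using T_pos by (auto simp: b_def max_def min_def)
  ultimately show ?thesis by simp
qed

end

section \<open>Maximum principle and uniqueness\<close>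

text \<open>On this interval the density is at least its value at 2. It represents displacements of
  one to two standard deviations downwards, the ones counted in
  \<open>excess_impossible\<close>.\<close>

lemma measure_stdN_pos: "0 < measure stdN {-2..-1}"
proof -
  have ind: "(\<integral>z. indicator {-2..-1} z \<partial>stdN) = measure stdN {-2..-1::real}" by simp
  let ?c = "std_normal_density 2"
  have c: "0 < ?c" by (rule normal_density_pos) simp
  have "?c = (\<integral>z. indicator {-2..-1::real} z *\<^sub>R ?c \<partial>lborel)" by simp
  also have "\<dots> \<le> (\<integral>z. std_normal_density z * indicator {-2..-1} z \<partial>lborel)"
  proof (rule integral_mono)
    show "integrable lborel (\<lambda>z. indicator {-2..-1::real} z *\<^sub>R ?c)"
      using set_integrable_const_Icc[of "-2" "-1" ?c] unfolding set_integrable_def .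
    show "integrable lborel (\<lambda>z. std_normal_density z * indicator {-2..-1} z)"
      by (subst integrable_stdN_iff[symmetric]) (auto intro!: integrable_real_indicator simp: stdN.emeasure_eq_measure)
    fix z :: real
    show "indicator {-2..-1} z *\<^sub>R ?c \<le> std_normal_density z * indicator {-2..-1} z"
    proof (cases "z \<in> {-2..-1}")
      case True
      then have "z\<^sup>2 \<le> 2\<^sup>2" by (intro abs_le_square_iff[THEN iffD1]) auto
      then have "?c \<le> std_normal_density z" unfolding std_normal_density_def by (intro mult_left_mono) auto
      then show ?thesis using True by simp
    qed simp
  qed
  also have "\<dots> = measure stdN {-2..-1}"
    unfolding ind[symmetric] by (rule integral_stdN[symmetric]) simp
  finally show ?thesis using c by linarith
qed

context stopping_problem
begin

section \<open>Joint continuity of \<open>G\<close>\<close>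

lemma q_tendsto:
  assumes c: "isCont c \<tau>" and t: "t \<longlonglongrightarrow> \<tau>" and x: "x \<longlonglongrightarrow> z" and ne: "z \<noteq> c \<tau>"
  shows "(\<lambda>n. q c (t n) (x n)) \<longlonglongrightarrow> q c \<tau> z"
proof -
  have "isCont f \<tau>" using f_cont by (simp add: continuous_on_eq_continuous_at)
  then have fx: "(\<lambda>n. f (t n) - x n) \<longlonglongrightarrow> f \<tau> - z" by (intro tendsto_intros x isCont_tendsto_compose[OF _ t])
  have cx: "(\<lambda>n. c (t n) - x n) \<longlonglongrightarrow> c \<tau> - z" by (intro tendsto_intros x isCont_tendsto_compose[OF c t])
  show ?thesis
  proof (cases "z < c \<tau>")
    case True
    then have "\<forall>\<^sub>F n in sequentially. 0 < c (t n) - x n" by (intro order_tendstoD(1)[OF cx]) simp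
    then have "\<forall>\<^sub>F n in sequentially. q c (t n) (x n) = f (t n) - x n" by eventually_elim (simp add: q_def)
    then show ?thesis using fx True by (simp add: tendsto_cong q_def)
  next
    case False
    then have "\<forall>\<^sub>F n in sequentially. c (t n) - x n < 0" using ne by (intro order_tendstoD(2)[OF cx]) simp
    then have "\<forall>\<^sub>F n in sequentially. q c (t n) (x n) = 0" by eventually_elim (simp add: q_def)
    then show ?thesis using False ne by (simp add: tendsto_cong q_def)
  qed
qed

text \<open>For \<open>s > 0\<close> the Gaussian law has no mass at the jump of the source, so
  smoothing makes it continuous in time and state.\<close>

lemma heat_q_tendsto:
  assumes c: "continuous_on UNIV c" and t: "t \<longlonglongrightarrow> \<tau>" and y: "y \<longlonglongrightarrow> z" and s: "0 < s"
  shows "(\<lambda>n. P s (q c (t n)) (y n)) \<longlonglongrightarrow> P s (q c \<tau>) z"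
proof -
  have [measurable]: "c \<in> borel_measurable borel" by (rule borel_measurable_continuous_onI[OF c])
  have cc: "isCont c \<tau>" using c by (simp add: continuous_on_eq_continuous_at)
  obtain Y where Y: "\<And>n. \<bar>y n\<bar> \<le> Y"
    using convergent_imp_Bseq[OF convergentI[OF y]] unfolding Bseq_def by auto
  show ?thesis
    unfolding heat_def
  proof (rule integral_dominated_convergence)
    show "(\<lambda>x. q c \<tau> (z + \<sigma> * sqrt s * x)) \<in> borel_measurable stdN"
      "(\<lambda>x. q c (t n) (y n + \<sigma> * sqrt s * x)) \<in> borel_measurable stdN" for n by measurable
    show "integrable stdN (\<lambda>x. fb + Y + \<sigma> * sqrt s * \<bar>x\<bar>)" by simp
    show "AE x in stdN. norm (q c (t n) (y n + \<sigma> * sqrt s * x)) \<le> fb + Y + \<sigma> * sqrt s * \<bar>x\<bar>" for n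
    proof (rule AE_I2)
      fix x
      have "\<bar>q c (t n) (y n + \<sigma> * sqrt s * x)\<bar> \<le> fb + \<bar>y n + \<sigma> * sqrt s * x\<bar>" by (rule q_bound)
      also have "\<bar>y n + \<sigma> * sqrt s * x\<bar> \<le> \<bar>y n\<bar> + \<sigma> * sqrt s * \<bar>x\<bar>" using \<sigma>_pos s by (intro abs_shift_le) auto
      finally show "norm (q c (t n) (y n + \<sigma> * sqrt s * x)) \<le> fb + Y + \<sigma> * sqrt s * \<bar>x\<bar>" using Y[of n] by simp
    qed
    show "AE x in stdN. (\<lambda>n. q c (t n) (y n + \<sigma> * sqrt s * x)) \<longlonglongrightarrow> q c \<tau> (z + \<sigma> * sqrt s * x)"
      using AE_stdN_neq[of "(c \<tau> - z) / (\<sigma> * sqrt s)"]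
    proof eventually_elim
      case (elim x)
      have "z + \<sigma> * sqrt s * x \<noteq> c \<tau>" using elim \<sigma>_pos s by (auto simp: field_simps)
      then show ?case by (intro q_tendsto[OF cc t] tendsto_intros y)
    qed
  qed
qed

text \<open>Apart from the instants \<open>s = 0\<close> and \<open>s = T - fst a\<close>, the
  indicator of the moving interval is eventually constant and the smoothed source converges.
  Continuity up to the edges of the time interval is what lets the maximum principle attain its
  maximum on a compact set.\<close>

lemma G_cont:
  assumes c: "continuous_on UNIV c"
  shows "continuous_on ({0..T} \<times> UNIV) (\<lambda>p. G c (fst p) (snd p))"
  unfolding continuous_on_sequentially
proof (intro allI ballI impI)
  fix p :: "nat \<Rightarrow> real \<times> real" and a
  assume a: "a \<in> {0..T} \<times> UNIV" and p: "(\<forall>n. p n \<in> {0..T} \<times> UNIV) \<and> p \<longlonglongrightarrow> a"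
  define t y where "t n = fst (p n)" and "y n = snd (p n)" for n
  let ?\<tau> = "fst a" and ?z = "snd a"
  have tn: "0 \<le> t n" "t n \<le> T" for n using p by (auto simp: t_def mem_Times_iff)
  have \<tau>: "0 \<le> ?\<tau>" "?\<tau> \<le> T" using a by (auto simp: mem_Times_iff)
  have tl: "t \<longlonglongrightarrow> ?\<tau>" and yl: "y \<longlonglongrightarrow> ?z"
    unfolding t_def[abs_def] y_def[abs_def] using p by (auto intro: tendsto_fst tendsto_snd)
  have cm[measurable]: "c \<in> borel_measurable borel" by (rule borel_measurable_continuous_onI[OF c])
  obtain Y where Y: "\<And>n. \<bar>y n\<bar> \<le> Y"
    using convergent_imp_Bseq[OF convergentI[OF yl]] unfolding Bseq_def by auto
  let ?C = "fb + Y + \<sigma> * sqrt T"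
  have Y0: "0 \<le> Y" using Y[of 0] by simp
  have "(\<lambda>n. G c (t n) (y n)) \<longlonglongrightarrow> G c ?\<tau> ?z"
    unfolding G_def set_lebesgue_integral_def
  proof (rule integral_dominated_convergence)
    show "(\<lambda>s. indicator {0..T - ?\<tau>} s *\<^sub>R (damp s * P s (q c (?\<tau> + s)) ?z)) \<in> borel_measurable lborel"
      "(\<lambda>s. indicator {0..T - t n} s *\<^sub>R (damp s * P s (q c (t n + s)) (y n))) \<in> borel_measurable lborel" for n
      by measurable
    show "integrable lborel (\<lambda>s. indicator {0..T} s *\<^sub>R ?C)"
      using set_integrable_const_Icc[of 0 T ?C] unfolding set_integrable_def .
    show "AE s in lborel. norm (indicator {0..T - t n} s *\<^sub>R (damp s * P s (q c (t n + s)) (y n))) \<le> indicator {0..T} s *\<^sub>R ?C" for n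
    proof (rule AE_I2)
      fix s
      show "norm (indicator {0..T - t n} s *\<^sub>R (damp s * P s (q c (t n + s)) (y n))) \<le> indicator {0..T} s *\<^sub>R ?C"
      proof (cases "s \<in> {0..T - t n}")
        case True
        then have s: "0 \<le> s" "s \<le> T" using tn[of n] by auto
        have "\<bar>P s (q c (t n + s)) (y n)\<bar> \<le> ?C" using heat_q_bound[OF cm s, of "t n + s" "y n"] Y[of n] by linarith
        then have "damp s * \<bar>P s (q c (t n + s)) (y n)\<bar> \<le> 1 * ?C" using exp_le_1[OF s(1)] by (intro mult_mono) auto
        then show ?thesis using True s by (simp add: abs_mult)
      next
        case False
        have "0 \<le> ?C" using fb_nonneg \<sigma>_pos T_pos Y0 by simp
        then show ?thesis using False by simp
      qed
    qed
    have Tl: "(\<lambda>n. T - t n) \<longlonglongrightarrow> T - ?\<tau>" by (intro tendsto_intros tl)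
    show "AE s in lborel. (\<lambda>n. indicator {0..T - t n} s *\<^sub>R (damp s * P s (q c (t n + s)) (y n)))
        \<longlonglongrightarrow> indicator {0..T - ?\<tau>} s *\<^sub>R (damp s * P s (q c (?\<tau> + s)) ?z)"
      using AE_lborel_singleton[of 0] AE_lborel_singleton[of "T - ?\<tau>"]
    proof eventually_elim
      case (elim s)
      consider "s < 0" | "T - ?\<tau> < s" | "0 < s" "s < T - ?\<tau>" using elim by linarith
      then show ?case
      proof cases
        case 1
        then show ?thesis by simp
      next
        case 2
        have "\<forall>\<^sub>F n in sequentially. T - t n < s" by (rule order_tendstoD(2)[OF Tl 2])
        then have ev: "\<forall>\<^sub>F n in sequentially. indicator {0..T - t n} s *\<^sub>R (damp s * P s (q c (t n + s)) (y n)) = 0"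
          by eventually_elim simp
        show ?thesis using 2 by (subst tendsto_cong[OF ev]) simp
      next
        case 3
        have "\<forall>\<^sub>F n in sequentially. s < T - t n" by (rule order_tendstoD(1)[OF Tl 3(2)])
        then have ev: "\<forall>\<^sub>F n in sequentially. indicator {0..T - t n} s *\<^sub>R (damp s * P s (q c (t n + s)) (y n)) = damp s * P s (q c (t n + s)) (y n)"
          by eventually_elim (use 3 in simp)
        have "(\<lambda>n. damp s * P s (q c (t n + s)) (y n)) \<longlonglongrightarrow> damp s * P s (q c (?\<tau> + s)) ?z"
          by (intro tendsto_intros heat_q_tendsto[OF c _ yl 3(1)] tl)
        then show ?thesis using 3 by (subst tendsto_cong[OF ev]) simp
      qed
    qed
  qed
  then show "((\<lambda>p. G c (fst p) (snd p)) \<circ> p) \<longlonglongrightarrow> G c (fst a) (snd a)" by (simp add: o_def t_def y_def)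
qed

text \<open>At a positive maximum of \<open>d - \<eta>(y\<^sup>2 + 2\<sigma>\<^sup>2(T - t))\<close> over \<open>S\<close> the semigroup identity over a short time \<open>r\<close> loses
  \<open>\<eta>\<sigma>\<^sup>2r\<close> and gains only \<open>O(r\<^sup>2)\<close>; values of \<open>d\<close> outside \<open>S\<close> enter through this error only.\<close>

lemma max_principle:
  fixes a1 a2 :: real and S :: "(real \<times> real) set"
  assumes c1: "continuous_on UNIV c1" and c2: "continuous_on UNIV c2"
  defines "d \<equiv> \<lambda>t y. a1 * G c1 t y + a2 * G c2 t y" and "k \<equiv> \<lambda>t x. a1 * q c1 t x + a2 * q c2 t x"
  assumes S: "closed S" "\<And>t y. (t, y) \<in> S \<Longrightarrow> 0 \<le> t \<and> t \<le> T"
    and interior: "\<And>t y. (t, y) \<in> S \<Longrightarrow> 0 < d t y \<Longrightarrow> t < T \<Longrightarrow>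
      \<exists>e>0. \<forall>s x. 0 < s \<longrightarrow> s < e \<longrightarrow> t + s \<le> T \<longrightarrow> \<bar>x - y\<bar> \<le> e \<longrightarrow> (t + s, x) \<in> S \<and> k (t + s) x \<le> 0"
    and mem: "(t1, y1) \<in> S"
  shows "d t1 y1 \<le> 0"
proof (rule ccontr)
  assume "\<not> d t1 y1 \<le> 0"
  then have pos: "0 < d t1 y1" by simp
  have m[measurable]: "c1 \<in> borel_measurable borel" "c2 \<in> borel_measurable borel"
    by (auto intro: borel_measurable_continuous_onI c1 c2)
  define aa where "aa = \<bar>a1\<bar> + \<bar>a2\<bar>"
  have aa: "0 \<le> aa" by (simp add: aa_def)
  have Gc: "0 \<le> Gc" using fb_nonneg \<sigma>_pos T_pos by (simp add: Gc_def)
  have qd: "qbound (aa * Gc) (d t)" if "0 \<le> t" "t \<le> T" for t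
    unfolding d_def aa_def distrib_right by (intro qbound_add qbound_cmult G_qbound m that)
  have qk: "qbound (aa * (fb + 1)) (k t)" for t
    unfolding k_def aa_def distrib_right[of "\<bar>a1\<bar>"] by (intro qbound_add qbound_cmult q_qbound m)
  have heat_k: "P s (k t) y = a1 * P s (q c1 t) y + a2 * P s (q c2 t) y" for s t y
    unfolding k_def by (subst heat_add[OF qbound_cmult[OF q_qbound[OF m(1)]] qbound_cmult[OF q_qbound[OF m(2)]]]) (simp add: heat_cmult)
  have heat_d: "P s (d t) y = a1 * P s (G c1 t) y + a2 * P s (G c2 t) y" if "0 \<le> t" "t \<le> T" for s t y
    unfolding d_def by (subst heat_add[OF qbound_cmult[OF G_qbound[OF m(1) that]] qbound_cmult[OF G_qbound[OF m(2) that]]]) (simp add: heat_cmult)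
  have k_eq: "damp s * P s (k (t + s)) y = a1 * (damp s * P s (q c1 (t + s)) y) + a2 * (damp s * P s (q c2 (t + s)) y)" for s t y
    unfolding heat_k by (simp add: distrib_left mult.left_commute)
  have k_int: "set_integrable lborel {0..r} (\<lambda>s. damp s * P s (k (t + s)) y)" if "0 \<le> r" "r \<le> T" for r t y
    unfolding k_eq using that by (intro set_integral_add set_integrable_mult_right heat_q_integral(1) m) auto
  have flow: "d t y = (LBINT s:{0..r}. damp s * P s (k (t + s)) y) + damp r * P r (d (t + r)) y"
    if "0 \<le> t" "0 \<le> r" "t + r \<le> T" for t r y
  proof -
    have "(LBINT s:{0..r}. damp s * P s (k (t + s)) y)
      = (LBINT s:{0..r}. a1 * (damp s * P s (q c1 (t + s)) y)) + (LBINT s:{0..r}. a2 * (damp s * P s (q c2 (t + s)) y))"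
      unfolding k_eq using that by (intro set_integral_add(2) set_integrable_mult_right heat_q_integral(1) m) auto
    also have "\<dots> = a1 * (LBINT s:{0..r}. damp s * P s (q c1 (t + s)) y) + a2 * (LBINT s:{0..r}. damp s * P s (q c2 (t + s)) y)"
      by simp
    finally show ?thesis
      using that unfolding d_def[of] G_flow[OF m(1) that] G_flow[OF m(2) that]
      by (simp add: heat_d[unfolded d_def] algebra_simps)
  qed
  have d_cont: "continuous_on ({0..T} \<times> UNIV) (\<lambda>p. d (fst p) (snd p))"
    unfolding d_def by (intro continuous_intros G_cont c1 c2)
  define A where "A = aa * Gc"
  have A: "0 \<le> A" using aa Gc by (simp add: A_def)
  have growth: "\<bar>d t y\<bar> \<le> A + A * \<bar>y\<bar>" if t: "0 \<le> t" "t \<le> T" for t y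
  proof -
    have g: "\<bar>G c t y\<bar> \<le> Gc * (1 + \<bar>y\<bar>)" if "c \<in> borel_measurable borel" for c
    proof -
      have "\<bar>G c t y\<bar> \<le> T * (fb + \<sigma> * sqrt T) + T * \<bar>y\<bar>" by (rule G_bound[OF that t])
      also have "\<dots> \<le> Gc + Gc * \<bar>y\<bar>"
        unfolding Gc_def using T_pos fb_nonneg \<sigma>_pos by (intro add_mono mult_right_mono) auto
      finally show ?thesis by (simp add: distrib_left)
    qed
    have "\<bar>d t y\<bar> \<le> \<bar>a1\<bar> * \<bar>G c1 t y\<bar> + \<bar>a2\<bar> * \<bar>G c2 t y\<bar>"
      unfolding d_def using abs_triangle_ineq[of "a1 * G c1 t y" "a2 * G c2 t y"] by (simp add: abs_mult)
    also have "\<dots> \<le> \<bar>a1\<bar> * (Gc * (1 + \<bar>y\<bar>)) + \<bar>a2\<bar> * (Gc * (1 + \<bar>y\<bar>))"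
      by (intro add_mono mult_left_mono g m) auto
    also have "\<dots> = A + A * \<bar>y\<bar>" unfolding A_def aa_def by (simp add: algebra_simps)
    finally show ?thesis .
  qed
  have t1: "0 \<le> t1" "t1 \<le> T" using S(2)[OF mem] by auto
  \<comment> \<open>Over time \<open>r\<close> the semigroup raises the square by
    \<open>\<sigma>\<^sup>2 * r\<close> while the penalty falls by \<open>l * r\<close>; the factor
    2 leaves a strict loss.\<close>
  define l where "l = 2 * \<sigma>\<^sup>2"
  \<comment> \<open>\<open>\<eta>\<close> is chosen so that the penalty consumes at most half of the
    positive value at \<open>(t1, y1)\<close>; the summand 1 keeps the denominator positive.\<close>
  define E where "E = y1\<^sup>2 + l * T + 1"
  define \<eta> where "\<eta> = d t1 y1 / (2 * E)"
  have den: "0 < E" using T_pos by (simp add: l_def E_def add_nonneg_pos)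
  have \<eta>: "0 < \<eta>" using pos den by (simp add: \<eta>_def)
  define \<Phi> where "\<Phi> p = d (fst p) (snd p) - \<eta> * ((snd p)\<^sup>2 + l * (T - fst p))" for p
  have \<Phi>1: "0 < \<Phi> (t1, y1)"
  proof -
    have "\<eta> * (y1\<^sup>2 + l * (T - t1)) \<le> \<eta> * E"
      using \<eta> t1 by (intro mult_left_mono) (auto simp: l_def E_def algebra_simps)
    also have "\<dots> = d t1 y1 / 2" using den by (simp add: \<eta>_def)
    finally show ?thesis using pos by (simp add: \<Phi>_def)
  qed
  \<comment> \<open>From \<open>R\<close> on, the quadratic penalty exceeds the linear growth bound
    of \<open>d\<close>, so positive values of \<open>\<Phi>\<close> are confined to a compact part
    of \<open>S\<close>.\<close>
  define R where "R = 1 + 2 * A / \<eta>"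
  have out: "\<Phi> (t, y) < 0" if t: "0 \<le> t" "t \<le> T" and y: "R \<le> \<bar>y\<bar>" for t y
  proof -
    have R1: "1 \<le> R" using A \<eta> by (simp add: R_def)
    then have y1: "1 \<le> \<bar>y\<bar>" using y by linarith
    have "A + A * \<bar>y\<bar> \<le> 2 * A * \<bar>y\<bar>" using A y1 mult_left_mono[of 1 "\<bar>y\<bar>" A] by simp
    also have "\<dots> < (\<eta> + 2 * A) * \<bar>y\<bar>" using \<eta> y1 by (simp add: distrib_right)
    also have "\<eta> + 2 * A = \<eta> * R" using \<eta> by (simp add: R_def distrib_left)
    also have "\<eta> * R * \<bar>y\<bar> \<le> \<eta> * \<bar>y\<bar> * \<bar>y\<bar>" using \<eta> y by (intro mult_right_mono mult_left_mono) auto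
    also have "\<dots> = \<eta> * y\<^sup>2" by (simp add: power2_eq_square mult.assoc)
    finally have "d t y < \<eta> * y\<^sup>2" using growth[OF t, of y] by linarith
    moreover have "0 \<le> \<eta> * (l * (T - t))" using \<eta> t by (simp add: l_def)
    ultimately show ?thesis by (simp add: \<Phi>_def distrib_left)
  qed
  define K where "K = S \<inter> ({0..T} \<times> {-R..R})"
  have "compact K" unfolding K_def by (intro closed_Int_compact S compact_Times) auto
  moreover have "(t1, y1) \<in> K"
  proof -
    have "\<not> R \<le> \<bar>y1\<bar>" using out[OF t1, of y1] \<Phi>1 by auto
    then show ?thesis using mem t1 by (auto simp: K_def)
  qed
  moreover have "continuous_on K \<Phi>"
  proof -
    have "continuous_on K (\<lambda>p. d (fst p) (snd p))" by (rule continuous_on_subset[OF d_cont]) (auto simp: K_def)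
    then show ?thesis unfolding \<Phi>_def[abs_def] by (intro continuous_intros)
  qed
  ultimately obtain p where p: "p \<in> K" "\<And>p'. p' \<in> K \<Longrightarrow> \<Phi> p' \<le> \<Phi> p"
    using continuous_attains_sup[of K \<Phi>] by blast
  obtain t y where ty: "p = (t, y)" by (cases p)
  have t: "0 \<le> t" "t \<le> T" and tyS: "(t, y) \<in> S" using p(1) ty by (auto simp: K_def)
  define mx where "mx = \<Phi> (t, y)"
  have mx: "0 < mx" using p(2)[OF \<open>(t1, y1) \<in> K\<close>] \<Phi>1 ty by (simp add: mx_def)
  have top: "\<Phi> (t', y') \<le> mx" if "(t', y') \<in> S" for t' y'
  proof (cases "R \<le> \<bar>y'\<bar>")
    case True
    then show ?thesis using out[of t' y'] S(2)[OF that] mx by auto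
  next
    case False
    then have "(t', y') \<in> K" using that S(2)[OF that] by (auto simp: K_def)
    then show ?thesis using p(2) ty by (simp add: mx_def)
  qed
  have d_eq: "d t y = mx + \<eta> * (y\<^sup>2 + l * (T - t))" by (simp add: mx_def \<Phi>_def)
  have l0: "0 \<le> l" by (simp add: l_def)
  have dpos: "0 < d t y" unfolding d_eq using mx \<eta> t l0 by (intro add_pos_nonneg) auto
  have tT: "t < T"
  proof -
    have "d T y = 0" by (simp add: d_def G_def)
    then show ?thesis using dpos t by (cases "t = T") auto
  qed
  obtain e where e: "0 < e" "\<And>s x. 0 < s \<Longrightarrow> s < e \<Longrightarrow> t + s \<le> T \<Longrightarrow> \<bar>x - y\<bar> \<le> e \<Longrightarrow> (t + s, x) \<in> S \<and> k (t + s) x \<le> 0"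
    using interior[OF tyS dpos tT] by blast
  \<comment> \<open>One growth constant for the source, for \<open>d\<close> and for the majorant
    \<open>\<kappa>\<close>, so that the same \<open>D\<close> bounds both localisation
    errors.\<close>
  define C where "C = aa * (fb + 1) + aa * Gc + (mx + \<eta> * (l * T) + \<eta>)"
  have C: "aa * (fb + 1) \<le> C" "aa * Gc \<le> C" "mx + \<eta> * (l * T) + \<eta> \<le> C" "0 \<le> C"
    using aa Gc fb_nonneg mx \<eta> l0 T_pos by (auto simp: C_def add_nonneg_nonneg)
  define D where "D = 2 * C / e ^ 4 * far_const \<sigma> T y"
  have D: "0 \<le> D" using C e far_const_nonneg[of T \<sigma> y] T_pos by (simp add: D_def)
  show False
  proof (rule small_r_contradiction[of "\<eta> * \<sigma>\<^sup>2" "min e (T - t)" D D])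
    show "0 < \<eta> * \<sigma>\<^sup>2" "0 < min e (T - t)" using \<eta> \<sigma>_pos e tT by auto
    fix r assume r: "0 < r" "r < min e (T - t)"
    then have r': "r < e" "t + r \<le> T" "0 \<le> t + r" "r \<le> T" using t by auto
    have I: "(LBINT s:{0..r}. damp s * P s (k (t + s)) y) \<le> r * (damp r * 0 + D * r\<^sup>2)"
      unfolding D_def
    proof (rule source_le[OF _ _ _ _ _ e(1)])
      show "qbound C (k (t + s))" for s by (rule qbound_weaken[OF qk C(1)])
      show "set_integrable lborel {0..r} (\<lambda>s. damp s * P s (k (t + s)) y)" using r r' by (intro k_int) auto
      show "k (t + s) x \<le> 0" if "0 < s" "s < r" "\<bar>x - y\<bar> \<le> e" for s x
        using e(2)[of s x] that r' by auto
    qed (use C r r' in auto)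
    \<comment> \<open>The penalty at time \<open>t + r\<close> raised by the maximum
      \<open>mx\<close>: it dominates \<open>d (t + r)\<close> at all points of \<open>S\<close>, in
      particular near \<open>y\<close>.\<close>
    define \<kappa> where "\<kappa> x = (mx + \<eta> * (l * (T - t - r))) + \<eta> * (x - 0)\<^sup>2" for x
    have \<kappa>c: "0 \<le> mx + \<eta> * (l * (T - t - r))" "mx + \<eta> * (l * (T - t - r)) \<le> mx + \<eta> * (l * T)"
      using mx \<eta> l0 r' t r by (auto intro!: mult_left_mono add_nonneg_nonneg)
    have q\<kappa>: "qbound C \<kappa>"
    proof (rule qboundI)
      show "\<kappa> \<in> borel_measurable borel" unfolding \<kappa>_def[abs_def] by measurable
      fix x
      have "\<bar>\<kappa> x\<bar> = \<kappa> x" unfolding \<kappa>_def using \<kappa>c(1) \<eta> by simp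
      also have "\<dots> \<le> (mx + \<eta> * (l * T) + \<eta>) * 1 + (mx + \<eta> * (l * T) + \<eta>) * x\<^sup>2"
      proof -
        have "0 \<le> \<eta> * (l * T)" using \<eta> l0 T_pos by simp
        then have "\<eta> \<le> mx + \<eta> * (l * T) + \<eta>" using mx by linarith
        then have "\<eta> * x\<^sup>2 \<le> (mx + \<eta> * (l * T) + \<eta>) * x\<^sup>2" by (intro mult_right_mono) auto
        then show ?thesis unfolding \<kappa>_def diff_0_right mult_1_right using \<kappa>c(2) \<eta> by linarith
      qed
      also have "\<dots> = (mx + \<eta> * (l * T) + \<eta>) * (1 + x\<^sup>2)" by (simp add: distrib_left)
      also have "\<dots> \<le> C * (1 + x\<^sup>2)" using C by (intro mult_right_mono) auto
      finally show "\<bar>\<kappa> x\<bar> \<le> C * (1 + x\<^sup>2)" .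
    qed
    have "P r (d (t + r)) y \<le> P r \<kappa> y + D * r\<^sup>2"
      unfolding D_def
    proof (rule heat_local[OF qbound_weaken[OF qd C(2)] q\<kappa> _ _ e(1)])
      fix x assume "\<bar>x - y\<bar> \<le> e"
      then have "(t + r, x) \<in> S" using e(2)[of r x] r r' by auto
      from top[OF this] show "d (t + r) x \<le> \<kappa> x" by (simp add: \<Phi>_def \<kappa>_def distrib_left algebra_simps)
    qed (use r r' in auto)
    also have "P r \<kappa> y = d t y - \<eta> * \<sigma>\<^sup>2 * r"
    proof -
      have "P r \<kappa> y = P r (\<lambda>x. mx + \<eta> * (l * (T - t - r))) y + P r (\<lambda>x. \<eta> * (x - 0)\<^sup>2) y"
        unfolding \<kappa>_def[abs_def] by (rule heat_add[OF qbound_const qbound_cmult[OF qbound_sq]])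
      also have "\<dots> = mx + \<eta> * (l * (T - t - r)) + \<eta> * (y\<^sup>2 + \<sigma>\<^sup>2 * r)"
        using heat_sq[of r \<sigma> 0 y] r unfolding heat_cmult by simp
      also have "\<dots> = d t y - \<eta> * \<sigma>\<^sup>2 * r" unfolding d_eq l_def by (simp add: algebra_simps)
      finally show ?thesis .
    qed
    finally have II: "damp r * P r (d (t + r)) y \<le> damp r * (d t y - \<eta> * \<sigma>\<^sup>2 * r + D * r\<^sup>2)"
      by (rule mult_left_mono) simp
    \<comment> \<open>Positivity of \<open>d\<close> at the maximum enters here: discounting can
      only lower a nonnegative quantity.\<close>
    have "damp r * (d t y + D * r\<^sup>2) \<le> 1 * (d t y + D * r\<^sup>2)"
      using exp_le_1[of r] r dpos D by (intro mult_right_mono) auto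
    moreover have "damp r * (d t y - \<eta> * \<sigma>\<^sup>2 * r + D * r\<^sup>2) = damp r * (d t y + D * r\<^sup>2) - r * (\<eta> * \<sigma>\<^sup>2 * damp r)"
      by (simp add: algebra_simps)
    ultimately have "r * (\<eta> * \<sigma>\<^sup>2 * damp r) \<le> r * (D * r\<^sup>2) + D * r\<^sup>2"
      using I II flow[OF t(1) _ r'(2), of y] r by simp
    also have "\<dots> = r * (D * r\<^sup>2 + D * r)" by (simp add: distrib_left power2_eq_square mult_ac)
    finally show "\<eta> * \<sigma>\<^sup>2 * damp r \<le> D * r\<^sup>2 + D * r" using r by simp
  qed
qed


section \<open>The four comparisons for a second solution\<close>

lemma closed_epigraph_hypograph:
  fixes c :: "real \<Rightarrow> real"
  assumes c: "continuous_on UNIV c"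
  shows "closed {p. 0 \<le> fst p \<and> fst p \<le> T \<and> c (fst p) \<le> snd p}"
    and "closed {p. 0 \<le> fst p \<and> fst p \<le> T \<and> snd p \<le> c (fst p)}"
proof -
  have "continuous_on UNIV (\<lambda>p :: real \<times> real. c (fst p))"
    by (rule continuous_on_compose2[OF c]) (auto intro!: continuous_intros)
  then show "closed {p. 0 \<le> fst p \<and> fst p \<le> T \<and> c (fst p) \<le> snd p}"
    "closed {p. 0 \<le> fst p \<and> fst p \<le> T \<and> snd p \<le> c (fst p)}"
    by (auto intro!: closed_Collect_conj closed_Collect_le continuous_intros)
qed

lemma cont_lower:
  fixes c :: "real \<Rightarrow> real"
  assumes "continuous_on UNIV c" "y < c t"
  shows "\<exists>e>0. \<forall>s x. 0 < s \<longrightarrow> s < e \<longrightarrow> \<bar>x - y\<bar> \<le> e \<longrightarrow> x \<le> c (t + s)"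
proof -
  have "isCont c t" using assms(1) by (simp add: continuous_on_eq_continuous_at)
  then obtain d where d: "0 < d" "\<And>s. \<bar>s - t\<bar> < d \<Longrightarrow> \<bar>c s - c t\<bar> < (c t - y) / 2"
    unfolding continuous_at_eps_delta dist_real_def using assms(2) by (metis diff_gt_0_iff_gt half_gt_zero)
  show ?thesis
  proof (intro exI[of _ "min d ((c t - y) / 2)"] conjI allI impI)
    show "0 < min d ((c t - y) / 2)" using d assms by simp
    fix s x assume "0 < s" "s < min d ((c t - y) / 2)" "\<bar>x - y\<bar> \<le> min d ((c t - y) / 2)"
    then have "\<bar>x - y\<bar> \<le> (c t - y) / 2" "\<bar>c (t + s) - c t\<bar> < (c t - y) / 2" using d(2)[of "t + s"] by auto
    then show "x \<le> c (t + s)" unfolding abs_le_iff abs_less_iff by (auto simp: field_simps)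
  qed
qed

lemma antimono_upper:
  fixes c :: "real \<Rightarrow> real"
  assumes "\<And>s t. s \<le> t \<Longrightarrow> c t \<le> c s" "c t < y"
  shows "\<exists>e>0. \<forall>s x. 0 < s \<longrightarrow> s < e \<longrightarrow> \<bar>x - y\<bar> \<le> e \<longrightarrow> c (t + s) < x"
proof (intro exI[of _ "(y - c t) / 2"] conjI allI impI)
  show "0 < (y - c t) / 2" using assms by simp
  fix s x :: real assume s: "0 < s" and "\<bar>x - y\<bar> \<le> (y - c t) / 2"
  moreover have "c (t + s) \<le> c t" using s by (intro assms(1)) auto
  ultimately show "c (t + s) < x" using assms(2) unfolding abs_le_iff by (auto simp: field_simps)
qed

text \<open>The test point minimises \<open>c t + L t\<close>, so that afterwards \<open>c\<close> falls at most linearly and the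
  diffusion spends a fixed fraction of any short time strictly between \<open>b\<close> and \<open>c\<close>.\<close>

lemma excess_impossible:
  assumes c: "continuous_on UNIV c" and fc: "\<And>t. 0 \<le> t \<Longrightarrow> t \<le> T \<Longrightarrow> f t \<le> c t"
    and zero: "\<And>t. 0 \<le> t \<Longrightarrow> t \<le> T \<Longrightarrow> G c t (c t) = 0"
    and neg: "\<And>t y. 0 \<le> t \<Longrightarrow> t \<le> T \<Longrightarrow> b t \<le> y \<Longrightarrow> G c t y \<le> 0"
    and t0: "0 \<le> t0" "t0 < T"
  shows "c t0 \<le> b t0"
proof (rule ccontr)
  assume "\<not> c t0 \<le> b t0"
  then have gt: "0 < c t0 - b t0" by simp
  have m[measurable]: "c \<in> borel_measurable borel" by (rule borel_measurable_continuous_onI[OF c])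
  have "isCont (\<lambda>t. c t - b t) t0"
    using c b_cont by (intro continuous_intros) (auto simp: continuous_on_eq_continuous_at)
  then obtain d where d: "0 < d" "\<And>s. \<bar>s - t0\<bar> < d \<Longrightarrow> \<bar>(c s - b s) - (c t0 - b t0)\<bar> < c t0 - b t0"
    unfolding continuous_at_eps_delta dist_real_def using gt by meson
  define t2 where "t2 = t0 + min (d / 2) (T - t0)"
  have t2: "t0 < t2" "t2 \<le> T" "t2 - t0 < d" using d t0 by (auto simp: t2_def)
  have gt2: "b s < c s" if "t0 \<le> s" "s \<le> t2" for s
    using d(2)[of s] that t2 by (simp add: abs_less_iff)
  \<comment> \<open>\<open>L\<close> exceeds the average rate of change of \<open>c\<close> between
    \<open>t0\<close> and \<open>t2\<close>. Hence \<open>c s + L * s\<close> is larger at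
    \<open>t2\<close> than at \<open>t0\<close>, its minimiser lies strictly before
    \<open>t2\<close>, and there is room to the right of it.\<close>
  define L where "L = \<bar>c t0 - c t2\<bar> / (t2 - t0) + 1"
  have L: "0 < L" using t2 by (simp add: L_def add_nonneg_pos)
  have Lt: "c t0 + L * t0 < c t2 + L * t2"
  proof -
    have "c t0 - c t2 < L * (t2 - t0)" using t2 by (simp add: L_def distrib_right abs_if)
    then show ?thesis by (simp add: algebra_simps)
  qed
  have "continuous_on {t0..t2} (\<lambda>s. c s + L * s)" by (intro continuous_intros continuous_on_subset[OF c]) auto
  then obtain t where t: "t \<in> {t0..t2}" "\<And>s. s \<in> {t0..t2} \<Longrightarrow> c t + L * t \<le> c s + L * s"
    using continuous_attains_inf[of "{t0..t2}" "\<lambda>s. c s + L * s"] t2 by auto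
  have "t \<noteq> t2" using t(2)[of t0] Lt t2 by auto
  then have tt: "t0 \<le> t" "t < t2" "0 \<le> t" "t < T" using t(1) t0 t2 by auto
  have slope: "c t - L * s \<le> c (t + s)" if "0 \<le> s" "t + s \<le> t2" for s
    using t(2)[of "t + s"] that tt by (simp add: algebra_simps)
  define y where "y = c t"
  define e where "e = (y - b t) / 2"
  have e: "0 < e" "b t = y - 2 * e" using gt2[of t] tt by (auto simp: e_def y_def field_simps)
  define p where "p = measure stdN {-2..-1::real}"
  have p: "0 < p" unfolding p_def by (rule measure_stdN_pos)
  have Gc: "0 \<le> Gc" using fb_nonneg \<sigma>_pos T_pos by (simp add: Gc_def)
  define C where "C = fb + 1 + Gc + e"
  have C: "fb + 1 \<le> C" "Gc \<le> C" "e \<le> C" "0 \<le> C" using Gc e fb_nonneg by (auto simp: C_def)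
  define D where "D = 2 * C / e ^ 4 * far_const \<sigma> T y"
  have D: "0 \<le> D" using C e far_const_nonneg[of T \<sigma> y] T_pos by (simp add: D_def)
  \<comment> \<open>The three bounds keep the motion inside the range of the slope estimate, give
    \<open>L * s \<le> \<sigma> * sqrt s\<close>, so that one standard deviation covers the fall of
    \<open>c\<close>, and give \<open>2 * (\<sigma> * sqrt s) \<le> e\<close>, so that two standard
    deviations stay above \<open>b\<close>.\<close>
  define r0 where "r0 = min (t2 - t) (min ((\<sigma> / L)\<^sup>2) ((e / (2 * \<sigma>))\<^sup>2))"
  have r0: "0 < r0" using tt \<sigma>_pos L e by (simp add: r0_def)
  show False
  proof (rule small_r_contradiction[of "e * p" r0 D D])
    show "0 < e * p" using e p by simp
    show "0 < r0" by (rule r0)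
    fix r assume r: "0 < r" "r < r0"
    then have r': "t + r \<le> t2" "t + r \<le> T" "r \<le> T" using t2 tt by (auto simp: r0_def)
    have src: "P s (q c (t + s)) y \<le> - (e * p) + D * s\<^sup>2" if s: "0 < s" "s < r" for s
    proof -
      have sL: "L * s \<le> \<sigma> * sqrt s" and sE: "2 * (\<sigma> * sqrt s) \<le> e"
      proof -
        have "s \<le> (\<sigma> / L)\<^sup>2" "s \<le> (e / (2 * \<sigma>))\<^sup>2" using s r by (auto simp: r0_def)
        then have "sqrt s \<le> \<sigma> / L" "sqrt s \<le> e / (2 * \<sigma>)" using \<sigma>_pos L e by (auto intro!: real_le_lsqrt)
        then have a: "L * sqrt s \<le> \<sigma>" "2 * (\<sigma> * sqrt s) \<le> e" using \<sigma>_pos L by (auto simp: field_simps)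
        have "L * s = L * sqrt s * sqrt s" using s by simp
        also have "\<dots> \<le> \<sigma> * sqrt s" using a(1) s by (intro mult_right_mono) auto
        finally show "L * s \<le> \<sigma> * sqrt s" .
        show "2 * (\<sigma> * sqrt s) \<le> e" by (rule a(2))
      qed
      \<comment> \<open>A majorant of the source near \<open>y\<close>: points within
        \<open>e\<close> of \<open>y\<close> lie at least \<open>e\<close> above \<open>f\<close>,
        so the source is at most \<open>- e\<close> where it is active and never positive; one to
        two standard deviations down the point is certainly below \<open>c\<close>.\<close>
      define \<kappa> where "\<kappa> x = - e * indicator {y - 2 * (\<sigma> * sqrt s)..y - \<sigma> * sqrt s} x" for x
      have q\<kappa>: "qbound C \<kappa>"
      proof (rule qboundI)
        show "\<kappa> \<in> borel_measurable borel" unfolding \<kappa>_def[abs_def] by measurable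
        fix x
        have "\<bar>\<kappa> x\<bar> \<le> C * 1" using C e by (simp add: \<kappa>_def indicator_def)
        also have "\<dots> \<le> C * (1 + x\<^sup>2)" using C by (intro mult_left_mono) auto
        finally show "\<bar>\<kappa> x\<bar> \<le> C * (1 + x\<^sup>2)" .
      qed
      have "P s (q c (t + s)) y \<le> P s \<kappa> y + D * s\<^sup>2"
        unfolding D_def
      proof (rule heat_local[OF qbound_weaken[OF q_qbound[OF m] C(1)] q\<kappa> _ _ e(1)])
        fix x assume x: "\<bar>x - y\<bar> \<le> e"
        have "b (t + s) \<le> b t" using s by (intro b_antimono) auto
        moreover have "f (t + s) \<le> b (t + s)" using s r' tt by (intro f_le_b) auto
        ultimately have fx: "f (t + s) - x \<le> - e" using x e(2) by (simp add: abs_le_iff)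
        show "q c (t + s) x \<le> \<kappa> x"
        proof (cases "x \<in> {y - 2 * (\<sigma> * sqrt s)..y - \<sigma> * sqrt s}")
          case True
          then have "x \<le> y - L * s" using sL by simp
          also have "\<dots> \<le> c (t + s)" unfolding y_def using s r' by (intro slope) auto
          finally show ?thesis using True fx by (simp add: q_def \<kappa>_def)
        next
          case False
          then show ?thesis using fx e by (simp add: q_def \<kappa>_def)
        qed
      qed (use s r' in auto)
      also have "P s \<kappa> y = - (e * p)"
      proof -
        have "\<kappa> (y + \<sigma> * sqrt s * z) = - e * indicator {-2..-1} z" for z
        proof -
          have sg: "0 < \<sigma> * sqrt s" using \<sigma>_pos s by simp
          have "y - 2 * (\<sigma> * sqrt s) \<le> y + \<sigma> * sqrt s * z \<longleftrightarrow> (\<sigma> * sqrt s) * (-2) \<le> (\<sigma> * sqrt s) * z" by auto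
          also have "\<dots> \<longleftrightarrow> -2 \<le> z" by (rule mult_le_cancel_left_pos[OF sg])
          finally have 1: "y - 2 * (\<sigma> * sqrt s) \<le> y + \<sigma> * sqrt s * z \<longleftrightarrow> -2 \<le> z" .
          have "y + \<sigma> * sqrt s * z \<le> y - \<sigma> * sqrt s \<longleftrightarrow> (\<sigma> * sqrt s) * z \<le> (\<sigma> * sqrt s) * (-1)" by auto
          also have "\<dots> \<longleftrightarrow> z \<le> -1" by (rule mult_le_cancel_left_pos[OF sg])
          finally have 2: "y + \<sigma> * sqrt s * z \<le> y - \<sigma> * sqrt s \<longleftrightarrow> z \<le> -1" .
          show ?thesis by (simp only: \<kappa>_def indicator_def atLeastAtMost_iff 1 2)
        qed
        then show ?thesis by (simp add: heat_def p_def)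
      qed
      finally show ?thesis .
    qed
    have I: "(LBINT s:{0..r}. damp s * P s (q c (t + s)) y) \<le> r * (damp r * - (e * p) + D * r\<^sup>2)"
      using e p r r' by (intro source_le_pointwise D src heat_q_integral(1) m) auto
    have "P r (G c (t + r)) y \<le> P r (\<lambda>x. 0) y + D * r\<^sup>2"
      unfolding D_def
    proof (rule heat_local[OF qbound_weaken[OF G_qbound[OF m] C(2)] _ _ _ e(1)])
      show "qbound C (\<lambda>x. 0)" using C by (intro qboundI) auto
      fix x assume "\<bar>x - y\<bar> \<le> e"
      then have "b t \<le> x" using e unfolding abs_le_iff by linarith
      then have "b (t + r) \<le> x" using b_antimono[of t "t + r"] r by simp
      then show "G c (t + r) x \<le> 0" using r r' tt by (intro neg) auto
    qed (use r r' tt in auto)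
    then have "damp r * P r (G c (t + r)) y \<le> damp r * (D * r\<^sup>2)" by (intro mult_left_mono) auto
    also have "\<dots> \<le> 1 * (D * r\<^sup>2)" using r by (intro mult_right_mono[OF exp_le_1 mult_nonneg_nonneg[OF D zero_le_power2]]) auto
    finally have II: "damp r * P r (G c (t + r)) y \<le> D * r\<^sup>2" by simp
    have "G c t y = 0" unfolding y_def using tt by (intro zero) auto
    then have "0 \<le> r * (damp r * - (e * p) + D * r\<^sup>2) + D * r\<^sup>2"
      using I II G_flow[OF m tt(3) _ r'(2), of y] r by simp
    also have "\<dots> = r * (damp r * - (e * p) + D * r\<^sup>2 + D * r)" by (simp add: distrib_left power2_eq_square mult_ac)
    finally have "0 \<le> damp r * - (e * p) + D * r\<^sup>2 + D * r" using r by (simp add: zero_le_mult_iff)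
    then show "e * p * damp r \<le> D * r\<^sup>2 + D * r" by (simp add: mult.commute)
  qed
qed

theorem boundary_unique:
  assumes c: "continuous_on UNIV c" and anti: "\<And>s t. s \<le> t \<Longrightarrow> c t \<le> c s"
    and fc: "\<And>t. 0 \<le> t \<Longrightarrow> t \<le> T \<Longrightarrow> f t \<le> c t"
    and zero: "\<And>t. 0 \<le> t \<Longrightarrow> t \<le> T \<Longrightarrow> G c t (c t) = 0"
    and t: "0 \<le> t" "t \<le> T"
  shows "c t = b t"
proof -
  have GT: "G c' T y = 0" for c' y by (simp add: G_def)
  have above: "G c t y = 0" if "0 \<le> t" "t \<le> T" "c t \<le> y" for t y
  proof -
    let ?S = "{p. 0 \<le> fst p \<and> fst p \<le> T \<and> c (fst p) \<le> snd p}"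
    \<comment> \<open>Above \<open>c\<close> the source vanishes, so \<open>G c\<close> and
      \<open>- G c\<close> both satisfy the interior condition; on the curve itself the equation
      gives 0. The signs \<open>a = 1\<close> and \<open>a = -1\<close> together give
      equality.\<close>
    have side: "a * G c t y + 0 * G c t y \<le> 0" for a :: real
    proof (rule max_principle[OF c c closed_epigraph_hypograph(1)[OF c]])
      show "(t, y) \<in> ?S" using that by simp
      fix t y assume S: "(t, y) \<in> ?S" and pos: "0 < a * G c t y + 0 * G c t y"
      have "c t \<noteq> y" using zero[of t] S pos by auto
      then have "c t < y" using S by auto
      from antimono_upper[of c, OF anti this] obtain e where e: "0 < e"
        "\<And>s x. 0 < s \<Longrightarrow> s < e \<Longrightarrow> \<bar>x - y\<bar> \<le> e \<Longrightarrow> c (t + s) < x" by blast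
      show "\<exists>e>0. \<forall>s x. 0 < s \<longrightarrow> s < e \<longrightarrow> t + s \<le> T \<longrightarrow> \<bar>x - y\<bar> \<le> e \<longrightarrow>
          (t + s, x) \<in> ?S \<and> a * q c (t + s) x + 0 * q c (t + s) x \<le> 0"
        using e S by (intro exI[of _ e]) (auto simp: q_def not_le dest: e(2) intro: less_imp_le)
    qed auto
    from side[of 1] side[of "-1"] show ?thesis by simp
  qed
  have le_u: "G c t y \<le> u t y" if t: "0 \<le> t" "t \<le> T" for t y
  proof (cases "c t \<le> y")
    case True
    then show ?thesis using above t u_nonneg by simp
  next
    case False
    let ?S = "{p. 0 \<le> fst p \<and> fst p \<le> T \<and> snd p \<le> c (fst p)}"
    \<comment> \<open>Below \<open>c\<close> the two sources cancel up to \<open>b\<close>, and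
      beyond \<open>b\<close> the difference is \<open>f - x\<close>, which is not positive since
      \<open>f \<le> b\<close>. On the curve \<open>c\<close> the first term vanishes and
      \<open>u\<close> is nonnegative, so a positive value must lie strictly below it.\<close>
    have "1 * G c t y + - 1 * G b t y \<le> 0"
    proof (rule max_principle[OF c b_cont closed_epigraph_hypograph(2)[OF c]])
      show "(t, y) \<in> ?S" using t False by simp
      fix t y assume S: "(t, y) \<in> ?S" and pos: "0 < 1 * G c t y + - 1 * G b t y"
      have t': "0 \<le> t" "t \<le> T" using S by auto
      have "y \<noteq> c t" using zero[OF t'] u_nonneg[OF t', of y] u_eq_G[OF t', of y] pos by auto
      then have "y < c t" using S by auto
      from cont_lower[OF c this] obtain e where e: "0 < e"
        "\<And>s x. 0 < s \<Longrightarrow> s < e \<Longrightarrow> \<bar>x - y\<bar> \<le> e \<Longrightarrow> x \<le> c (t + s)" by blast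
      show "\<exists>e>0. \<forall>s x. 0 < s \<longrightarrow> s < e \<longrightarrow> t + s \<le> T \<longrightarrow> \<bar>x - y\<bar> \<le> e \<longrightarrow>
          (t + s, x) \<in> ?S \<and> 1 * q c (t + s) x + - 1 * q b (t + s) x \<le> 0"
      proof (intro exI[of _ e] conjI allI impI e(1))
        fix s x assume s: "0 < s" "s < e" "t + s \<le> T" "\<bar>x - y\<bar> \<le> e"
        have x: "x \<le> c (t + s)" using s by (intro e)
        then show "(t + s, x) \<in> ?S" using s t' by simp
        show "1 * q c (t + s) x + - 1 * q b (t + s) x \<le> 0"
          using x f_le_b[of "t + s"] s t' by (auto simp: q_def)
      qed
    qed auto
    then show ?thesis using u_eq_G[OF t] by simp
  qed
  have neg: "G c t y \<le> 0" if t: "0 \<le> t" "t \<le> T" "b t \<le> y" for t y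
    using le_u[OF t(1,2), of y] u_zero_above[OF t] by simp
  have le: "c t \<le> b t" if "0 \<le> t" "t < T" for t
    by (rule excess_impossible[OF c fc zero neg that])
  have ge: "b t \<le> c t" if t: "0 \<le> t" "t < T" for t
  proof (rule ccontr)
    assume "\<not> b t \<le> c t"
    then obtain y where y: "c t < y" "y < b t" using dense[of "c t" "b t"] by auto
    let ?S = "{p. 0 \<le> fst p \<and> fst p \<le> T \<and> snd p \<le> b (fst p)}"
    \<comment> \<open>The roles are exchanged on the region below \<open>b\<close>, with
      \<open>f \<le> c\<close> giving the sign. On the curve \<open>b\<close> both terms vanish:
      \<open>G c\<close> does so because the point lies above \<open>c\<close> by
      \<open>c t \<le> b t\<close>, known for \<open>t < T\<close>.\<close>
    have "1 * G b t y + - 1 * G c t y \<le> 0"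
    proof (rule max_principle[OF b_cont c closed_epigraph_hypograph(2)[OF b_cont]])
      show "(t, y) \<in> ?S" using t y by simp
      fix t y assume S: "(t, y) \<in> ?S" and pos: "0 < 1 * G b t y + - 1 * G c t y" and tT: "t < T"
      have t': "0 \<le> t" "t \<le> T" using S by auto
      have "y \<noteq> b t"
      proof
        assume "y = b t"
        then have "G b t y = 0" "G c t y = 0"
          using u_zero_above[OF t'] u_eq_G[OF t', of y] above[OF t'] le[OF t'(1) tT] by auto
        then show False using pos by simp
      qed
      then have "y < b t" using S by auto
      from cont_lower[OF b_cont this] obtain e where e: "0 < e"
        "\<And>s x. 0 < s \<Longrightarrow> s < e \<Longrightarrow> \<bar>x - y\<bar> \<le> e \<Longrightarrow> x \<le> b (t + s)" by blast
      show "\<exists>e>0. \<forall>s x. 0 < s \<longrightarrow> s < e \<longrightarrow> t + s \<le> T \<longrightarrow> \<bar>x - y\<bar> \<le> e \<longrightarrow>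
          (t + s, x) \<in> ?S \<and> 1 * q b (t + s) x + - 1 * q c (t + s) x \<le> 0"
      proof (intro exI[of _ e] conjI allI impI e(1))
        fix s x assume s: "0 < s" "s < e" "t + s \<le> T" "\<bar>x - y\<bar> \<le> e"
        have x: "x \<le> b (t + s)" using s by (intro e)
        then show "(t + s, x) \<in> ?S" using s t' by simp
        show "1 * q b (t + s) x + - 1 * q c (t + s) x \<le> 0"
          using x fc[of "t + s"] s t' by (auto simp: q_def)
      qed
    qed auto
    then have "u t y \<le> 0" using u_eq_G[of t y] above[of t y] t y by simp
    then show False using u_pos_iff[OF t, of y] y by simp
  qed
  have eq: "c t = b t" if "0 \<le> t" "t < T" for t
    using le[OF that] ge[OF that] by simp
  show ?thesis
  proof (cases "t = T")
    case False
    then show ?thesis using eq t by simp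
  next
    case True
    \<comment> \<open>At \<open>T\<close> the equation is void, because \<open>G\<close> vanishes
      there for every boundary; equality comes from continuity along times increasing to
      \<open>T\<close>.\<close>
    have s: "(\<lambda>n. T - mesh 0 n) \<longlonglongrightarrow> T - 0" by (intro tendsto_intros mesh T_pos)
    have "0 \<le> T - mesh 0 n \<and> T - mesh 0 n < T" for n
      using mesh(1)[OF T_pos, of n] T_pos by (simp add: mesh_def field_simps)
    then have "c (T - mesh 0 n) = b (T - mesh 0 n)" for n by (intro eq) auto
    moreover have "(\<lambda>n. c (T - mesh 0 n)) \<longlonglongrightarrow> c T" "(\<lambda>n. b (T - mesh 0 n)) \<longlonglongrightarrow> b T"
      using s c b_cont by (auto intro!: isCont_tendsto_compose[of T] simp: continuous_on_eq_continuous_at)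
    ultimately show ?thesis using True LIMSEQ_unique by simp
  qed
qed


section \<open>The integral equation\<close>

text \<open>The terminal cost is written as \<open>K\<close> minus the discounted integral of
  \<open>\<rho> * K\<close>, which turns the cost of each stopping time into
  \<open>K - J t y \<tau>\<close>. The infimum of these costs is \<open>K\<close> minus the supremum
  of the gains.\<close>

lemma value_fun_eq:
  assumes f\<theta>: "\<And>s. 0 \<le> s \<Longrightarrow> s \<le> T \<Longrightarrow> f s = \<alpha> * (2 - \<alpha>) * \<theta> s + \<rho> * K" and t: "0 \<le> t" "t \<le> T"
  shows "value_fun M F W T \<sigma> \<rho> K \<alpha> \<theta> t y = K - u t y"
proof -
  let ?V = "\<lambda>\<tau> \<omega>. (LBINT s:{0..\<tau> \<omega>}. damp s * (X y s \<omega> - \<alpha> * (2 - \<alpha>) * \<theta> (s + t))) + K * damp (\<tau> \<omega>)"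
  have payoff: "expectation (?V \<tau>) = K - J t y \<tau>" if \<tau>: "\<tau> \<in> stopping_times_upto M F (T - t)" for \<tau>
  proof -
    note fub = payoff_fubini[OF \<tau> f_shift_cont[of UNIV t] f_bound order.strict_implies_order[OF \<rho>_pos], of y]
    let ?Z = "\<lambda>\<omega>. LBINT s:{0..\<tau> \<omega>}. damp s * (f (t + s) - X y s \<omega>)"
    have ae: "AE \<omega> in M. ?V \<tau> \<omega> = K - ?Z \<omega>"
      using fub(4) AE_space
    proof eventually_elim
      case (elim \<omega>)
      have \<tau>\<omega>: "0 \<le> \<tau> \<omega>" "\<tau> \<omega> \<le> T - t" using stopping_times_uptoD(2)[OF \<tau> elim(2)] by auto
      have "(LBINT s:{0..\<tau> \<omega>}. damp s * (X y s \<omega> - \<alpha> * (2 - \<alpha>) * \<theta> (s + t)))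
          = (LBINT s:{0..\<tau> \<omega>}. damp s * (\<rho> * K) - damp s * (f (t + s) - X y s \<omega>))"
      proof (rule set_lebesgue_integral_cong, simp, intro allI impI)
        fix s assume "s \<in> {0..\<tau> \<omega>}"
        then have fs: "f (t + s) = \<alpha> * (2 - \<alpha>) * \<theta> (s + t) + \<rho> * K" using \<tau>\<omega> t f\<theta>[of "t + s"] by (simp add: add.commute)
        show "damp s * (X y s \<omega> - \<alpha> * (2 - \<alpha>) * \<theta> (s + t)) = damp s * (\<rho> * K) - damp s * (f (t + s) - X y s \<omega>)"
          unfolding fs by (simp add: algebra_simps)
      qed
      also have "\<dots> = (LBINT s:{0..\<tau> \<omega>}. damp s * (\<rho> * K)) - ?Z \<omega>"
        by (rule set_integral_diff(2)[OF _ elim(1)]) (intro set_integrable_mult_left disc_integrable)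
      also have "(LBINT s:{0..\<tau> \<omega>}. damp s * (\<rho> * K)) = (\<rho> * disc (\<tau> \<omega>)) * K"
        by (simp add: disc_def)
      also have "\<dots> = K - K * damp (\<tau> \<omega>)" unfolding disc_eq[OF \<tau>\<omega>(1)] by (simp add: algebra_simps)
      finally show ?case by simp
    qed
    have m: "(\<lambda>\<omega>. K - ?Z \<omega>) \<in> borel_measurable M" using borel_measurable_integrable[OF fub(2)] by measurable
    have "expectation (?V \<tau>) = expectation (\<lambda>\<omega>. K - ?Z \<omega>)"
      by (rule integral_cong_AE[OF borel_measurable_AE[OF m ae] m ae])
    also have "\<dots> = K - expectation ?Z" using fub(2) by (simp add: prob_space)
    finally show ?thesis unfolding J_eq_expectation[OF \<tau>] .
  qed
  have "value_fun M F W T \<sigma> \<rho> K \<alpha> \<theta> t y = (INF \<tau>\<in>stopping_times_upto M F (T - t). K - J t y \<tau>)"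
    unfolding value_fun_def by (intro INF_cong refl payoff)
  also have "\<dots> = K - u t y"
  proof (rule antisym)
    have ne: "stopping_times_upto M F (T - t) \<noteq> {}" using zero_stopping[of "T - t"] t by auto
    show "K - u t y \<le> (INF \<tau>\<in>stopping_times_upto M F (T - t). K - J t y \<tau>)"
      using u_upper t by (intro cINF_greatest ne) auto
    have "u t y \<le> K - (INF \<tau>\<in>stopping_times_upto M F (T - t). K - J t y \<tau>)"
    proof (rule u_least[OF t(2)])
      fix \<tau> assume \<tau>: "\<tau> \<in> stopping_times_upto M F (T - t)"
      have "(INF \<tau>\<in>stopping_times_upto M F (T - t). K - J t y \<tau>) \<le> K - J t y \<tau>"
        using u_upper t by (intro cINF_lower[OF _ \<tau>] bdd_belowI2[where m = "K - u t y"]) auto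
      then show "J t y \<tau> \<le> K - (INF \<tau>\<in>stopping_times_upto M F (T - t). K - J t y \<tau>)" by simp
    qed
    then show "(INF \<tau>\<in>stopping_times_upto M F (T - t). K - J t y \<tau>) \<le> K - u t y" by simp
  qed
  finally show ?thesis .
qed

text \<open>Before \<open>T\<close>, value at least \<open>K\<close> means \<open>u \<le> 0\<close>,
  which is the half-line above \<open>b\<close>. At \<open>T\<close> the left limit in the
  definition is evaluated by continuity of \<open>b\<close>.\<close>

lemma free_boundary_eq:
  assumes f\<theta>: "\<And>s. 0 \<le> s \<Longrightarrow> s \<le> T \<Longrightarrow> f s = \<alpha> * (2 - \<alpha>) * \<theta> s + \<rho> * K" and t: "0 \<le> t" "t \<le> T"
  shows "free_boundary M F W T \<sigma> \<rho> K \<alpha> \<theta> t = ereal (b t)"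
proof -
  let ?b = "\<lambda>u. Inf {ereal y | y. value_fun M F W T \<sigma> \<rho> K \<alpha> \<theta> u y \<ge> K}"
  have eq: "?b s = ereal (b s)" if s: "0 \<le> s" "s < T" for s
  proof (rule Inf_eqI)
    have *: "value_fun M F W T \<sigma> \<rho> K \<alpha> \<theta> s y \<ge> K \<longleftrightarrow> b s \<le> y" for y
      using u_pos_iff[OF s, of y] value_fun_eq[OF f\<theta>, of s y] s by auto
    show "ereal (b s) \<le> i" if "i \<in> {ereal y | y. value_fun M F W T \<sigma> \<rho> K \<alpha> \<theta> s y \<ge> K}" for i
      using that by (auto simp: *)
    show "z \<le> ereal (b s)" if "\<And>i. i \<in> {ereal y | y. value_fun M F W T \<sigma> \<rho> K \<alpha> \<theta> s y \<ge> K} \<Longrightarrow> z \<le> i" for z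
      using that by (auto simp: *)
  qed
  show ?thesis
  proof (cases "t < T")
    case True
    then show ?thesis using eq[OF t(1)] by (simp add: free_boundary_def Let_def)
  next
    case False
    then have tT: "t = T" using t by simp
    have "(b \<longlongrightarrow> b T) (at_left T)"
      using b_cont by (auto simp: continuous_on_eq_continuous_at isCont_def intro: tendsto_within_subset)
    then have l: "((\<lambda>s. ereal (b s)) \<longlongrightarrow> ereal (b T)) (at_left T)" by (rule tendsto_ereal)
    have "\<forall>\<^sub>F s in at_left T. ?b s = ereal (b s)"
      unfolding eventually_at_left_field using eq T_pos by (intro exI[of _ 0]) auto
    then have "(?b \<longlongrightarrow> ereal (b T)) (at_left T)"
      using l by (subst tendsto_cong)
    then have "Lim (at_left T) ?b = ereal (b T)" by (intro tendsto_Lim) auto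
    then show ?thesis using tT by (simp add: free_boundary_def Let_def)
  qed
qed

text \<open>The integrand of the equation is the negative of the source \<open>q\<close>. A
  candidate \<open>\<beta>\<close> is constrained on \<open>[0,T]\<close> alone, so a Borel function
  \<open>c\<close> agreeing with it there is used in \<open>G\<close>.\<close>

lemma boundary_lhs_eq:
  assumes f\<theta>: "\<And>s. 0 \<le> s \<Longrightarrow> s \<le> T \<Longrightarrow> f s = \<alpha> * (2 - \<alpha>) * \<theta> s + \<rho> * K" and t: "0 \<le> t" "t \<le> T"
    and c[measurable]: "c \<in> borel_measurable borel" and cb: "\<And>s. 0 \<le> s \<Longrightarrow> s \<le> T \<Longrightarrow> c s = \<beta> s"
  shows "boundary_lhs M W T \<sigma> \<rho> K \<alpha> \<theta> \<beta> t = - G c t (c t)"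
proof -
  let ?k = "\<lambda>s \<omega> x. - (damp s * q c (t + s) x)"
  have km: "(\<lambda>p. ?k (fst p) (fst (snd p)) (snd (snd p))) \<in> borel_measurable (borel \<Otimes>\<^sub>M (M \<Otimes>\<^sub>M borel))"
    by measurable
  have kb: "\<bar>?k s \<omega> x\<bar> \<le> fb + \<bar>x\<bar>" if s: "0 \<le> s" for s x and \<omega> :: 'a
  proof -
    have "\<bar>?k s \<omega> x\<bar> \<le> 1 * \<bar>q c (t + s) x\<bar>"
      unfolding abs_minus_cancel abs_mult using exp_le_1[OF s] by (intro mult_mono) auto
    then show ?thesis using q_bound[of c "t + s" x] by simp
  qed
  have "boundary_lhs M W T \<sigma> \<rho> K \<alpha> \<theta> \<beta> t = expectation (\<lambda>\<omega>. LBINT s:{0..T - t}. ?k s \<omega> (X (c t) s \<omega>))"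
    unfolding boundary_lhs_def
  proof (intro Bochner_Integration.integral_cong refl set_lebesgue_integral_cong, simp, intro allI impI)
    fix \<omega> s assume s: "s \<in> {0..T - t}"
    then have eqs: "f (t + s) = \<alpha> * (2 - \<alpha>) * \<theta> (t + s) + \<rho> * K" "\<beta> (t + s) = c (t + s)" "\<beta> t = c t"
      using t f\<theta>[of "t + s"] cb[of "t + s"] cb[of t] by auto
    show "damp s * (X_proc \<sigma> W (\<beta> t) s \<omega> - \<alpha> * (2 - \<alpha>) * \<theta> (t + s) - \<rho> * K)
       * indicator {..\<beta> (t + s)} (X_proc \<sigma> W (\<beta> t) s \<omega>) = ?k s \<omega> (X (c t) s \<omega>)"
      unfolding q_def eqs by (simp add: indicator_def algebra_simps)
  qed
  also have "\<dots> = (LBINT s:{0..T - t}. expectation (\<lambda>\<omega>. ?k s \<omega> (X (c t) s \<omega>)))"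
    by (rule path_fubini(1)[OF km kb])
  also have "\<dots> = (LBINT s:{0..T - t}. - (damp s * P s (q c (t + s)) (c t)))"
    using expectation_X[OF q_qbound[OF c]] by (intro set_lebesgue_integral_cong) auto
  also have "\<dots> = - G c t (c t)" by (simp add: G_def set_lebesgue_integral_def)
  finally show ?thesis .
qed

end

theorem theorem4p14:
  fixes M :: "'a measure" and F :: "real \<Rightarrow> 'a measure" and W :: "real \<Rightarrow> 'a \<Rightarrow> real"
    and T \<sigma> \<rho> K x \<alpha> \<delta> :: real and \<theta> :: "real \<Rightarrow> real"
  assumes "filtered_brownian_motion M F W"
    and "0 < T" and "0 < \<sigma>" and "0 < \<rho>" and "0 < K" and "0 < \<delta>"
    and "0 < \<alpha>" and "\<alpha> < 2"
    and "\<theta> \<in> E_tilde T x \<delta>"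
  shows "\<exists>b :: real \<Rightarrow> real.
    (\<forall>t\<in>{0..T}. free_boundary M F W T \<sigma> \<rho> K \<alpha> \<theta> t = ereal (b t)) \<and>
    continuous_on {0..T} b \<and> antimono_on {0..T} b \<and>
    solves_boundary_equation M W T \<sigma> \<rho> K \<alpha> \<theta> b \<and>
    b \<in> solution_class T \<rho> K \<alpha> \<theta> \<and>
    (\<forall>c \<in> solution_class T \<rho> K \<alpha> \<theta>. solves_boundary_equation M W T \<sigma> \<rho> K \<alpha> \<theta> c
       \<longrightarrow> (\<forall>t\<in>{0..T}. c t = b t))"
proof -
  \<comment> \<open>Clamping the time to \<open>[0,T]\<close> extends \<open>\<theta>\<close>, and
    later any competitor \<open>c\<close>, by constants: continuity and monotonicity carry over, and
    nothing changes on \<open>[0,T]\<close>.\<close>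
  define cl where "cl s = max 0 (min T s)" for s :: real
  have cl: "cl s \<in> {0..T}" "s \<le> s' \<Longrightarrow> cl s \<le> cl s'" "s \<in> {0..T} \<Longrightarrow> cl s = s" for s s'
    using assms(2) by (auto simp: cl_def)
  have cl_cont: "continuous_on UNIV cl" unfolding cl_def[abs_def] by (intro continuous_intros)
  have cl_comp: "continuous_on UNIV (\<lambda>s. g (cl s))" if "continuous_on {0..T} g" for g :: "real \<Rightarrow> real"
    by (rule continuous_on_compose2[OF that cl_cont]) (use cl in auto)
  define a where "a = \<alpha> * (2 - \<alpha>)"
  have a: "0 < a" using assms by (simp add: a_def)
  have \<theta>: "continuous_on {0..T} \<theta>" "antimono_on {0..T} \<theta>" "\<And>s. s \<in> {0..T} \<Longrightarrow> x - \<delta> \<le> \<theta> s \<and> \<theta> s \<le> x"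
    using assms(9) by (auto simp: E_tilde_def E_set_def Theta_def)
  define f where "f s = a * \<theta> (cl s) + \<rho> * K" for s
  define fb where "fb = a * (\<bar>x\<bar> + \<delta>) + \<rho> * K"
  interpret stopping_problem M F W \<sigma> T \<rho> fb f
  proof (intro stopping_problem.intro diffusion.intro assms(1) diffusion_axioms.intro stopping_problem_axioms.intro assms(2-4))
    show "continuous_on UNIV f" unfolding f_def[abs_def] by (intro continuous_intros cl_comp \<theta>(1))
    show "f t \<le> f s" if "s \<le> t" for s t
      unfolding f_def using monotone_onD[OF \<theta>(2) cl(1) cl(1) cl(2)[OF that]] a by (intro add_right_mono mult_left_mono) auto
    show "\<bar>f s\<bar> \<le> fb" for s
    proof -
      have "\<bar>\<theta> (cl s)\<bar> \<le> \<bar>x\<bar> + \<delta>" using \<theta>(3)[OF cl(1), of s] assms(6) by (auto simp: abs_le_iff)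
      then have "a * \<bar>\<theta> (cl s)\<bar> \<le> a * (\<bar>x\<bar> + \<delta>)" using a by (intro mult_left_mono) auto
      moreover have "\<bar>f s\<bar> \<le> \<bar>a * \<theta> (cl s)\<bar> + \<bar>\<rho> * K\<bar>" unfolding f_def by (rule abs_triangle_ineq)
      moreover have "\<bar>a * \<theta> (cl s)\<bar> = a * \<bar>\<theta> (cl s)\<bar>" "\<bar>\<rho> * K\<bar> = \<rho> * K" using a assms(4,5) by (auto simp: abs_mult)
      ultimately show ?thesis unfolding fb_def by linarith
    qed
  qed
  have f\<theta>: "f s = \<alpha> * (2 - \<alpha>) * \<theta> s + \<rho> * K" if "0 \<le> s" "s \<le> T" for s
    using cl(3)[of s] that by (simp add: f_def a_def)
  have b_zero: "boundary_lhs M W T \<sigma> \<rho> K \<alpha> \<theta> b t = 0" if t: "0 \<le> t" "t \<le> T" for t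
    using boundary_lhs_eq[OF f\<theta> t b_measurable, of b] u_eq_G[OF t, of "b t"] u_zero_above[OF t] by simp
  have anti: "antimono_on {0..T} b" using b_antimono by (auto intro!: monotone_onI)
  have unique: "c t = b t"
    if c: "c \<in> solution_class T \<rho> K \<alpha> \<theta>" "solves_boundary_equation M W T \<sigma> \<rho> K \<alpha> \<theta> c" and t: "t \<in> {0..T}" for c t
  proof -
    have c': "continuous_on {0..T} c" "antimono_on {0..T} c" "\<And>t. t \<in> {0..T} \<Longrightarrow> \<alpha> * (2 - \<alpha>) * \<theta> t + \<rho> * K \<le> c t"
      using c(1) by (auto simp: solution_class_def)
    have cc: "continuous_on UNIV (\<lambda>s. c (cl s))" by (rule cl_comp[OF c'(1)])
    have eq: "c (cl s) = c s" if "0 \<le> s" "s \<le> T" for s using cl(3)[of s] that by simp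
    have "c (cl t) = b t"
    proof (rule boundary_unique[OF cc])
      show "c (cl t) \<le> c (cl s)" if "s \<le> t" for s t
        using monotone_onD[OF c'(2) cl(1) cl(1) cl(2)[OF that]] .
      show "f s \<le> c (cl s)" if "0 \<le> s" "s \<le> T" for s
        using f\<theta>[OF that] c'(3)[of s] eq[OF that] that by simp
      show "G (\<lambda>s. c (cl s)) s (c (cl s)) = 0" if "0 \<le> s" "s \<le> T" for s
        using boundary_lhs_eq[OF f\<theta> that borel_measurable_continuous_onI[OF cc] eq] c(2) that
        by (simp add: solves_boundary_equation_def)
    qed (use t in auto)
    then show ?thesis using eq t by simp
  qed
  have cont: "continuous_on {0..T} b" by (rule continuous_on_subset[OF b_cont]) simp
  have mem: "b \<in> solution_class T \<rho> K \<alpha> \<theta>"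
    using cont anti f_le_b f\<theta> by (auto simp: solution_class_def)
  show ?thesis
  proof (intro exI[of _ b] conjI ballI impI)
    show "free_boundary M F W T \<sigma> \<rho> K \<alpha> \<theta> t = ereal (b t)" if "t \<in> {0..T}" for t
      using that by (intro free_boundary_eq[OF f\<theta>]) auto
    show "solves_boundary_equation M W T \<sigma> \<rho> K \<alpha> \<theta> b"
      unfolding solves_boundary_equation_def using b_zero by auto
  qed (use cont anti mem unique in auto)
qed

end
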